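(* Let $(\omega,J,g)$ be a compatible triple on a Lie algebroid $\mathcal{A}$ over $M$ and let $\Lambda$ be the symplectic generalized distribution of $(\mathcal{A},\omega)$ on $M$. Then for every integral submanifold $\mathcal{O}$ of $\Lambda$ and all $f,h\in C^\infty(M)$, $$\{f,h\}|_{\mathcal{O}}=\{f|_{\mathcal{O}},h|_{\mathcal{O}}\}_{\mathcal{O}},$$ where $\{\,,\}$ is the Poisson structure on $M$ induced by $\omega$ and $\{\,,\}_{\mathcal{O}}$ is the Poisson structure on $\mathcal{O}$ induced by the symplectic form $\omega_{\mathcal{O}}$.
   Context: A Lie algebroid over $M$ is a vector bundle $\mathcal{A}\to M$ with a Lie bracket $[\,,]$ on $\Gamma(\mathcal{A})$ and a bundle map $\rho:\mathcal{A}\to TM$ (anchor) which is a Lie algebra homomorphism on sections and satisfies $[S_1,fS_2]=f[S_1,S_2]+(\rho(S_1)\cdot f)S_2$; $d^{\mathcal{A}}$ denotes the usual Lie algebroid exterior derivative on $\Gamma(\wedge^k\mathcal{A}^* )$ (so $d^{\mathcal{A}}f(b)=\rho(b)\cdot f$). A symplectic form on $\mathcal{A}$ is a closed, nondegenerate section $\omega$ of $\wedge^2\mathcal{A}^*$. An almost complex structure on $\mathcal{A}$ is a bundle endomorphism $J$ over the identity with $J^2=-\mathrm{id}$. A compatible triple $(\omega,J,g)$ consists of a symplectic form $\omega$, an almost complex structure $J$ and a Riemannian metric $g$ on $\mathcal{A}$ with $g(J(S),J(T))=g(S,T)$ and $\omega(S,T)=g(S,J(T))$. Poisson structure induced by $\omega$: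 the Hamiltonian section $a_f$ of $f\in C^\infty(M)$ is the unique section with $d^{\mathcal{A}}f(b)=\omega(a_f,b)$ for all $b\in\Gamma(\mathcal{A})$, and $\{f,h\}:=\omega(a_f,a_h)$. The same convention ($df=\omega_{\mathcal{O}}(X_f,\cdot)$, $\{f,h\}_{\mathcal{O}}=\omega_{\mathcal{O}}(X_f,X_h)$) is used on the symplectic manifold $(\mathcal{O},\omega_{\mathcal{O}})$. For $p\in M$: $L_p=\ker\rho_p$, $V^{\omega}=\{a\in\mathcal{A}_p:\omega(a,v)=0\ \forall v\in V\}$, $L^1_p=L_p\cap L_p^{\omega}$, $E^1_p=J(L^1_p)$, $E^2_p=(L_p+E^1_p)^{\omega}$. The symplectic generalized distribution is $\Lambda_p=\rho(E^2_p+L^1_p)$; it is an integrable generalized distribution on $M$ (Stefan–Sussmann sense), and an integral submanifold $\mathcal{O}$ satisfies $T_p\mathcal{O}=\Lambda_p$ for $p\in\mathcal{O}$. On $\mathcal{O}$ the symplectic form $\omega_{\mathcal{O}}$ is defined by $\omega_{\mathcal{O}}(X_p,Y_p)=\omega(a_p,b_p)$ for any $a_p,b_p\in E^2_p+L^1_p$ with $\rho(a_p)=X_p$, $\rho(b_p)=Y_p$. *)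

theory Defs
  imports "HOL-Analysis.Analysis"
begin

section \<open>Smooth maps between open subsets of Euclidean spaces\<close>

text \<open>
  The model spaces of manifolds are the finite-dimensional real inner product spaces. The library
  class \<open>euclidean_space\<close> forces the dimension to be positive, whereas an integral submanifold of a
  generalized distribution may well be a point; the instance \<open>unit\<close> is the model space of
  dimension 0.
\<close>

class findim_inner = real_inner +
  assumes ex_finite_spanning: "\<exists>B. finite B \<and> (\<forall>x. \<exists>c. x = (\<Sum>b\<in>B. c b *\<^sub>R b))"

lemma ex_finite_span_UNIV: "\<exists>B::'a::findim_inner set. finite B \<and> span B = UNIV"
proof -
  obtain B :: "'a set" where B: "finite B" "\<forall>x. \<exists>c. x = (\<Sum>b\<in>B. c b *\<^sub>R b)"
    using ex_finite_spanning by blast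
  have "x \<in> span B" for x
  proof -
    obtain c where "x = (\<Sum>b\<in>B. c b *\<^sub>R b)"
      using B(2) by blast
    then show ?thesis
      by (simp add: span_sum span_scale span_base)
  qed
  with B(1) show ?thesis by blast
qed

instance euclidean_space \<subseteq> findim_inner
proof
  show "\<exists>B::'a set. finite B \<and> (\<forall>x. \<exists>c. x = (\<Sum>b\<in>B. c b *\<^sub>R b))"
    by (intro exI [of _ Basis] conjI allI finite_Basis)
      (rule exI, rule euclidean_representation [symmetric])
qed

instantiation unit :: real_inner
begin

definition zero_unit :: unit where "zero_unit = ()"
definition plus_unit :: "unit \<Rightarrow> unit \<Rightarrow> unit" where "plus_unit x y = ()"
definition minus_unit :: "unit \<Rightarrow> unit \<Rightarrow> unit" where "minus_unit x y = ()"
definition uminus_unit :: "unit \<Rightarrow> unit" where "uminus_unit x = ()"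
definition scaleR_unit :: "real \<Rightarrow> unit \<Rightarrow> unit" where "scaleR_unit c x = ()"
definition inner_unit :: "unit \<Rightarrow> unit \<Rightarrow> real" where "inner_unit x y = 0"
definition norm_unit :: "unit \<Rightarrow> real" where "norm_unit x = 0"
definition dist_unit :: "unit \<Rightarrow> unit \<Rightarrow> real" where "dist_unit x y = 0"
definition sgn_unit :: "unit \<Rightarrow> unit" where "sgn_unit x = ()"
definition uniformity_unit :: "(unit \<times> unit) filter"
  where "uniformity_unit = (INF e\<in>{0<..}. principal {(x, y). dist x y < e})"
definition open_unit :: "unit set \<Rightarrow> bool"
  where "open_unit U \<longleftrightarrow> (\<forall>x\<in>U. eventually (\<lambda>(x', y). x' = x \<longrightarrow> y \<in> U) uniformity)"

instance
  by standard
    (simp_all add: inner_unit_def norm_unit_def dist_unit_def uniformity_unit_def open_unit_def)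

end

instance unit :: findim_inner
  by standard auto

primrec Ck_on :: "nat \<Rightarrow> 'a::real_normed_vector set \<Rightarrow> ('a \<Rightarrow> 'b::real_normed_vector) \<Rightarrow> bool" where
  "Ck_on 0 S f \<longleftrightarrow> continuous_on S f"
| "Ck_on (Suc k) S f \<longleftrightarrow>
     (\<forall>x\<in>S. f differentiable (at x)) \<and> (\<forall>v. Ck_on k S (\<lambda>x. frechet_derivative f (at x) v))"

definition smooth_on :: "'a::real_normed_vector set \<Rightarrow> ('a \<Rightarrow> 'b::real_normed_vector) \<Rightarrow> bool"
  where "smooth_on S f \<longleftrightarrow> (\<forall>k. Ck_on k S f)"


section \<open>Smooth manifolds\<close>

text \<open>
  A smooth manifold is a Hausdorff, second countable type with an atlas of charts
  \<open>(U, \<phi>)\<close>; the values of \<open>\<phi>\<close> outside \<open>U\<close> are irrelevant.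
\<close>

type_synonym ('m, 'e) atlas = "('m set \<times> ('m \<Rightarrow> 'e)) set"

definition smooth_manifold ::
    "('m::{t2_space, second_countable_topology}, 'e::findim_inner) atlas \<Rightarrow> bool" where
  "smooth_manifold \<A> \<longleftrightarrow>
     (\<Union>(U, \<phi>)\<in>\<A>. U) = UNIV \<and>
     (\<forall>(U, \<phi>)\<in>\<A>. open U \<and> open (\<phi> ` U) \<and> homeomorphism U (\<phi> ` U) \<phi> (inv_into U \<phi>)) \<and>
     (\<forall>(U, \<phi>)\<in>\<A>. \<forall>(V, \<psi>)\<in>\<A>. smooth_on (\<phi> ` (U \<inter> V)) (\<psi> \<circ> inv_into U \<phi>))"

definition smooth_fun_on ::
    "('m, 'e::findim_inner) atlas \<Rightarrow> 'm set \<Rightarrow> ('m \<Rightarrow> real) \<Rightarrow> bool" where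
  "smooth_fun_on \<A> W f \<longleftrightarrow>
     (\<forall>(U, \<phi>)\<in>\<A>. smooth_on (\<phi> ` (U \<inter> W)) (f \<circ> inv_into U \<phi>))"

definition C_inf :: "('m, 'e::findim_inner) atlas \<Rightarrow> ('m \<Rightarrow> real) set" where
  "C_inf \<A> = {f. smooth_fun_on \<A> UNIV f}"

definition smooth_map ::
    "('n::topological_space, 'd::findim_inner) atlas \<Rightarrow> ('m::topological_space, 'e::findim_inner) atlas
      \<Rightarrow> ('n \<Rightarrow> 'm) \<Rightarrow> bool" where
  "smooth_map \<B> \<A> F \<longleftrightarrow> continuous_on UNIV F \<and>
     (\<forall>(V, \<psi>)\<in>\<B>. \<forall>(U, \<phi>)\<in>\<A>. smooth_on (\<psi> ` (V \<inter> F -` U)) (\<phi> \<circ> F \<circ> inv_into V \<psi>))"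

text \<open>
  Tangent vectors are point derivations of the algebra of smooth functions. As HOL functions they
  are total; the value 0 on non-smooth functions makes them equal as soon as they agree on smooth
  functions.
\<close>

type_synonym 'm tangent = "('m \<Rightarrow> real) \<Rightarrow> real"

definition tangent_space :: "('m, 'e::findim_inner) atlas \<Rightarrow> 'm \<Rightarrow> 'm tangent set" where
  "tangent_space \<A> p = {X.
     (\<forall>f\<in>C_inf \<A>. \<forall>h\<in>C_inf \<A>. X (\<lambda>q. f q + h q) = X f + X h) \<and>
     (\<forall>c. \<forall>f\<in>C_inf \<A>. X (\<lambda>q. c * f q) = c * X f) \<and>
     (\<forall>f\<in>C_inf \<A>. \<forall>h\<in>C_inf \<A>. X (\<lambda>q. f q * h q) = f p * X h + h p * X f) \<and>
     (\<forall>f. f \<notin> C_inf \<A> \<longrightarrow> X f = 0)}"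

definition vector_fields :: "('m, 'e::findim_inner) atlas \<Rightarrow> ('m \<Rightarrow> 'm tangent) set" where
  "vector_fields \<A> = {X.
     (\<forall>p. X p \<in> tangent_space \<A> p) \<and> (\<forall>f\<in>C_inf \<A>. (\<lambda>p. X p f) \<in> C_inf \<A>)}"

definition vf_bracket :: "('m \<Rightarrow> 'm tangent) \<Rightarrow> ('m \<Rightarrow> 'm tangent) \<Rightarrow> 'm \<Rightarrow> 'm tangent" where
  "vf_bracket X Y = (\<lambda>p f. X p (\<lambda>q. Y q f) - Y p (\<lambda>q. X q f))"

text \<open>
  The differential of \<open>F\<close> at a point; \<open>\<A>\<close> is the atlas of the target, and the point is implicit
  in the tangent vector \<open>X\<close>.
\<close>

definition pushforward ::
    "('m, 'e::findim_inner) atlas \<Rightarrow> ('n \<Rightarrow> 'm) \<Rightarrow> 'n tangent \<Rightarrow> 'm tangent" where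
  "pushforward \<A> F X = (\<lambda>f. if f \<in> C_inf \<A> then X (f \<circ> F) else 0)"

text \<open>An immersed submanifold is given by its inclusion, an injective immersion \<open>\<iota>\<close>.\<close>

definition immersed_submanifold ::
    "('n::{t2_space, second_countable_topology}, 'd::findim_inner) atlas
      \<Rightarrow> ('m::{t2_space, second_countable_topology}, 'e::findim_inner) atlas \<Rightarrow> ('n \<Rightarrow> 'm) \<Rightarrow> bool" where
  "immersed_submanifold \<B> \<A> \<iota> \<longleftrightarrow>
     smooth_manifold \<B> \<and> smooth_map \<B> \<A> \<iota> \<and> inj \<iota> \<and>
     (\<forall>q. inj_on (pushforward \<A> \<iota>) (tangent_space \<B> q))"


subsection \<open>The Poisson structure of a two-form on a manifold\<close>

definition hamiltonian_field ::
    "('n, 'd::findim_inner) atlas \<Rightarrow> ('n \<Rightarrow> 'n tangent \<Rightarrow> 'n tangent \<Rightarrow> real)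
      \<Rightarrow> ('n \<Rightarrow> real) \<Rightarrow> 'n \<Rightarrow> 'n tangent" where
  "hamiltonian_field \<B> \<sigma> f =
     (THE X. X \<in> vector_fields \<B> \<and> (\<forall>q. \<forall>Y\<in>tangent_space \<B> q. Y f = \<sigma> q (X q) Y))"

definition manifold_poisson ::
    "('n, 'd::findim_inner) atlas \<Rightarrow> ('n \<Rightarrow> 'n tangent \<Rightarrow> 'n tangent \<Rightarrow> real)
      \<Rightarrow> ('n \<Rightarrow> real) \<Rightarrow> ('n \<Rightarrow> real) \<Rightarrow> 'n \<Rightarrow> real" where
  "manifold_poisson \<B> \<sigma> f h =
     (\<lambda>q. \<sigma> q (hamiltonian_field \<B> \<sigma> f q) (hamiltonian_field \<B> \<sigma> h q))"


section \<open>Vector bundles\<close>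

text \<open>
  The fibre over \<open>p\<close> is a linear subspace of a real vector space \<open>'v\<close>, which only serves to carry
  the linear operations: neither the topology nor the smooth structure of the total space
  \<open>{(p, v). v \<in> fibre p}\<close> comes from \<open>'v\<close>. They are given by the local trivializations, recorded as
  local frames \<open>(U, e)\<close> where \<open>e 0 p, \<dots>, e (r - 1) p\<close> is a basis of the fibre over \<open>p \<in> U\<close>.
  Every smooth vector bundle is of this form up to isomorphism.
\<close>

record ('m, 'e, 'v) vbundle =
  base :: "('m, 'e) atlas"
  fibre :: "'m \<Rightarrow> 'v set"
  bundle_rank :: nat
  frames :: "('m set \<times> (nat \<Rightarrow> 'm \<Rightarrow> 'v)) set"

definition smooth_section_on ::
    "('m, 'e::findim_inner, 'v::real_vector, 'z) vbundle_scheme \<Rightarrow> 'm set \<Rightarrow> ('m \<Rightarrow> 'v) \<Rightarrow> bool" where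
  "smooth_section_on E W s \<longleftrightarrow> (\<forall>p\<in>W. s p \<in> fibre E p) \<and>
     (\<forall>(U, e)\<in>frames E. \<exists>c. (\<forall>i<bundle_rank E. smooth_fun_on (base E) (U \<inter> W) (c i)) \<and>
        (\<forall>p\<in>U \<inter> W. s p = (\<Sum>i<bundle_rank E. c i p *\<^sub>R e i p)))"

definition vector_bundle ::
    "('m::{t2_space, second_countable_topology}, 'e::findim_inner, 'v::real_vector, 'z) vbundle_scheme
      \<Rightarrow> bool" where
  "vector_bundle E \<longleftrightarrow>
     smooth_manifold (base E) \<and>
     (\<forall>p. subspace (fibre E p)) \<and>
     (\<Union>(U, e)\<in>frames E. U) = UNIV \<and>
     (\<forall>(U, e)\<in>frames E. open U \<and>
        (\<forall>p\<in>U. inj_on (\<lambda>i. e i p) {..<bundle_rank E} \<and>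
           independent ((\<lambda>i. e i p) ` {..<bundle_rank E}) \<and>
           span ((\<lambda>i. e i p) ` {..<bundle_rank E}) = fibre E p) \<and>
        (\<forall>i<bundle_rank E. smooth_section_on E U (e i)))"

definition sections ::
    "('m, 'e::findim_inner, 'v::real_vector, 'z) vbundle_scheme \<Rightarrow> ('m \<Rightarrow> 'v) set" where
  "sections E = {s. smooth_section_on E UNIV s}"

definition bundle_endomorphism ::
    "('m, 'e::findim_inner, 'v::real_vector, 'z) vbundle_scheme \<Rightarrow> ('m \<Rightarrow> 'v \<Rightarrow> 'v) \<Rightarrow> bool" where
  "bundle_endomorphism E J \<longleftrightarrow>
     (\<forall>p. \<forall>a\<in>fibre E p. J p a \<in> fibre E p) \<and>
     (\<forall>p. \<forall>a\<in>fibre E p. \<forall>b\<in>fibre E p. J p (a + b) = J p a + J p b) \<and>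
     (\<forall>p c. \<forall>a\<in>fibre E p. J p (c *\<^sub>R a) = c *\<^sub>R J p a) \<and>
     (\<forall>(U, e)\<in>frames E. \<forall>i<bundle_rank E. smooth_section_on E U (\<lambda>p. J p (e i p)))"

definition smooth_bilinear_form ::
    "('m, 'e::findim_inner, 'v::real_vector, 'z) vbundle_scheme \<Rightarrow> ('m \<Rightarrow> 'v \<Rightarrow> 'v \<Rightarrow> real) \<Rightarrow> bool" where
  "smooth_bilinear_form E \<beta> \<longleftrightarrow>
     (\<forall>p. \<forall>a\<in>fibre E p. \<forall>b\<in>fibre E p. \<forall>c\<in>fibre E p.
        \<beta> p (a + b) c = \<beta> p a c + \<beta> p b c \<and> \<beta> p c (a + b) = \<beta> p c a + \<beta> p c b) \<and>
     (\<forall>p r. \<forall>a\<in>fibre E p. \<forall>b\<in>fibre E p.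
        \<beta> p (r *\<^sub>R a) b = r * \<beta> p a b \<and> \<beta> p a (r *\<^sub>R b) = r * \<beta> p a b) \<and>
     (\<forall>(U, e)\<in>frames E. \<forall>i<bundle_rank E. \<forall>j<bundle_rank E.
        smooth_fun_on (base E) U (\<lambda>p. \<beta> p (e i p) (e j p)))"


section \<open>Lie algebroids\<close>

record ('m, 'e, 'v) algebroid = "('m, 'e, 'v) vbundle" +
  anchor :: "'m \<Rightarrow> 'v \<Rightarrow> 'm tangent"
  bracket :: "('m \<Rightarrow> 'v) \<Rightarrow> ('m \<Rightarrow> 'v) \<Rightarrow> ('m \<Rightarrow> 'v)"

definition anchor_map ::
    "('m, 'e::findim_inner, 'v::real_vector, 'z) vbundle_scheme \<Rightarrow> ('m \<Rightarrow> 'v \<Rightarrow> 'm tangent) \<Rightarrow> bool" where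
  "anchor_map E \<rho> \<longleftrightarrow>
     (\<forall>p. \<forall>a\<in>fibre E p. \<rho> p a \<in> tangent_space (base E) p) \<and>
     (\<forall>p. \<forall>a\<in>fibre E p. \<forall>b\<in>fibre E p. \<rho> p (a + b) = (\<lambda>f. \<rho> p a f + \<rho> p b f)) \<and>
     (\<forall>p c. \<forall>a\<in>fibre E p. \<rho> p (c *\<^sub>R a) = (\<lambda>f. c * \<rho> p a f)) \<and>
     (\<forall>(U, e)\<in>frames E. \<forall>i<bundle_rank E. \<forall>f\<in>C_inf (base E).
        smooth_fun_on (base E) U (\<lambda>p. \<rho> p (e i p) f))"

definition lie_algebroid ::
    "('m::{t2_space, second_countable_topology}, 'e::findim_inner, 'v::real_vector, 'z) algebroid_scheme
      \<Rightarrow> bool" where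
  "lie_algebroid A \<longleftrightarrow>
     vector_bundle A \<and>
     anchor_map A (anchor A) \<and>
     (\<forall>s\<in>sections A. \<forall>t\<in>sections A. bracket A s t \<in> sections A) \<and>
     (\<forall>s\<in>sections A. \<forall>t\<in>sections A. \<forall>u\<in>sections A.
        bracket A s (\<lambda>p. t p + u p) = (\<lambda>p. bracket A s t p + bracket A s u p)) \<and>
     (\<forall>c. \<forall>s\<in>sections A. \<forall>t\<in>sections A.
        bracket A s (\<lambda>p. c *\<^sub>R t p) = (\<lambda>p. c *\<^sub>R bracket A s t p)) \<and>
     (\<forall>s\<in>sections A. \<forall>t\<in>sections A. bracket A s t = (\<lambda>p. - bracket A t s p)) \<and>
     (\<forall>s\<in>sections A. \<forall>t\<in>sections A. \<forall>u\<in>sections A. \<forall>p.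
        bracket A s (bracket A t u) p + bracket A t (bracket A u s) p
          + bracket A u (bracket A s t) p = 0) \<and>
     (\<forall>s\<in>sections A. \<forall>t\<in>sections A. \<forall>p.
        anchor A p (bracket A s t p) = vf_bracket (\<lambda>q. anchor A q (s q)) (\<lambda>q. anchor A q (t q)) p) \<and>
     (\<forall>s\<in>sections A. \<forall>t\<in>sections A. \<forall>f\<in>C_inf (base A). \<forall>p.
        bracket A s (\<lambda>q. f q *\<^sub>R t q) p
          = f p *\<^sub>R bracket A s t p + anchor A p (s p) f *\<^sub>R t p)"

text \<open>The Lie algebroid exterior derivative in degrees 0 and 2, evaluated on sections.\<close>

definition d0 :: "('m, 'e, 'v, 'z) algebroid_scheme \<Rightarrow> ('m \<Rightarrow> real) \<Rightarrow> ('m \<Rightarrow> 'v) \<Rightarrow> 'm \<Rightarrow> real" where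
  "d0 A f b = (\<lambda>p. anchor A p (b p) f)"

definition d2 ::
    "('m, 'e, 'v, 'z) algebroid_scheme \<Rightarrow> ('m \<Rightarrow> 'v \<Rightarrow> 'v \<Rightarrow> real)
      \<Rightarrow> ('m \<Rightarrow> 'v) \<Rightarrow> ('m \<Rightarrow> 'v) \<Rightarrow> ('m \<Rightarrow> 'v) \<Rightarrow> 'm \<Rightarrow> real" where
  "d2 A \<omega> a b c = (\<lambda>p.
       anchor A p (a p) (\<lambda>q. \<omega> q (b q) (c q))
     - anchor A p (b p) (\<lambda>q. \<omega> q (a q) (c q))
     + anchor A p (c p) (\<lambda>q. \<omega> q (a q) (b q))
     - \<omega> p (bracket A a b p) (c p)
     + \<omega> p (bracket A a c p) (b p)
     - \<omega> p (bracket A b c p) (a p))"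

definition symplectic_form ::
    "('m, 'e::findim_inner, 'v::real_vector, 'z) algebroid_scheme \<Rightarrow> ('m \<Rightarrow> 'v \<Rightarrow> 'v \<Rightarrow> real) \<Rightarrow> bool" where
  "symplectic_form A \<omega> \<longleftrightarrow>
     smooth_bilinear_form A \<omega> \<and>
     (\<forall>p. \<forall>a\<in>fibre A p. \<omega> p a a = 0) \<and>
     (\<forall>a\<in>sections A. \<forall>b\<in>sections A. \<forall>c\<in>sections A. d2 A \<omega> a b c = (\<lambda>p. 0)) \<and>
     (\<forall>p. \<forall>a\<in>fibre A p. (\<forall>b\<in>fibre A p. \<omega> p a b = 0) \<longrightarrow> a = 0)"

definition almost_complex_structure ::
    "('m, 'e::findim_inner, 'v::real_vector, 'z) vbundle_scheme \<Rightarrow> ('m \<Rightarrow> 'v \<Rightarrow> 'v) \<Rightarrow> bool" where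
  "almost_complex_structure E J \<longleftrightarrow>
     bundle_endomorphism E J \<and> (\<forall>p. \<forall>a\<in>fibre E p. J p (J p a) = - a)"

definition riemannian_metric ::
    "('m, 'e::findim_inner, 'v::real_vector, 'z) vbundle_scheme \<Rightarrow> ('m \<Rightarrow> 'v \<Rightarrow> 'v \<Rightarrow> real) \<Rightarrow> bool" where
  "riemannian_metric E g \<longleftrightarrow>
     smooth_bilinear_form E g \<and>
     (\<forall>p. \<forall>a\<in>fibre E p. \<forall>b\<in>fibre E p. g p a b = g p b a) \<and>
     (\<forall>p. \<forall>a\<in>fibre E p. a \<noteq> 0 \<longrightarrow> g p a a > 0)"

definition compatible_triple ::
    "('m, 'e::findim_inner, 'v::real_vector, 'z) algebroid_scheme \<Rightarrow> ('m \<Rightarrow> 'v \<Rightarrow> 'v \<Rightarrow> real)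
      \<Rightarrow> ('m \<Rightarrow> 'v \<Rightarrow> 'v) \<Rightarrow> ('m \<Rightarrow> 'v \<Rightarrow> 'v \<Rightarrow> real) \<Rightarrow> bool" where
  "compatible_triple A \<omega> J g \<longleftrightarrow>
     symplectic_form A \<omega> \<and> almost_complex_structure A J \<and> riemannian_metric A g \<and>
     (\<forall>p. \<forall>a\<in>fibre A p. \<forall>b\<in>fibre A p. g p (J p a) (J p b) = g p a b \<and> \<omega> p a b = g p a (J p b))"


subsection \<open>The Poisson structure induced by a symplectic form\<close>

definition hamiltonian_section ::
    "('m, 'e::findim_inner, 'v::real_vector, 'z) algebroid_scheme \<Rightarrow> ('m \<Rightarrow> 'v \<Rightarrow> 'v \<Rightarrow> real)
      \<Rightarrow> ('m \<Rightarrow> real) \<Rightarrow> 'm \<Rightarrow> 'v" where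
  "hamiltonian_section A \<omega> f =
     (THE a. a \<in> sections A \<and> (\<forall>b\<in>sections A. d0 A f b = (\<lambda>p. \<omega> p (a p) (b p))))"

definition poisson ::
    "('m, 'e::findim_inner, 'v::real_vector, 'z) algebroid_scheme \<Rightarrow> ('m \<Rightarrow> 'v \<Rightarrow> 'v \<Rightarrow> real)
      \<Rightarrow> ('m \<Rightarrow> real) \<Rightarrow> ('m \<Rightarrow> real) \<Rightarrow> 'm \<Rightarrow> real" where
  "poisson A \<omega> f h = (\<lambda>p. \<omega> p (hamiltonian_section A \<omega> f p) (hamiltonian_section A \<omega> h p))"


subsection \<open>The symplectic generalized distribution\<close>

definition omega_orth ::
    "('m, 'e, 'v, 'z) vbundle_scheme \<Rightarrow> ('m \<Rightarrow> 'v \<Rightarrow> 'v \<Rightarrow> real) \<Rightarrow> 'm \<Rightarrow> 'v set \<Rightarrow> 'v set" where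
  "omega_orth E \<omega> p V = {a \<in> fibre E p. \<forall>v\<in>V. \<omega> p a v = 0}"

definition subspace_sum :: "'v::plus set \<Rightarrow> 'v set \<Rightarrow> 'v set" where
  "subspace_sum V W = {v + w | v w. v \<in> V \<and> w \<in> W}"

definition isotropy :: "('m, 'e, 'v, 'z) algebroid_scheme \<Rightarrow> 'm \<Rightarrow> 'v set" where
  "isotropy A p = {a \<in> fibre A p. anchor A p a = (\<lambda>f. 0)}"

definition L1 ::
    "('m, 'e, 'v, 'z) algebroid_scheme \<Rightarrow> ('m \<Rightarrow> 'v \<Rightarrow> 'v \<Rightarrow> real) \<Rightarrow> 'm \<Rightarrow> 'v set" where
  "L1 A \<omega> p = isotropy A p \<inter> omega_orth A \<omega> p (isotropy A p)"

definition E1 ::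
    "('m, 'e, 'v, 'z) algebroid_scheme \<Rightarrow> ('m \<Rightarrow> 'v \<Rightarrow> 'v \<Rightarrow> real) \<Rightarrow> ('m \<Rightarrow> 'v \<Rightarrow> 'v)
      \<Rightarrow> 'm \<Rightarrow> 'v set" where
  "E1 A \<omega> J p = J p ` L1 A \<omega> p"

definition E2 ::
    "('m, 'e, 'v::real_vector, 'z) algebroid_scheme \<Rightarrow> ('m \<Rightarrow> 'v \<Rightarrow> 'v \<Rightarrow> real) \<Rightarrow> ('m \<Rightarrow> 'v \<Rightarrow> 'v)
      \<Rightarrow> 'm \<Rightarrow> 'v set" where
  "E2 A \<omega> J p = omega_orth A \<omega> p (subspace_sum (isotropy A p) (E1 A \<omega> J p))"

definition E2_L1 ::
    "('m, 'e, 'v::real_vector, 'z) algebroid_scheme \<Rightarrow> ('m \<Rightarrow> 'v \<Rightarrow> 'v \<Rightarrow> real) \<Rightarrow> ('m \<Rightarrow> 'v \<Rightarrow> 'v)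
      \<Rightarrow> 'm \<Rightarrow> 'v set" where
  "E2_L1 A \<omega> J p = subspace_sum (E2 A \<omega> J p) (L1 A \<omega> p)"

definition symplectic_distribution ::
    "('m, 'e, 'v::real_vector, 'z) algebroid_scheme \<Rightarrow> ('m \<Rightarrow> 'v \<Rightarrow> 'v \<Rightarrow> real) \<Rightarrow> ('m \<Rightarrow> 'v \<Rightarrow> 'v)
      \<Rightarrow> 'm \<Rightarrow> 'm tangent set" where
  "symplectic_distribution A \<omega> J p = anchor A p ` E2_L1 A \<omega> J p"

definition integral_submanifold ::
    "('n::{t2_space, second_countable_topology}, 'd::findim_inner) atlas
      \<Rightarrow> ('m::{t2_space, second_countable_topology}, 'e::findim_inner) atlas
      \<Rightarrow> ('n \<Rightarrow> 'm) \<Rightarrow> ('m \<Rightarrow> 'm tangent set) \<Rightarrow> bool" where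
  "integral_submanifold \<B> \<A> \<iota> \<Lambda> \<longleftrightarrow>
     immersed_submanifold \<B> \<A> \<iota> \<and>
     (\<forall>q. pushforward \<A> \<iota> ` tangent_space \<B> q = \<Lambda> (\<iota> q))"

text \<open>The value does not depend on the choice of the lifts \<open>a\<close> and \<open>b\<close>.\<close>

definition leaf_form ::
    "('m, 'e::findim_inner, 'v::real_vector, 'z) algebroid_scheme \<Rightarrow> ('m \<Rightarrow> 'v \<Rightarrow> 'v \<Rightarrow> real)
      \<Rightarrow> ('m \<Rightarrow> 'v \<Rightarrow> 'v) \<Rightarrow> ('n \<Rightarrow> 'm) \<Rightarrow> 'n \<Rightarrow> 'n tangent \<Rightarrow> 'n tangent \<Rightarrow> real" where
  "leaf_form A \<omega> J \<iota> q X Y =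
     (THE r. \<forall>a\<in>E2_L1 A \<omega> J (\<iota> q). \<forall>b\<in>E2_L1 A \<omega> J (\<iota> q).
        anchor A (\<iota> q) a = pushforward (base A) \<iota> X \<and>
        anchor A (\<iota> q) b = pushforward (base A) \<iota> Y \<longrightarrow> r = \<omega> (\<iota> q) a b)"

end

theory Submission
  imports Defs "Jordan_Normal_Form.Determinant"
begin

text \<open>
  Everything reduces to the identity \<open>L\<^sup>\<omega> = E\<^sup>2 + L\<^sup>1\<close> in the fibres: the Hamiltonian section \<open>a\<^sub>f\<close>
  is \<open>\<omega>\<close>-orthogonal to \<open>L = ker \<rho>\<close>, so \<open>\<rho>(a\<^sub>f)\<close> is tangent to the leaf, and there it satisfies the
  equation that defines the Hamiltonian field of \<open>f\<close> restricted to the leaf. The work lies in the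
  smoothness of both objects. In a frame the coefficients of \<open>a\<^sub>f\<close> solve a linear system with smooth
  coefficients. On the leaf a derivation at a point is a directional derivative in a chart
  (Hadamard's lemma and bump functions), and as the inclusion is an immersion, the components of the
  field solve a linear system given by its values on restrictions of smooth functions on the base.
\<close>

text \<open>Both Hamiltonian objects are definite descriptions that range over smooth candidates
  only, so a pointwise solution says nothing about their values until it is shown to be smooth and
  to be the only candidate. The leaf is the harder case: the candidate field is known only through
  its push-forward, that is, through its values on restrictions \<open>f \<circ> \<iota>\<close>,
  whereas a vector field has to preserve all smooth functions of the leaf. Rather than straightening
  the immersion by the inverse function theorem, the proof selects finitely many restrictions whose
  differentials form a basis at one point; their Jacobian stays invertible nearby and Cramer's rule
  yields smooth components. The form on the leaf uses orthogonality twice: two lifts of a tangent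
  vector differ by an element of \<open>L\<close>, which is orthogonal to
  \<open>L\<^sup>\<omega>\<close>, so values are well defined; and nondegeneracy rests on the double
  orthogonal of \<open>L\<close> being contained in \<open>L\<close>, shown with \<open>J\<close>
  and an orthogonal projection instead of a dimension count.\<close>

no_notation scalar_prod (infix "\<bullet>" 70)

section \<open>Finite-dimensional inner product spaces\<close>

text \<open>The fibres are subspaces of a bare \<open>real_vector\<close> type, and
  \<open>g p\<close> is controlled on them only; so the inner product arguments are relative to
  \<open>F\<close>. The second use is \<open>F = UNIV\<close> with \<open>inner\<close>, for the
  model spaces of manifolds.\<close>

locale inner_on =
  fixes F :: "'v::real_vector set" and g :: "'v \<Rightarrow> 'v \<Rightarrow> real"
  assumes subspace_F: "subspace F"
    and g_add: "\<lbrakk>a \<in> F; b \<in> F; c \<in> F\<rbrakk> \<Longrightarrow> g (a + b) c = g a c + g b c"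
    and g_scale: "\<lbrakk>a \<in> F; b \<in> F\<rbrakk> \<Longrightarrow> g (r *\<^sub>R a) b = r * g a b"
    and g_sym: "\<lbrakk>a \<in> F; b \<in> F\<rbrakk> \<Longrightarrow> g a b = g b a"
    and g_pos: "\<lbrakk>a \<in> F; a \<noteq> 0\<rbrakk> \<Longrightarrow> g a a > 0"
begin

lemma F_closed:
  "0 \<in> F" "\<lbrakk>a \<in> F; b \<in> F\<rbrakk> \<Longrightarrow> a + b \<in> F" "\<lbrakk>a \<in> F; b \<in> F\<rbrakk> \<Longrightarrow> a - b \<in> F" "a \<in> F \<Longrightarrow> r *\<^sub>R a \<in> F"
  using subspace_F by (auto simp: subspace_0 subspace_add subspace_diff subspace_scale)

lemma g_zero [simp]: "b \<in> F \<Longrightarrow> g 0 b = 0"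
  using g_scale[of b b 0] by simp

lemma g_zero_right [simp]: "b \<in> F \<Longrightarrow> g b 0 = 0"
  using g_scale[of b b 0] g_sym[of b 0] F_closed(1) by simp

lemma g_diff: "\<lbrakk>a \<in> F; b \<in> F; c \<in> F\<rbrakk> \<Longrightarrow> g (a - b) c = g a c - g b c"
  using g_add[of "a - b" b c] by (simp add: F_closed)

lemma g_diff_right: "\<lbrakk>a \<in> F; b \<in> F; c \<in> F\<rbrakk> \<Longrightarrow> g c (a - b) = g c a - g c b"
  by (simp add: g_sym[of c] g_diff F_closed)

lemma g_add_right: "\<lbrakk>a \<in> F; b \<in> F; c \<in> F\<rbrakk> \<Longrightarrow> g c (a + b) = g c a + g c b"
  by (simp add: g_sym[of c] g_add F_closed)

lemma g_scale_right: "\<lbrakk>a \<in> F; b \<in> F\<rbrakk> \<Longrightarrow> g b (r *\<^sub>R a) = r * g b a"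
  by (simp add: g_sym[of b] g_scale F_closed)

lemma orth_span:
  assumes "c \<in> F" "B \<subseteq> F" "\<And>b. b \<in> B \<Longrightarrow> g c b = 0" "w \<in> span B"
  shows "g c w = 0"
proof -
  have "subspace {w \<in> F. g c w = 0}"
    using assms(1) by (auto simp: subspace_def F_closed g_add_right g_scale_right)
  then have "span B \<subseteq> {w \<in> F. g c w = 0}"
    using assms by (intro span_minimal) auto
  then show ?thesis using assms(4) by auto
qed

text \<open>One step of Gram-Schmidt per vector. The induction keeps \<open>a\<close> arbitrary
  because the hypothesis is needed twice: to project \<open>a\<close>, and to split off from the new
  vector \<open>b\<close> its part \<open>b'\<close> orthogonal to \<open>span B\<close>.\<close>

lemma ex_projection_span:
  assumes "finite B" "B \<subseteq> F" "a \<in> F"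
  shows "\<exists>v\<in>span B. \<forall>w\<in>span B. g (a - v) w = 0"
  using assms
proof (induction B arbitrary: a rule: finite_induct)
  case empty
  then show ?case by (auto simp: F_closed)
next
  case (insert b B)
  have sub: "span B \<subseteq> F"
    using insert.prems subspace_F by (intro span_minimal) auto
  have spi: "span B \<subseteq> span (insert b B)"
    by (rule span_mono) auto
  obtain p where p: "p \<in> span B" "\<And>w. w \<in> span B \<Longrightarrow> g (b - p) w = 0"
    using insert.IH[of b] insert.prems by auto
  obtain v where v: "v \<in> span B" "\<And>w. w \<in> span B \<Longrightarrow> g (a - v) w = 0"
    using insert.IH[of a] insert.prems by auto
  define b' where "b' = b - p"
  have F: "b \<in> F" "p \<in> F" "v \<in> F" "b' \<in> F" "a \<in> F"
    using insert.prems sub p(1) v(1) by (auto simp: b'_def F_closed)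
  \<comment> \<open>If \<open>b\<close> already lies in the old span, then \<open>b' = 0\<close> and
    the quotient is 0 by convention; the equation \<open>r * g b' b' = g a b'\<close> used below
    holds in that case too.\<close>
  define r where "r = g a b' / g b' b'"
  have b'in: "b' \<in> span (insert b B)"
    unfolding b'_def using p(1) spi by (intro span_diff) (auto intro: span_base)
  have vb': "g v b' = 0"
    using p(2)[OF v(1)] g_sym[of v b'] F by (simp add: b'_def)
  have r: "r * g b' b' = g a b'"
    unfolding r_def using g_pos[of b'] F by (cases "b' = 0") auto
  have o: "g (a - (v + r *\<^sub>R b')) w = 0" if "w \<in> insert b B" for w
  proof -
    have wF: "w \<in> F" using that insert.prems by auto
    have split: "g (a - (v + r *\<^sub>R b')) w = g (a - v) w - r * g b' w" if "w \<in> F" for w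
      using F that by (simp add: diff_diff_add[symmetric] g_diff g_scale F_closed)
    have onB: "g (a - (v + r *\<^sub>R b')) w = 0" if "w \<in> span B" for w
      using that sub v(2)[of w] p(2)[of w] split[of w] by (auto simp: b'_def)
    have "g (a - (v + r *\<^sub>R b')) b' = 0"
      using split[of b'] F r vb' by (simp add: g_diff)
    then have "g (a - (v + r *\<^sub>R b')) b = 0"
      using onB[OF p(1)] F unfolding b'_def by (simp add: g_diff_right F_closed)
    then show ?thesis
      using that onB[of w] by (auto intro: span_base)
  qed
  have "v + r *\<^sub>R b' \<in> span (insert b B)"
    using v(1) spi b'in by (intro span_add span_scale) auto
  moreover have "g (a - (v + r *\<^sub>R b')) w = 0" if "w \<in> span (insert b B)" for w
    using orth_span[OF _ _ o that] F insert.prems by (auto simp: F_closed)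
  ultimately show ?case by blast
qed

text \<open>The finite spanning set bounds the size of independent subsets of \<open>V\<close>, so a
  maximal one is a finite basis of \<open>V\<close> and the projection onto a finite span
  applies.\<close>

lemma ex_projection:
  assumes "finite B" "F \<subseteq> span B" "subspace V" "V \<subseteq> F" "a \<in> F"
  shows "\<exists>v\<in>V. \<forall>w\<in>V. g (a - v) w = 0"
proof -
  obtain C where C: "C \<subseteq> V" "independent C" "V \<subseteq> span C"
    using maximal_independent_subset by blast
  have "finite C"
    using independent_span_bound[OF assms(1) C(2)] C(1) assms by auto
  moreover have "span C = V"
    using C span_minimal[OF C(1) assms(3)] by auto
  ultimately show ?thesis
    using ex_projection_span[of C a] C(1) assms by auto
qed

text \<open>If the form is not zero, the residual \<open>n\<close> of a vector \<open>a\<close>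
  outside the kernel \<open>K\<close>, after projection to \<open>K\<close>, is a normal of
  \<open>K\<close>; every \<open>b\<close> is an element of \<open>K\<close> plus a multiple of
  \<open>n\<close>, which fixes the scaling of \<open>n\<close>. It produces gradients in the
  fibres.\<close>

lemma riesz:
  fixes \<phi> :: "'v \<Rightarrow> real"
  assumes fin: "finite B" "F \<subseteq> span B"
    and add: "\<And>a b. \<lbrakk>a \<in> F; b \<in> F\<rbrakk> \<Longrightarrow> \<phi> (a + b) = \<phi> a + \<phi> b"
    and sc: "\<And>r a. a \<in> F \<Longrightarrow> \<phi> (r *\<^sub>R a) = r * \<phi> a"
  shows "\<exists>n\<in>F. \<forall>b\<in>F. \<phi> b = g n b"
proof (cases "\<forall>a\<in>F. \<phi> a = 0")
  case True
  then show ?thesis by (intro bexI[of _ 0]) (auto simp: F_closed)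
next
  case False
  then obtain a where a: "a \<in> F" "\<phi> a \<noteq> 0" by auto
  define K where "K = {b \<in> F. \<phi> b = 0}"
  have [simp]: "\<phi> 0 = 0" using sc[of 0 0] F_closed by simp
  have "subspace K"
    by (auto simp: K_def subspace_def F_closed add sc)
  then obtain v where v: "v \<in> K" "\<And>w. w \<in> K \<Longrightarrow> g (a - v) w = 0"
    using ex_projection[OF fin, of K a] a K_def by auto
  define n where "n = a - v"
  have nF: "n \<in> F" using v(1) a by (auto simp: n_def K_def F_closed)
  have "\<phi> a = \<phi> n + \<phi> v"
    using add[of n v] nF v(1) by (simp add: n_def K_def)
  then have \<phi>n: "\<phi> n \<noteq> 0" using a v(1) by (simp add: K_def)
  have gn: "g n n \<noteq> 0"
    using g_pos[of n] nF \<phi>n by (cases "n = 0") auto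
  have rep: "\<phi> b = g ((\<phi> n / g n n) *\<^sub>R n) b" if b: "b \<in> F" for b
  proof -
    define k where "k = b - (\<phi> b / \<phi> n) *\<^sub>R n"
    have kF: "k \<in> F" using b nF by (simp add: k_def F_closed)
    have beq: "b = k + (\<phi> b / \<phi> n) *\<^sub>R n" by (simp add: k_def)
    have "\<phi> b = \<phi> k + \<phi> b"
      using add[of k "(\<phi> b / \<phi> n) *\<^sub>R n"] sc[OF nF, of "\<phi> b / \<phi> n"] beq kF nF \<phi>n by (simp add: F_closed)
    then have "k \<in> K" using kF by (simp add: K_def)
    then have "g n k = 0" using v(2) by (simp add: n_def)
    then have "g n b = \<phi> b / \<phi> n * g n n"
      using g_add_right[of k "(\<phi> b / \<phi> n) *\<^sub>R n" n] kF nF beq by (simp add: F_closed g_scale_right)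
    then show ?thesis
      using \<phi>n gn nF b by (simp add: g_scale)
  qed
  then show ?thesis using F_closed(4)[OF nF] by blast
qed

end

section \<open>Orthonormal bases of the model spaces\<close>

lemma inner_on_inner: "inner_on UNIV (inner :: 'a::real_inner \<Rightarrow> 'a \<Rightarrow> real)"
proof
  fix a b :: 'a
  show "a \<bullet> b = b \<bullet> a" by (rule inner_commute)
qed (simp_all add: inner_add_left subspace_UNIV)

text \<open>Gram-Schmidt with discarding: the residual of the new vector is normalized and added,
  unless it vanishes.\<close>

lemma ex_orthonormal_span:
  fixes B :: "'a::real_inner set"
  assumes "finite B"
  shows "\<exists>C. finite C \<and> (\<forall>x\<in>C. \<forall>y\<in>C. x \<bullet> y = (if x = y then 1 else 0)) \<and> span C = span B"
  using assms
proof (induction rule: finite_induct)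
  case empty
  then show ?case by (intro exI[of _ "{}"]) auto
next
  case (insert b B)
  then obtain C where C: "finite C" "\<And>x y. x\<in>C \<Longrightarrow> y\<in>C \<Longrightarrow> x \<bullet> y = (if x = y then 1 else 0)" "span C = span B"
    by auto
  interpret inner_on UNIV "inner :: 'a \<Rightarrow> 'a \<Rightarrow> real" by (rule inner_on_inner)
  obtain v where v: "v \<in> span C" "\<And>w. w \<in> span C \<Longrightarrow> (b - v) \<bullet> w = 0"
    using ex_projection_span[OF C(1), of b] by auto
  have sp: "span (insert b B) = span (insert b C)"
    using C(3) by (simp add: span_insert)
  show ?case
  proof (cases "b = v")
    case True
    then have "span (insert b C) = span C" using v(1) by (simp add: span_redundant)
    then show ?thesis using C sp by (intro exI[of _ C]) auto
  next
    case False
    define u where "u = (b - v) /\<^sub>R norm (b - v)"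
    have nz: "norm (b - v) \<noteq> 0" using False by simp
    have u: "u \<bullet> u = 1" "\<And>w. w \<in> span C \<Longrightarrow> u \<bullet> w = 0"
      using nz v(2) by (auto simp: u_def dot_square_norm power2_eq_square)
    have *: "u \<bullet> c = 0" "c \<bullet> u = 0" "c \<noteq> u" if "c \<in> C" for c
      using u(2)[of c] that u(1) by (auto simp: inner_commute span_base)
    have b: "b = norm (b - v) *\<^sub>R u + v" using nz by (simp add: u_def)
    have vi: "v \<in> span (insert u C)" "v \<in> span (insert b C)"
      using v(1) span_mono[of C "insert u C"] span_mono[of C "insert b C"] by auto
    have "b \<in> span (insert u C)"
      by (subst b) (intro span_add span_scale vi, simp add: span_base)
    moreover have "u \<in> span (insert b C)"
      unfolding u_def by (intro span_scale span_diff vi) (simp add: span_base)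
    ultimately have "span (insert u C) = span (insert b C)"
      by (auto simp: span_eq intro: span_base)
    moreover have "u \<notin> C" using *(3) by blast
    ultimately show ?thesis using C sp u * by (intro exI[of _ "insert u C"]) auto
  qed
qed

text \<open>Stands in for \<open>Basis\<close>, which is tied to \<open>euclidean_space\<close>. For
  the model space \<open>unit\<close> it is the empty set.\<close>

definition onb :: "'a::findim_inner set" where
  "onb = (SOME C. finite C \<and> (\<forall>x\<in>C. \<forall>y\<in>C. x \<bullet> y = (if x = y then 1 else 0)) \<and> span C = UNIV)"

lemma onb_props:
  "finite (onb :: 'a::findim_inner set) \<and>
   (\<forall>x\<in>onb. \<forall>y\<in>onb. (x::'a) \<bullet> y = (if x = y then 1 else 0)) \<and> span (onb :: 'a set) = UNIV"
proof -
  obtain B :: "'a set" where "finite B" "span B = UNIV"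
    using ex_finite_span_UNIV by blast
  then have "\<exists>C. finite C \<and> (\<forall>x\<in>C. \<forall>y\<in>C. (x::'a) \<bullet> y = (if x = y then 1 else 0)) \<and> span C = UNIV"
    using ex_orthonormal_span[of B] by metis
  then show ?thesis
    unfolding onb_def by (rule someI_ex)
qed

lemma finite_onb [simp]: "finite (onb :: 'a::findim_inner set)"
  and inner_onb: "\<lbrakk>x \<in> onb; y \<in> onb\<rbrakk> \<Longrightarrow> (x::'a::findim_inner) \<bullet> y = (if x = y then 1 else 0)"
  and span_onb: "span (onb :: 'a::findim_inner set) = UNIV"
  using onb_props[where 'a = 'a] by (blast, metis, blast)

lemma onb_representation: "(\<Sum>b\<in>onb. (x \<bullet> b) *\<^sub>R b) = (x :: 'a::findim_inner)"
proof -
  have "x \<in> span onb" by (simp add: span_onb)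
  then obtain c where x: "x = (\<Sum>b\<in>onb. c b *\<^sub>R b)"
    by (auto simp: span_finite)
  have "x \<bullet> b = c b" if "b \<in> onb" for b
    using that by (simp add: x inner_sum_left inner_onb if_distrib sum.delta cong: if_cong)
  then show ?thesis using x by simp
qed

lemma linear_onb_expand:
  assumes "linear f"
  shows "f x = (\<Sum>b\<in>onb. (x \<bullet> b) *\<^sub>R f (b :: 'a::findim_inner))"
proof -
  have "f x = f (\<Sum>b\<in>onb. (x \<bullet> b) *\<^sub>R b)"
    by (simp only: onb_representation)
  then show ?thesis by (simp add: assms linear_sum linear_scale)
qed

lemma independent_onb: "independent (onb :: 'a::findim_inner set)"
proof -
  have "a = 0" if "(\<Sum>b\<in>onb. a' b *\<^sub>R (b::'a)) = 0" "c \<in> onb" "a = a' c" for a a' c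
  proof -
    have "(\<Sum>b\<in>onb. a' b *\<^sub>R b) \<bullet> c = a' c"
      using that(2) by (simp add: inner_sum_left inner_onb if_distrib sum.delta cong: if_cong)
    then show ?thesis using that by simp
  qed
  then show ?thesis by (auto simp: dependent_finite)
qed

section \<open>Compact balls and completeness\<close>

lemma compact_cball_findim: "compact (cball x r :: 'a::findim_inner set)"
proof -
  \<comment> \<open>Boxes of bounded coordinates are compact by induction on the number of vectors,
    as sums of a segment and a smaller box. By Cauchy-Schwarz a closed ball around 0 lies in such a
    box over \<open>onb\<close>, and it is closed.\<close>
  have K: "compact {\<Sum>b\<in>C. c b *\<^sub>R b | c. \<forall>b\<in>C. \<bar>c b\<bar> \<le> r}" if "finite C" for C :: "'a set" and r
    using that
  proof (induction C rule: finite_induct)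
    case empty
    then show ?case by simp
  next
    case (insert a C)
    have "{\<Sum>b\<in>insert a C. c b *\<^sub>R b | c. \<forall>b\<in>insert a C. \<bar>c b\<bar> \<le> r} =
          {x + y | x y. x \<in> (\<lambda>t. t *\<^sub>R a) ` {-r..r} \<and> y \<in> {\<Sum>b\<in>C. c b *\<^sub>R b | c. \<forall>b\<in>C. \<bar>c b\<bar> \<le> r}}"
      (is "?l = ?r")
    proof safe
      fix c :: "'a \<Rightarrow> real" assume "\<forall>b\<in>insert a C. \<bar>c b\<bar> \<le> r"
      then show "\<exists>x y. (\<Sum>b\<in>insert a C. c b *\<^sub>R b) = x + y \<and> x \<in> (\<lambda>t. t *\<^sub>R a) ` {- r..r} \<and>
          y \<in> {\<Sum>b\<in>C. c b *\<^sub>R b |c. \<forall>b\<in>C. \<bar>c b\<bar> \<le> r}"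
        using insert.hyps
        by (intro exI[of _ "c a *\<^sub>R a"] exI[of _ "\<Sum>b\<in>C. c b *\<^sub>R b"]) (auto simp: abs_le_iff intro!: image_eqI[of _ _ "c a"])
    next
      fix t and c :: "'a \<Rightarrow> real" assume "t \<in> {-r..r}" "\<forall>b\<in>C. \<bar>c b\<bar> \<le> r"
      moreover have "(\<Sum>b\<in>C. (c(a := t)) b *\<^sub>R b) = (\<Sum>b\<in>C. c b *\<^sub>R b)"
        using insert.hyps by (intro sum.cong) auto
      ultimately show "\<exists>d. t *\<^sub>R a + (\<Sum>b\<in>C. c b *\<^sub>R b) = (\<Sum>b\<in>insert a C. d b *\<^sub>R b) \<and> (\<forall>b\<in>insert a C. \<bar>d b\<bar> \<le> r)"
        using insert.hyps by (intro exI[of _ "c(a := t)"]) (auto simp: abs_le_iff)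
    qed
    moreover have "compact ((\<lambda>t. t *\<^sub>R a) ` {-r..r})"
      by (intro compact_continuous_image continuous_intros) auto
    then have "compact ?r"
      by (rule compact_sums[OF _ insert.IH])
    ultimately show ?case
      by (simp only:)
  qed
  have "cball 0 R \<subseteq> {\<Sum>b\<in>onb. c b *\<^sub>R b | c. \<forall>b\<in>(onb::'a set). \<bar>c b\<bar> \<le> R}" for R
  proof
    fix y :: 'a assume "y \<in> cball 0 R"
    moreover have "\<bar>y \<bullet> b\<bar> \<le> norm y" if "b \<in> onb" for b
      using Cauchy_Schwarz_ineq2[of y b] inner_onb[OF that that] by (simp add: norm_eq_sqrt_inner)
    ultimately show "y \<in> {\<Sum>b\<in>onb. c b *\<^sub>R b | c. \<forall>b\<in>(onb::'a set). \<bar>c b\<bar> \<le> R}"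
      by (intro CollectI exI[of _ "\<lambda>b. y \<bullet> b"]) (auto simp: onb_representation intro: order_trans)
  qed
  then have c0: "compact (cball 0 R :: 'a set)" for R
    using compact_Int_closed[OF K[OF finite_onb, of R] closed_cball[of 0 R]] by (simp add: Int_absorb1)
  have "cball x r = (\<lambda>y. x + y) ` cball 0 r"
    by (simp add: image_add_cball)
  then show ?thesis
    using compact_translation[OF c0, of x r] by (simp only:)
qed

text \<open>With completeness the model spaces have sort \<open>banach\<close>, as differentiation
  under the integral sign asks of the parameter space in the ray integrals below.\<close>

instance findim_inner \<subseteq> complete_space
proof
  fix X :: "nat \<Rightarrow> 'a" assume X: "Cauchy X"
  then obtain e where "\<And>n. norm (X n) \<le> e"
    using Cauchy_Bseq[OF X] unfolding Bseq_def by blast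
  then have "range X \<subseteq> cball 0 e" by auto
  moreover have "complete (cball 0 e :: 'a set)"
    by (rule compact_imp_complete[OF compact_cball_findim])
  ultimately obtain l where "X \<longlonglongrightarrow> l"
    using X unfolding complete_def by blast
  then show "convergent X"
    by (rule convergentI)
qed

instance findim_inner \<subseteq> banach ..

section \<open>Calculus of smooth functions\<close>

lemma frechet_derivative_cong_open:
  assumes "open S" "x \<in> S" "\<And>y. y \<in> S \<Longrightarrow> f y = g y"
  shows "frechet_derivative f (at x) = frechet_derivative g (at x)"
proof -
  have "(f has_derivative D) (at x) \<longleftrightarrow> (g has_derivative D) (at x)" for D
    using has_derivative_transform_within_open[OF _ assms(1,2), of f D UNIV g]
      has_derivative_transform_within_open[OF _ assms(1,2), of g D UNIV f] assms(3) by auto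
  then show ?thesis unfolding frechet_derivative_def by simp
qed

lemma Ck_on_cong:
  assumes "open S" "\<And>x. x \<in> S \<Longrightarrow> f x = g x" "Ck_on k S f"
  shows "Ck_on k S g"
  using assms(2,3)
proof (induction k arbitrary: f g)
  case 0
  then show ?case by (auto cong: continuous_on_cong)
next
  case (Suc k)
  have "g differentiable (at x)" if "x \<in> S" for x
  proof -
    have "f differentiable (at x)"
      using Suc.prems(2) that by simp
    then obtain D where "(f has_derivative D) (at x)"
      unfolding differentiable_def by blast
    from has_derivative_transform_within_open[OF this assms(1) that] Suc.prems(1)
    show ?thesis by (auto simp: differentiable_def)
  qed
  moreover have "Ck_on k S (\<lambda>x. frechet_derivative g (at x) v)" for v
  proof (rule Suc.IH)
    show "Ck_on k S (\<lambda>x. frechet_derivative f (at x) v)"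
      using Suc.prems(2) by simp
    show "frechet_derivative f (at x) v = frechet_derivative g (at x) v" if "x \<in> S" for x
      using frechet_derivative_cong_open[OF assms(1) that Suc.prems(1)] by simp
  qed
  ultimately show ?case by simp
qed

text \<open>A derivative at a point is unique, so an explicitly computed \<open>f'\<close> may
  replace \<open>frechet_derivative\<close> in the recursion. The calculus rules below rest on this
  exchange.\<close>

lemma Ck_on_SucI:
  assumes "open S" "\<And>x. x \<in> S \<Longrightarrow> (f has_derivative f' x) (at x)" "\<And>v. Ck_on k S (\<lambda>x. f' x v)"
  shows "Ck_on (Suc k) S f"
proof -
  have "Ck_on k S (\<lambda>x. frechet_derivative f (at x) v)" for v
    by (rule Ck_on_cong[OF assms(1) _ assms(3)[of v]]) (simp add: frechet_derivative_at[OF assms(2)])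
  then show ?thesis using assms(2) by (auto simp: differentiable_def)
qed

lemma Ck_on_Suc_has_derivative:
  "\<lbrakk>Ck_on (Suc k) S f; x \<in> S\<rbrakk> \<Longrightarrow> (f has_derivative frechet_derivative f (at x)) (at x)"
  unfolding Ck_on.simps by (subst frechet_derivative_works[symmetric]) blast

lemma Ck_on_Suc_imp: "Ck_on (Suc k) S f \<Longrightarrow> Ck_on k S f"
proof (induction k arbitrary: f)
  case 0
  then show ?case
    by (auto intro!: continuous_at_imp_continuous_on differentiable_imp_continuous_within)
qed auto

lemma Ck_on_subset: "\<lbrakk>Ck_on k T f; S \<subseteq> T\<rbrakk> \<Longrightarrow> Ck_on k S f"
  by (induction k arbitrary: f) (auto intro: continuous_on_subset)

lemma Ck_on_local:
  assumes "\<And>x. x \<in> S \<Longrightarrow> \<exists>T. open T \<and> x \<in> T \<and> Ck_on k T f"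
  shows "Ck_on k S f"
  using assms
proof (induction k arbitrary: f)
  case 0
  have "continuous (at x) f" if "x \<in> S" for x
    using 0[OF that] by (auto simp: continuous_on_eq_continuous_at)
  then show ?case by (simp add: continuous_at_imp_continuous_on)
next
  case (Suc k)
  have "\<exists>T. open T \<and> x \<in> T \<and> Ck_on k T (\<lambda>x. frechet_derivative f (at x) v)" if "x \<in> S" for x v
    using Suc.prems[OF that] by auto
  then have "Ck_on k S (\<lambda>x. frechet_derivative f (at x) v)" for v
    by (rule Suc.IH)
  then show ?case using Suc.prems by fastforce
qed

lemma Ck_on_const [simp]: "Ck_on k S (\<lambda>x. c)"
  by (induction k arbitrary: c) (auto simp: frechet_derivative_const)

lemma Ck_on_bounded_linear:
  assumes "open S" "bounded_linear h" "Ck_on k S f"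
  shows "Ck_on k S (\<lambda>x. h (f x))"
  using assms(3)
proof (induction k arbitrary: f)
  case 0
  then show ?case using assms(2) by (simp add: bounded_linear.continuous_on)
next
  case (Suc k)
  show ?case
  proof (rule Ck_on_SucI[OF assms(1)])
    show "((\<lambda>x. h (f x)) has_derivative (\<lambda>v. h (frechet_derivative f (at x) v))) (at x)" if "x \<in> S" for x
      by (rule bounded_linear.has_derivative[OF assms(2) Ck_on_Suc_has_derivative[OF Suc.prems that]])
    show "Ck_on k S (\<lambda>x. h (frechet_derivative f (at x) v))" for v
      using Suc by simp
  qed
qed

lemma Ck_on_id: "open S \<Longrightarrow> Ck_on k S (\<lambda>x. x)"
proof (cases k)
  case (Suc k')
  assume "open S"
  then show ?thesis unfolding Suc
    by (intro Ck_on_SucI[where f' = "\<lambda>x v. v"]) auto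
qed simp

lemma Ck_on_add:
  assumes "open S" "Ck_on k S f" "Ck_on k S g"
  shows "Ck_on k S (\<lambda>x. f x + g x)"
  using assms(2,3)
proof (induction k arbitrary: f g)
  case 0
  then show ?case by (simp add: continuous_on_add)
next
  case (Suc k)
  show ?case
  proof (rule Ck_on_SucI[OF assms(1)])
    show "((\<lambda>x. f x + g x) has_derivative (\<lambda>v. frechet_derivative f (at x) v + frechet_derivative g (at x) v)) (at x)"
      if "x \<in> S" for x
      by (intro has_derivative_add Ck_on_Suc_has_derivative[OF Suc.prems(1) that]
          Ck_on_Suc_has_derivative[OF Suc.prems(2) that])
    show "Ck_on k S (\<lambda>x. frechet_derivative f (at x) v + frechet_derivative g (at x) v)" for v
      using Suc by simp
  qed
qed

lemma Ck_on_sum: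
  assumes "open S" "\<And>i. i \<in> I \<Longrightarrow> Ck_on k S (f i)"
  shows "Ck_on k S (\<lambda>x. \<Sum>i\<in>I. f i x)"
  using assms(2) by (induction I rule: infinite_finite_induct) (auto intro: Ck_on_add[OF assms(1)])

lemma Ck_on_bilinear:
  assumes "open S" "bounded_bilinear B" "Ck_on k S f" "Ck_on k S g"
  shows "Ck_on k S (\<lambda>x. B (f x) (g x))"
  using assms(3,4)
proof (induction k arbitrary: f g)
  case 0
  then show ?case by (simp add: bounded_bilinear.continuous_on[OF assms(2)])
next
  case (Suc k)
  show ?case
  proof (rule Ck_on_SucI[OF assms(1)])
    show "((\<lambda>x. B (f x) (g x)) has_derivative
        (\<lambda>v. B (f x) (frechet_derivative g (at x) v) + B (frechet_derivative f (at x) v) (g x))) (at x)"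
      if "x \<in> S" for x
      by (intro bounded_bilinear.FDERIV[OF assms(2)] Ck_on_Suc_has_derivative[OF Suc.prems(1) that]
          Ck_on_Suc_has_derivative[OF Suc.prems(2) that])
    show "Ck_on k S (\<lambda>x. B (f x) (frechet_derivative g (at x) v) + B (frechet_derivative f (at x) v) (g x))" for v
      using Suc by (intro Ck_on_add[OF assms(1)] Suc.IH) (auto intro: Ck_on_Suc_imp)
  qed
qed

lemmas Ck_on_mult = Ck_on_bilinear[OF _ bounded_bilinear_mult]
  and Ck_on_scaleR = Ck_on_bilinear[OF _ bounded_bilinear_scaleR]
  and Ck_on_inner = Ck_on_bilinear[OF _ bounded_bilinear_inner]

lemma Ck_on_inverse:
  fixes f :: "'a::real_normed_vector \<Rightarrow> real"
  assumes "open S" "\<And>x. x \<in> S \<Longrightarrow> f x \<noteq> 0" "Ck_on k S f"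
  shows "Ck_on k S (\<lambda>x. inverse (f x))"
  using assms(3)
proof (induction k)
  case 0
  then show ?case using assms(2) by (auto intro: continuous_on_inverse)
next
  case (Suc k)
  show ?case
  proof (rule Ck_on_SucI[OF assms(1)])
    show "((\<lambda>x. inverse (f x)) has_derivative
        (\<lambda>v. - 1 * (inverse (f x) * frechet_derivative f (at x) v * inverse (f x)))) (at x)"
      if "x \<in> S" for x
      using Deriv.has_derivative_inverse[OF assms(2)[OF that] Ck_on_Suc_has_derivative[OF Suc.prems that]] by simp
    show "Ck_on k S (\<lambda>x. - 1 * (inverse (f x) * frechet_derivative f (at x) v * inverse (f x)))" for v
      using Suc assms(1) by (intro Ck_on_mult Ck_on_const Suc.IH) (auto intro: Ck_on_Suc_imp)
  qed
qed

text \<open>In the chain rule the derivative of \<open>g\<close> is taken in a direction that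
  depends on \<open>x\<close>, which the induction hypothesis cannot handle. Expanding that
  direction in \<open>onb\<close> leaves derivatives of \<open>g\<close> in fixed directions, with
  coefficients from the derivative of \<open>f\<close>; hence the finite-dimensional type in the
  middle.\<close>

lemma Ck_on_compose:
  fixes f :: "'a::real_normed_vector \<Rightarrow> 'b::findim_inner" and g :: "'b \<Rightarrow> 'c::real_normed_vector"
  assumes "open S" "open T" "f ` S \<subseteq> T" "Ck_on k S f" "Ck_on k T g"
  shows "Ck_on k S (\<lambda>x. g (f x))"
  using assms(4,5)
proof (induction k arbitrary: g)
  case 0
  then show ?case using assms(3) continuous_on_compose2[of T g S f] by simp
next
  case (Suc k)
  have gd: "(g has_derivative frechet_derivative g (at y)) (at y)" if "y \<in> T" for y
    by (rule Ck_on_Suc_has_derivative[OF Suc.prems(2) that])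
  show ?case
  proof (rule Ck_on_SucI[OF assms(1)])
    fix x assume x: "x \<in> S"
    then have fx: "f x \<in> T" using assms(3) by auto
    have "((\<lambda>x. g (f x)) has_derivative (\<lambda>v. frechet_derivative g (at (f x)) (frechet_derivative f (at x) v))) (at x)"
      using has_derivative_compose[OF Ck_on_Suc_has_derivative[OF Suc.prems(1) x] gd[OF fx]] by simp
    also have "(\<lambda>v. frechet_derivative g (at (f x)) (frechet_derivative f (at x) v)) =
        (\<lambda>v. \<Sum>b\<in>onb. (frechet_derivative f (at x) v \<bullet> b) *\<^sub>R frechet_derivative g (at (f x)) b)"
      by (intro ext linear_onb_expand bounded_linear.linear[OF has_derivative_bounded_linear[OF gd[OF fx]]])
    finally show "((\<lambda>x. g (f x)) has_derivative (\<lambda>v. \<Sum>b\<in>onb. (frechet_derivative f (at x) v \<bullet> b) *\<^sub>R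
        frechet_derivative g (at (f x)) b)) (at x)" .
  next
    fix v
    show "Ck_on k S (\<lambda>x. \<Sum>b\<in>onb. (frechet_derivative f (at x) v \<bullet> b) *\<^sub>R
        frechet_derivative g (at (f x)) b)"
    proof (intro Ck_on_sum Ck_on_scaleR assms(1))
      fix b :: 'b
      show "Ck_on k S (\<lambda>x. frechet_derivative f (at x) v \<bullet> b)"
        using Suc.prems(1) by (intro Ck_on_inner assms(1)) auto
      show "Ck_on k S (\<lambda>x. frechet_derivative g (at (f x)) b)"
        using Suc.prems Ck_on_Suc_imp[OF Suc.prems(1)] by (intro Suc.IH) auto
    qed
  qed
qed

section \<open>Closure properties of smooth maps\<close>

lemma smooth_on_cong: "\<lbrakk>open S; \<And>x. x \<in> S \<Longrightarrow> f x = g x; smooth_on S f\<rbrakk> \<Longrightarrow> smooth_on S g"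
  unfolding smooth_on_def using Ck_on_cong by blast

lemma smooth_on_local:
  "(\<And>x. x \<in> S \<Longrightarrow> \<exists>T. open T \<and> x \<in> T \<and> smooth_on T f) \<Longrightarrow> smooth_on S f"
  unfolding smooth_on_def by (intro allI Ck_on_local) blast

lemma smooth_on_subset: "\<lbrakk>smooth_on T f; S \<subseteq> T\<rbrakk> \<Longrightarrow> smooth_on S f"
  unfolding smooth_on_def using Ck_on_subset by blast

lemma smooth_on_const [simp]: "smooth_on S (\<lambda>x. c)"
  by (simp add: smooth_on_def)

lemma smooth_on_id: "open S \<Longrightarrow> smooth_on S (\<lambda>x. x)"
  by (simp add: smooth_on_def Ck_on_id)

lemma smooth_on_add: "\<lbrakk>open S; smooth_on S f; smooth_on S g\<rbrakk> \<Longrightarrow> smooth_on S (\<lambda>x. f x + g x)"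
  by (simp add: smooth_on_def Ck_on_add)

lemma smooth_on_mult:
  fixes f g :: "'a::real_normed_vector \<Rightarrow> real"
  shows "\<lbrakk>open S; smooth_on S f; smooth_on S g\<rbrakk> \<Longrightarrow> smooth_on S (\<lambda>x. f x * g x)"
  by (simp add: smooth_on_def Ck_on_mult)

lemma smooth_on_inner: "\<lbrakk>open S; smooth_on S f; smooth_on S g\<rbrakk> \<Longrightarrow> smooth_on S (\<lambda>x. f x \<bullet> g x)"
  by (simp add: smooth_on_def Ck_on_inner)

lemma smooth_on_diff:
  assumes "open S" "smooth_on S f" "smooth_on S g"
  shows "smooth_on S (\<lambda>x. f x - g x)"
proof -
  have "smooth_on S (\<lambda>x. - g x)"
    using assms by (simp add: smooth_on_def Ck_on_bounded_linear[OF _ bounded_linear_minus[OF bounded_linear_ident]])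
  from smooth_on_add[OF assms(1,2) this] show ?thesis by simp
qed

lemma smooth_on_inverse:
  fixes f :: "'a::real_normed_vector \<Rightarrow> real"
  shows "\<lbrakk>open S; \<And>x. x \<in> S \<Longrightarrow> f x \<noteq> 0; smooth_on S f\<rbrakk> \<Longrightarrow> smooth_on S (\<lambda>x. inverse (f x))"
  by (simp add: smooth_on_def Ck_on_inverse)

lemma smooth_on_compose:
  fixes f :: "'a::real_normed_vector \<Rightarrow> 'b::findim_inner"
  shows "\<lbrakk>open S; open T; f ` S \<subseteq> T; smooth_on S f; smooth_on T g\<rbrakk> \<Longrightarrow> smooth_on S (\<lambda>x. g (f x))"
  unfolding smooth_on_def using Ck_on_compose by blast

lemma smooth_on_has_derivative:
  "\<lbrakk>smooth_on S f; x \<in> S\<rbrakk> \<Longrightarrow> (f has_derivative frechet_derivative f (at x)) (at x)"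
  unfolding smooth_on_def by (rule Ck_on_Suc_has_derivative[of 0]) auto

lemma smooth_on_frechet_derivative: "smooth_on S f \<Longrightarrow> smooth_on S (\<lambda>x. frechet_derivative f (at x) v)"
  unfolding smooth_on_def by (metis Ck_on.simps(2))

lemma smooth_on_imp_continuous_on: "smooth_on S f \<Longrightarrow> continuous_on S f"
  unfolding smooth_on_def by (metis Ck_on.simps(1))

subsection \<open>Bump functions\<close>

text \<open>For \<open>n = 0\<close> this is the classical flat function
  \<open>exp (- 1 / t)\<close> extended by 0. The denominators \<open>t ^ n\<close> make the family
  closed, up to linear combinations, under differentiation, so all derivatives are treated by one
  induction over arbitrary \<open>n\<close>.\<close>

definition flat_exp :: "nat \<Rightarrow> real \<Rightarrow> real" where
  "flat_exp n t = (if t > 0 then exp (- 1 / t) / t ^ n else 0)"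

lemma flat_exp_has_derivative:
  "(flat_exp n has_real_derivative flat_exp (n + 2) t - real n * flat_exp (n + 1) t) (at t)"
proof (cases "t > 0")
  case True
  have "((\<lambda>t. exp (- 1 / t) / t ^ n) has_real_derivative
      flat_exp (n + 2) t - real n * flat_exp (n + 1) t) (at t)"
    using True
    apply (auto intro!: derivative_eq_intros simp: flat_exp_def)
    apply (cases n)
     apply (auto simp: field_simps power2_eq_square)
    done
  then show ?thesis
    by (rule has_field_derivative_transform_within_open[of _ _ _ "{0<..}"])
      (use True in \<open>auto simp: flat_exp_def\<close>)
next
  case nonpos: False
  show ?thesis
  proof (cases "t < 0")
    case True
    have "((\<lambda>t. 0) has_real_derivative flat_exp (n + 2) t - real n * flat_exp (n + 1) t) (at t)"
      using True by (simp add: flat_exp_def)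
    then show ?thesis
      by (rule has_field_derivative_transform_within_open[of _ _ _ "{..<0}"])
        (use True in \<open>auto simp: flat_exp_def\<close>)
  next
    case False
    with nonpos have t: "t = 0" by simp
    \<comment> \<open>The difference quotient at 0 from the right is the formula for
      \<open>flat_exp (n + 1)\<close>. Substituting the inverse of \<open>y\<close> turns its limit
      into that of a power divided by an exponential at infinity.\<close>
    have "((\<lambda>y. exp (- 1 / y) / y ^ (n + 1)) \<longlongrightarrow> 0) (at_right (0::real))"
    proof -
      have "((\<lambda>y. inverse y ^ (n + 1) / exp (inverse y)) \<longlongrightarrow> 0) (at_right (0::real))"
        by (rule filterlim_compose[OF tendsto_power_div_exp_0 filterlim_inverse_at_top_right])
      moreover have "inverse y ^ (n + 1) / exp (inverse y) = exp (- 1 / y) / y ^ (n + 1)" for y :: real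
        using exp_minus[of "inverse y"] by (simp add: divide_inverse power_inverse mult_ac)
      ultimately show ?thesis by (simp only:)
    qed
    then have "((\<lambda>y. (flat_exp n y - flat_exp n 0) / (y - 0)) \<longlongrightarrow> 0) (at_right 0)"
      by (rule Lim_transform_eventually)
        (auto simp: flat_exp_def eventually_at_right_field intro!: exI[of _ 1])
    moreover have "((\<lambda>y. (flat_exp n y - flat_exp n 0) / (y - 0)) \<longlongrightarrow> 0) (at_left 0)"
      by (rule Lim_transform_eventually[of "\<lambda>y. 0"])
        (auto simp: flat_exp_def eventually_at_left_field intro!: exI[of _ "-1"])
    ultimately have "((\<lambda>y. (flat_exp n y - flat_exp n 0) / (y - 0)) \<longlongrightarrow> 0) (at 0)"
      by (simp add: filterlim_split_at)
    then show ?thesis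
      unfolding t by (simp add: has_field_derivative_iff flat_exp_def)
  qed
qed

lemma smooth_on_flat_exp: "smooth_on UNIV (flat_exp n)"
proof -
  have d: "(flat_exp n has_derivative (\<lambda>v. (flat_exp (n + 2) t + (- real n) * flat_exp (n + 1) t) * v)) (at t)" for n t
    using flat_exp_has_derivative[of n t] by (simp add: has_field_derivative_def)
  have "Ck_on k UNIV (flat_exp n)" for k
  proof (induction k arbitrary: n)
    case 0
    have "isCont (flat_exp n) t" for t
      using DERIV_isCont[OF flat_exp_has_derivative] .
    then show ?case by (auto simp: continuous_at_imp_continuous_on)
  next
    case (Suc k)
    show ?case
      by (rule Ck_on_SucI[OF open_UNIV d]) (intro Ck_on_mult Ck_on_add Ck_on_const Suc.IH open_UNIV)
  qed
  then show ?thesis by (simp add: smooth_on_def)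
qed

text \<open>The squared distance is smooth where the distance itself is not, so
  \<open>flat_exp 0\<close> is applied to \<open>r\<^sup>2\<close> minus the squared distance:
  negative arguments outside the ball, and the value at the centre is normalized to 1.\<close>

lemma ex_bump:
  fixes x0 :: "'a::findim_inner"
  assumes "r > 0"
  obtains \<beta> :: "'a \<Rightarrow> real" where "smooth_on UNIV \<beta>" "\<beta> x0 = 1" "\<And>x. x \<notin> cball x0 r \<Longrightarrow> \<beta> x = 0"
proof -
  let ?c = "flat_exp 0 (r\<^sup>2)"
  let ?\<beta> = "\<lambda>x. inverse ?c * flat_exp 0 (r\<^sup>2 - (x - x0) \<bullet> (x - x0))"
  have "?c > 0" using assms by (simp add: flat_exp_def)
  then have "?\<beta> x0 = 1" by simp
  moreover have "smooth_on UNIV (\<lambda>x. r\<^sup>2 - (x - x0) \<bullet> (x - x0))"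
    by (intro smooth_on_diff smooth_on_inner smooth_on_id smooth_on_const open_UNIV)
  then have "smooth_on UNIV ?\<beta>"
    by (intro smooth_on_mult smooth_on_const open_UNIV smooth_on_compose[OF _ _ _ _ smooth_on_flat_exp]) auto
  moreover have "?\<beta> x = 0" if "x \<notin> cball x0 r" for x
  proof -
    have "r\<^sup>2 < (norm (x - x0))\<^sup>2"
      using that assms by (intro power_strict_mono) (auto simp: dist_norm norm_minus_commute)
    then show ?thesis by (simp add: flat_exp_def dot_square_norm)
  qed
  ultimately show ?thesis using that by blast
qed

subsection \<open>Hadamard's lemma\<close>

text \<open>Differentiation under the integral sign. By the chain rule each derivative pulls out one
  factor \<open>t\<close> of the ray, so with the weight \<open>t ^ m\<close> the class of these
  integrals is closed under differentiation.\<close>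

lemma ray_integral_has_derivative:
  fixes w :: "'a::findim_inner \<Rightarrow> real"
  assumes w: "smooth_on (ball x0 r) w" and x: "x \<in> ball x0 r"
  shows "((\<lambda>x. integral {0..1} (\<lambda>t. t ^ m * w (x0 + t *\<^sub>R (x - x0)))) has_derivative
    (\<lambda>v. integral {0..1} (\<lambda>t. t ^ Suc m * frechet_derivative w (at (x0 + t *\<^sub>R (x - x0))) v))) (at x)"
proof -
  define \<gamma> where "\<gamma> x t = x0 + t *\<^sub>R (x - x0)" for x and t :: real
  have \<gamma>: "\<gamma> y t \<in> ball x0 r" if "y \<in> ball x0 r" "t \<in> {0..1}" for y t
  proof -
    have "norm (t *\<^sub>R (y - x0)) \<le> norm (y - x0)"
      using that(2) by (simp add: mult_left_le_one_le)
    also have "\<dots> < r" using that(1) by (simp add: dist_norm norm_minus_commute)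
    finally show ?thesis by (simp add: \<gamma>_def dist_norm)
  qed
  have wd: "(w has_derivative frechet_derivative w (at y)) (at y)" if "y \<in> ball x0 r" for y
    by (rule smooth_on_has_derivative[OF w that])
  \<comment> \<open>The derivative of the integrand as a bounded linear map. Writing it as a
    combination of coordinate functionals reduces its joint continuity to that of finitely many
    partial derivatives.\<close>
  define D where "D x t = (\<Sum>b\<in>onb. (t ^ Suc m * frechet_derivative w (at (\<gamma> x t)) b) *\<^sub>R blinfun_inner_left b)" for x t
  have D: "blinfun_apply (D y t) v = t ^ Suc m * frechet_derivative w (at (\<gamma> y t)) v"
    if "y \<in> ball x0 r" "t \<in> {0..1}" for y t v
  proof -
    have "frechet_derivative w (at (\<gamma> y t)) v = (\<Sum>b\<in>onb. (v \<bullet> b) *\<^sub>R frechet_derivative w (at (\<gamma> y t)) b)"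
      by (rule linear_onb_expand)
        (rule bounded_linear.linear[OF has_derivative_bounded_linear[OF wd[OF \<gamma>[OF that]]]])
    then show ?thesis
      by (simp add: D_def blinfun.sum_left blinfun.scaleR_left sum_distrib_left inner_commute mult_ac)
  qed
  have cont\<gamma>: "continuous_on (ball x0 r \<times> {0..1}) (\<lambda>z. \<gamma> (fst z) (snd z))"
    unfolding \<gamma>_def by (intro continuous_intros)
  have contD: "continuous_on (ball x0 r \<times> {0..1}) (\<lambda>(x, t). D x t)"
  proof -
    have "continuous_on (ball x0 r \<times> {0..1}) (\<lambda>z. frechet_derivative w (at (\<gamma> (fst z) (snd z))) b)" for b
      by (rule continuous_on_compose2[OF smooth_on_imp_continuous_on[OF smooth_on_frechet_derivative[OF w]] cont\<gamma>])
        (use \<gamma> in auto)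
    then show ?thesis
      unfolding D_def case_prod_beta by (intro continuous_intros)
  qed
  have wder: "((\<lambda>y. t ^ m * w (\<gamma> y t)) has_derivative blinfun_apply (D y t)) (at y within ball x0 r)"
    if "y \<in> ball x0 r" "t \<in> cbox 0 1" for y t
  proof -
    have t: "t \<in> {0..1}" using that(2) by simp
    have "((\<lambda>y. \<gamma> y t) has_derivative (\<lambda>v. t *\<^sub>R v)) (at y)"
      unfolding \<gamma>_def by (auto intro!: derivative_eq_intros)
    from has_derivative_compose[OF this wd[OF \<gamma>[OF that(1) t]]]
    have "((\<lambda>y. t ^ m * w (\<gamma> y t)) has_derivative (\<lambda>v. t ^ m * frechet_derivative w (at (\<gamma> y t)) (t *\<^sub>R v))) (at y)"
      by (intro has_derivative_mult_right) simp
    moreover have "frechet_derivative w (at (\<gamma> y t)) (t *\<^sub>R v) = t * frechet_derivative w (at (\<gamma> y t)) v" for v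
      using linear_scale[OF bounded_linear.linear[OF has_derivative_bounded_linear[OF wd[OF \<gamma>[OF that(1) t]]]], of t v]
      by simp
    then have "(\<lambda>v. t ^ m * frechet_derivative w (at (\<gamma> y t)) (t *\<^sub>R v)) = blinfun_apply (D y t)"
      using D[OF that(1) t] by (simp add: fun_eq_iff mult_ac)
    ultimately show ?thesis
      using has_derivative_at_withinI by fastforce
  qed
  have int: "(\<lambda>t. t ^ m * w (\<gamma> y t)) integrable_on cbox 0 1" if "y \<in> ball x0 r" for y
  proof (rule integrable_continuous)
    have "continuous_on (cbox 0 1) (\<lambda>t. w (\<gamma> y t))"
      by (rule continuous_on_compose2[OF smooth_on_imp_continuous_on[OF w]])
        (use \<gamma>[OF that] in \<open>auto simp: \<gamma>_def intro!: continuous_intros\<close>)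
    then show "continuous_on (cbox 0 1) (\<lambda>t. t ^ m * w (\<gamma> y t))"
      by (intro continuous_intros)
  qed
  have "((\<lambda>x. integral (cbox 0 1) (\<lambda>t. t ^ m * w (\<gamma> x t))) has_derivative
      blinfun_apply (integral (cbox 0 1) (D x))) (at x within ball x0 r)"
    by (rule leibniz_rule[OF wder int _ x]) (use contD in auto)
  then have *: "((\<lambda>x. integral {0..1} (\<lambda>t. t ^ m * w (\<gamma> x t))) has_derivative
      blinfun_apply (integral {0..1} (D x))) (at x)"
    unfolding at_within_open[OF x open_ball] cbox_interval .
  have "continuous_on {0..1} (\<lambda>t. (\<lambda>(x, t). D x t) (x, t))"
    by (rule continuous_on_compose2[OF contD]) (use x in \<open>auto intro!: continuous_intros\<close>)
  then have "D x integrable_on {0..1}"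
    by (intro integrable_continuous_interval) simp
  moreover have "integral {0..1} (\<lambda>t. blinfun_apply (D x t) v) =
      integral {0..1} (\<lambda>t. t ^ Suc m * frechet_derivative w (at (\<gamma> x t)) v)" for v
    by (rule integral_cong) (rule D[OF x])
  ultimately have "blinfun_apply (integral {0..1} (D x)) v =
      integral {0..1} (\<lambda>t. t ^ Suc m * frechet_derivative w (at (\<gamma> x t)) v)" for v
    using integral_linear[of "D x" "{0..1}" "\<lambda>F. blinfun_apply F v"]
    by (simp add: blinfun.bounded_linear_left comp_def)
  then have "blinfun_apply (integral {0..1} (D x)) =
      (\<lambda>v. integral {0..1} (\<lambda>t. t ^ Suc m * frechet_derivative w (at (\<gamma> x t)) v))"
    by (rule ext)
  with * show ?thesis by (simp only: \<gamma>_def)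
qed

lemma smooth_on_ray_integral:
  fixes w :: "'a::findim_inner \<Rightarrow> real"
  assumes "smooth_on (ball x0 r) w"
  shows "smooth_on (ball x0 r) (\<lambda>x. integral {0..1} (\<lambda>t. t ^ m * w (x0 + t *\<^sub>R (x - x0))))"
proof -
  have "Ck_on k (ball x0 r) (\<lambda>x. integral {0..1} (\<lambda>t. t ^ m * w (x0 + t *\<^sub>R (x - x0))))" for k
    using assms
  proof (induction k arbitrary: w m)
    case 0
    show ?case
      unfolding Ck_on.simps
      by (intro continuous_at_imp_continuous_on ballI
          has_derivative_continuous[OF ray_integral_has_derivative[OF 0]])
  next
    case (Suc k)
    show ?case
      by (rule Ck_on_SucI[OF open_ball ray_integral_has_derivative[OF Suc.prems]])
        (assumption, rule Suc.IH, rule smooth_on_frechet_derivative[OF Suc.prems])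
  qed
  then show ?thesis by (simp add: smooth_on_def)
qed

text \<open>The fundamental theorem of calculus along the segment from \<open>x0\<close> to
  \<open>x\<close>, which stays in the ball, with the derivative expanded in \<open>onb\<close>. The
  factors \<open>G b\<close> are averages of the partial derivatives over the segment, hence smooth
  as ray integrals.\<close>

lemma hadamard:
  fixes w :: "'a::findim_inner \<Rightarrow> real"
  assumes w: "smooth_on (ball x0 r) w" and r: "r > 0"
  shows "\<exists>G. (\<forall>b. smooth_on (ball x0 r) (G b)) \<and> (\<forall>b. G b x0 = frechet_derivative w (at x0) b) \<and>
    (\<forall>x\<in>ball x0 r. w x = w x0 + (\<Sum>b\<in>onb. ((x - x0) \<bullet> b) * G b x))"
proof -
  \<comment> \<open>The factor \<open>t ^ 0\<close> only puts the integrand into the shape of a ray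
    integral with \<open>m = 0\<close>.\<close>
  define G where "G b x = integral {0..1} (\<lambda>t. t ^ 0 * frechet_derivative w (at (x0 + t *\<^sub>R (x - x0))) b)" for b x
  have 1: "smooth_on (ball x0 r) (G b)" for b
    unfolding G_def by (intro smooth_on_ray_integral smooth_on_frechet_derivative w)
  have 2: "G b x0 = frechet_derivative w (at x0) b" for b
    by (simp add: G_def)
  have 3: "w x = w x0 + (\<Sum>b\<in>onb. ((x - x0) \<bullet> b) * G b x)" if x: "x \<in> ball x0 r" for x
  proof -
    define \<gamma> where "\<gamma> t = x0 + t *\<^sub>R (x - x0)" for t :: real
    have \<gamma>: "\<gamma> t \<in> ball x0 r" if "t \<in> {0..1}" for t
    proof -
      have "norm (t *\<^sub>R (x - x0)) \<le> norm (x - x0)"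
        using that by (simp add: mult_left_le_one_le)
      also have "\<dots> < r" using x by (simp add: dist_norm norm_minus_commute)
      finally show ?thesis by (simp add: \<gamma>_def dist_norm)
    qed
    note wd = smooth_on_has_derivative[OF w \<gamma>]
    have lin: "linear (frechet_derivative w (at (\<gamma> t)))" if "t \<in> {0..1}" for t
      by (rule bounded_linear.linear[OF has_derivative_bounded_linear[OF wd[OF that]]])
    have "((\<lambda>t. w (\<gamma> t)) has_vector_derivative frechet_derivative w (at (\<gamma> t)) (x - x0)) (at t within {0..1})"
      if "t \<in> {0..1}" for t
    proof -
      have "(\<gamma> has_derivative (\<lambda>s. s *\<^sub>R (x - x0))) (at t)"
        unfolding \<gamma>_def by (auto intro!: derivative_eq_intros)
      from has_derivative_compose[OF this wd[OF that]] show ?thesis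
        using linear_scale[OF lin[OF that]]
        by (simp add: has_vector_derivative_def has_derivative_at_withinI)
    qed
    then have "((\<lambda>t. frechet_derivative w (at (\<gamma> t)) (x - x0)) has_integral (w (\<gamma> 1) - w (\<gamma> 0))) {0..1}"
      by (intro fundamental_theorem_of_calculus) auto
    moreover have "((\<lambda>t. frechet_derivative w (at (\<gamma> t)) (x - x0)) has_integral
        (\<Sum>b\<in>onb. ((x - x0) \<bullet> b) * G b x)) {0..1}"
    proof (rule has_integral_eq)
      show "(\<Sum>b\<in>onb. ((x - x0) \<bullet> b) * frechet_derivative w (at (\<gamma> t)) b) =
          frechet_derivative w (at (\<gamma> t)) (x - x0)" if "t \<in> {0..1}" for t
        using linear_onb_expand[OF lin[OF that], of "x - x0"] by simp
      have "continuous_on {0..1} (\<lambda>t. frechet_derivative w (at (\<gamma> t)) b)" for b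
        by (rule continuous_on_compose2[OF smooth_on_imp_continuous_on[OF smooth_on_frechet_derivative[OF w]]])
          (use \<gamma> in \<open>auto simp: \<gamma>_def intro!: continuous_intros\<close>)
      then have "((\<lambda>t. frechet_derivative w (at (\<gamma> t)) b) has_integral G b x) {0..1}" for b
        unfolding G_def \<gamma>_def by (simp add: integrable_integral integrable_continuous_interval)
      then show "((\<lambda>t. \<Sum>b\<in>onb. ((x - x0) \<bullet> b) * frechet_derivative w (at (\<gamma> t)) b) has_integral
          (\<Sum>b\<in>onb. ((x - x0) \<bullet> b) * G b x)) {0..1}"
        by (intro has_integral_sum has_integral_mult_right) auto
    qed
    ultimately have "w (\<gamma> 1) - w (\<gamma> 0) = (\<Sum>b\<in>onb. ((x - x0) \<bullet> b) * G b x)"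
      by (rule has_integral_unique)
    then show ?thesis
      by (simp add: \<gamma>_def)
  qed
  show ?thesis
    by (intro exI[of _ G] conjI allI ballI 1 2 3)
qed

section \<open>Smooth functions on manifolds\<close>

locale smooth_mfd =
  fixes \<A> :: "('m::{t2_space, second_countable_topology}, 'e::findim_inner) atlas"
  assumes smooth_manifold: "smooth_manifold \<A>"
begin

lemma ex_chart: obtains U \<phi> where "(U, \<phi>) \<in> \<A>" "p \<in> U"
  using smooth_manifold unfolding smooth_manifold_def by fast

context
  fixes U :: "'m set" and \<phi> :: "'m \<Rightarrow> 'e"
  assumes chart: "(U, \<phi>) \<in> \<A>"
begin

lemma open_chart: "open U" "open (\<phi> ` U)"
  and chart_homeomorphism: "homeomorphism U (\<phi> ` U) \<phi> (inv_into U \<phi>)"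
  using smooth_manifold chart unfolding smooth_manifold_def by fast+

lemma inv_chart: "p \<in> U \<Longrightarrow> inv_into U \<phi> (\<phi> p) = p"
  using chart_homeomorphism by (simp add: homeomorphism_def)

lemma continuous_on_chart: "continuous_on U \<phi>" "continuous_on (\<phi> ` U) (inv_into U \<phi>)"
  using chart_homeomorphism by (simp_all add: homeomorphism_def)

lemma open_chart_image:
  assumes "open W"
  shows "open (\<phi> ` (U \<inter> W))"
proof -
  have "\<phi> ` (U \<inter> W) = \<phi> ` U \<inter> inv_into U \<phi> -` W"
    using inv_chart by auto
  then show ?thesis
    using continuous_open_preimage[OF continuous_on_chart(2) open_chart(2) assms] by simp
qed

end

lemma smooth_transition:
  "\<lbrakk>(U, \<phi>) \<in> \<A>; (V, \<psi>) \<in> \<A>\<rbrakk> \<Longrightarrow> smooth_on (\<phi> ` (U \<inter> V)) (\<psi> \<circ> inv_into U \<phi>)"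
  using smooth_manifold unfolding smooth_manifold_def by fast

lemma smooth_fun_onD:
  "\<lbrakk>smooth_fun_on \<A> W f; (U, \<phi>) \<in> \<A>\<rbrakk> \<Longrightarrow> smooth_on (\<phi> ` (U \<inter> W)) (f \<circ> inv_into U \<phi>)"
  unfolding smooth_fun_on_def by blast

lemma smooth_fun_on_subset: "\<lbrakk>smooth_fun_on \<A> W f; T \<subseteq> W\<rbrakk> \<Longrightarrow> smooth_fun_on \<A> T f"
  unfolding smooth_fun_on_def by (blast intro: smooth_on_subset)

lemma C_inf_smooth_fun_on: "f \<in> C_inf \<A> \<Longrightarrow> smooth_fun_on \<A> W f"
  unfolding C_inf_def using smooth_fun_on_subset by blast

lemma smooth_fun_on_cong:
  assumes "open W" "\<And>p. p \<in> W \<Longrightarrow> f p = h p" "smooth_fun_on \<A> W f"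
  shows "smooth_fun_on \<A> W h"
  unfolding smooth_fun_on_def
proof clarify
  fix U \<phi> assume c: "(U, \<phi>) \<in> \<A>"
  show "smooth_on (\<phi> ` (U \<inter> W)) (h \<circ> inv_into U \<phi>)"
    by (rule smooth_on_cong[OF open_chart_image[OF c assms(1)] _ smooth_fun_onD[OF assms(3) c]])
      (auto simp: inv_chart[OF c] assms(2))
qed

text \<open>The definition tests every chart of the atlas; composing with the smooth transition
  maps, one chart that contains \<open>W\<close> is enough.\<close>

lemma smooth_fun_on_chartI:
  assumes c: "(V, \<psi>) \<in> \<A>" and W: "open W" "W \<subseteq> V" and f: "smooth_on (\<psi> ` W) (f \<circ> inv_into V \<psi>)"
  shows "smooth_fun_on \<A> W f"
  unfolding smooth_fun_on_def
proof clarify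
  fix U \<phi> assume d: "(U, \<phi>) \<in> \<A>"
  have op: "open (\<phi> ` (U \<inter> W))" "open (\<psi> ` W)"
    using open_chart_image[OF d W(1)] open_chart_image[OF c W(1)] W(2) by (auto simp: Int_absorb1)
  have "smooth_on (\<phi> ` (U \<inter> W)) (\<lambda>x. (f \<circ> inv_into V \<psi>) ((\<psi> \<circ> inv_into U \<phi>) x))"
    by (rule smooth_on_compose[OF op _ smooth_on_subset[OF smooth_transition[OF d c]] f])
      (use W(2) in \<open>auto simp: inv_chart[OF d]\<close>)
  then show "smooth_on (\<phi> ` (U \<inter> W)) (f \<circ> inv_into U \<phi>)"
    by (rule smooth_on_cong[OF op(1), rotated]) (use W(2) in \<open>auto simp: inv_chart[OF c] inv_chart[OF d]\<close>)
qed

lemma smooth_fun_on_local: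
  assumes "\<And>p. p \<in> W \<Longrightarrow> \<exists>T. open T \<and> p \<in> T \<and> smooth_fun_on \<A> T f"
  shows "smooth_fun_on \<A> W f"
  unfolding smooth_fun_on_def
proof clarify
  fix U \<phi> assume c: "(U, \<phi>) \<in> \<A>"
  show "smooth_on (\<phi> ` (U \<inter> W)) (f \<circ> inv_into U \<phi>)"
  proof (rule smooth_on_local)
    fix x assume "x \<in> \<phi> ` (U \<inter> W)"
    then obtain p where p: "p \<in> U" "p \<in> W" "x = \<phi> p" by auto
    then obtain T where "open T" "p \<in> T" "smooth_fun_on \<A> T f"
      using assms by blast
    then show "\<exists>T. open T \<and> x \<in> T \<and> smooth_on T (f \<circ> inv_into U \<phi>)"
      using p open_chart_image[OF c] smooth_fun_onD[OF _ c]
      by (intro exI[of _ "\<phi> ` (U \<inter> T)"]) auto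
  qed
qed

section \<open>Algebra of smooth functions on an open set\<close>

lemma smooth_fun_on_const [simp]: "smooth_fun_on \<A> W (\<lambda>p. c)"
  by (simp add: smooth_fun_on_def comp_def)

lemma smooth_fun_on_add:
  assumes "open W" "smooth_fun_on \<A> W f" "smooth_fun_on \<A> W h"
  shows "smooth_fun_on \<A> W (\<lambda>p. f p + h p)"
  unfolding smooth_fun_on_def
proof clarify
  fix U \<phi> assume c: "(U, \<phi>) \<in> \<A>"
  show "smooth_on (\<phi> ` (U \<inter> W)) ((\<lambda>p. f p + h p) \<circ> inv_into U \<phi>)"
    using smooth_on_add[OF open_chart_image[OF c assms(1)] smooth_fun_onD[OF assms(2) c] smooth_fun_onD[OF assms(3) c]]
    by (simp add: comp_def)
qed

lemma smooth_fun_on_mult: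
  assumes "open W" "smooth_fun_on \<A> W f" "smooth_fun_on \<A> W h"
  shows "smooth_fun_on \<A> W (\<lambda>p. f p * h p)"
  unfolding smooth_fun_on_def
proof clarify
  fix U \<phi> assume c: "(U, \<phi>) \<in> \<A>"
  show "smooth_on (\<phi> ` (U \<inter> W)) ((\<lambda>p. f p * h p) \<circ> inv_into U \<phi>)"
    using smooth_on_mult[OF open_chart_image[OF c assms(1)] smooth_fun_onD[OF assms(2) c] smooth_fun_onD[OF assms(3) c]]
    by (simp add: comp_def)
qed

lemma smooth_fun_on_sum:
  assumes "open W" "\<And>i. i \<in> I \<Longrightarrow> smooth_fun_on \<A> W (f i)"
  shows "smooth_fun_on \<A> W (\<lambda>p. \<Sum>i\<in>I. f i p)"
  using assms(2) by (induction I rule: infinite_finite_induct) (auto intro: smooth_fun_on_add[OF assms(1)])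

lemma smooth_fun_on_prod:
  assumes "open W" "\<And>i. i \<in> I \<Longrightarrow> smooth_fun_on \<A> W (f i)"
  shows "smooth_fun_on \<A> W (\<lambda>p. \<Prod>i\<in>I. f i p)"
  using assms(2) by (induction I rule: infinite_finite_induct) (auto intro: smooth_fun_on_mult[OF assms(1)])

lemma smooth_fun_on_inverse:
  assumes "open W" "smooth_fun_on \<A> W f" "\<And>p. p \<in> W \<Longrightarrow> f p \<noteq> 0"
  shows "smooth_fun_on \<A> W (\<lambda>p. inverse (f p))"
  unfolding smooth_fun_on_def comp_def
proof clarify
  fix U \<phi> assume c: "(U, \<phi>) \<in> \<A>"
  show "smooth_on (\<phi> ` (U \<inter> W)) (\<lambda>x. inverse (f (inv_into U \<phi> x)))"
    using smooth_fun_onD[OF assms(2) c] assms(3)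
    by (intro smooth_on_inverse open_chart_image[OF c assms(1)]) (auto simp: inv_chart[OF c] comp_def)
qed

text \<open>Serves to keep a Jacobian determinant nonzero on a neighbourhood of a point where it is
  nonzero.\<close>

lemma smooth_fun_on_imp_continuous_on:
  assumes "open W" "smooth_fun_on \<A> W f"
  shows "continuous_on W f"
proof -
  have "continuous (at p) f" if p: "p \<in> W" for p
  proof -
    obtain U \<phi> where c: "(U, \<phi>) \<in> \<A>" "p \<in> U" by (rule ex_chart)
    have "continuous_on (U \<inter> W) (\<lambda>q. (f \<circ> inv_into U \<phi>) (\<phi> q))"
      by (rule continuous_on_compose2[OF smooth_on_imp_continuous_on[OF smooth_fun_onD[OF assms(2) c(1)]]
            continuous_on_subset[OF continuous_on_chart(1)[OF c(1)]]]) auto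
    then have "continuous_on (U \<inter> W) f"
      by (rule continuous_on_eq) (auto simp: inv_chart[OF c(1)])
    then show ?thesis
      using continuous_on_eq_continuous_at[of "U \<inter> W" f] open_chart(1)[OF c(1)] assms(1) p c(2)
      by (auto simp: open_Int)
  qed
  then show ?thesis by (simp add: continuous_at_imp_continuous_on)
qed

lemma C_inf_const: "(\<lambda>p. c) \<in> C_inf \<A>"
  and C_inf_add: "\<lbrakk>f \<in> C_inf \<A>; h \<in> C_inf \<A>\<rbrakk> \<Longrightarrow> (\<lambda>p. f p + h p) \<in> C_inf \<A>"
  and C_inf_mult: "\<lbrakk>f \<in> C_inf \<A>; h \<in> C_inf \<A>\<rbrakk> \<Longrightarrow> (\<lambda>p. f p * h p) \<in> C_inf \<A>"
  by (simp_all add: C_inf_def smooth_fun_on_add smooth_fun_on_mult)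

lemma C_inf_sum: "(\<And>i. i \<in> I \<Longrightarrow> f i \<in> C_inf \<A>) \<Longrightarrow> (\<lambda>p. \<Sum>i\<in>I. f i p) \<in> C_inf \<A>"
  by (simp add: C_inf_def smooth_fun_on_sum)

text \<open>The preimage of \<open>K\<close> in the manifold is compact, hence closed because the
  manifold is Hausdorff. Its complement is thus an open set around every point outside
  \<open>V\<close>, and there the extension is constantly 0.\<close>

lemma C_inf_extend_by_zero:
  assumes c: "(V, \<psi>) \<in> \<A>" and w: "smooth_on UNIV w" and K: "compact K" "K \<subseteq> \<psi> ` V"
    and 0: "\<And>x. x \<notin> K \<Longrightarrow> w x = 0"
  shows "(\<lambda>p. if p \<in> V then w (\<psi> p) else 0) \<in> C_inf \<A>"
  unfolding C_inf_def mem_Collect_eq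
proof (rule smooth_fun_on_local)
  fix p :: 'm
  show "\<exists>T. open T \<and> p \<in> T \<and> smooth_fun_on \<A> T (\<lambda>p. if p \<in> V then w (\<psi> p) else 0)"
  proof (cases "p \<in> V")
    case True
    have "smooth_fun_on \<A> V (\<lambda>p. if p \<in> V then w (\<psi> p) else 0)"
    proof (rule smooth_fun_on_chartI[OF c open_chart(1)[OF c] order_refl])
      show "smooth_on (\<psi> ` V) ((\<lambda>p. if p \<in> V then w (\<psi> p) else 0) \<circ> inv_into V \<psi>)"
        by (rule smooth_on_cong[OF open_chart(2)[OF c] _ smooth_on_subset[OF w]]) (auto simp: inv_chart[OF c])
    qed
    then show ?thesis using True open_chart(1)[OF c] by blast
  next
    case False
    have "compact (inv_into V \<psi> ` K)"
      by (intro compact_continuous_image continuous_on_subset[OF continuous_on_chart(2)[OF c]] K)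
    then have op: "open (- inv_into V \<psi> ` K)"
      by (simp add: compact_imp_closed open_Compl)
    have "smooth_fun_on \<A> (- inv_into V \<psi> ` K) (\<lambda>p. if p \<in> V then w (\<psi> p) else 0)"
    proof (rule smooth_fun_on_cong[OF op])
      fix q assume q: "q \<in> - inv_into V \<psi> ` K"
      show "0 = (if q \<in> V then w (\<psi> q) else 0)"
      proof (cases "q \<in> V")
        case True
        then have "\<psi> q \<notin> K" using q inv_chart[OF c True] by force
        then show ?thesis using 0 by simp
      qed simp
    qed simp
    moreover have "p \<notin> inv_into V \<psi> ` K"
      using False K(2) by (auto simp: inv_chart[OF c] dest!: subsetD)
    ultimately show ?thesis using op by blast
  qed
qed

subsection \<open>Tangent vectors in a chart\<close>

lemma C_inf_has_derivative:
  assumes "(V, \<psi>) \<in> \<A>" "u \<in> C_inf \<A>" "q \<in> V"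
  shows "((u \<circ> inv_into V \<psi>) has_derivative frechet_derivative (u \<circ> inv_into V \<psi>) (at (\<psi> q))) (at (\<psi> q))"
  using smooth_on_has_derivative[OF smooth_fun_onD[OF C_inf_smooth_fun_on[OF assms(2), of UNIV] assms(1)]] assms(3)
  by simp

text \<open>The value 0 on non-smooth functions is the normalization built into
  \<open>tangent_space\<close>; it lets a derivation and a directional derivative be equal as total
  functions.\<close>

definition chart_deriv :: "'m set \<Rightarrow> ('m \<Rightarrow> 'e) \<Rightarrow> 'm \<Rightarrow> 'e \<Rightarrow> 'm tangent" where
  "chart_deriv V \<psi> q v = (\<lambda>u. if u \<in> C_inf \<A> then frechet_derivative (u \<circ> inv_into V \<psi>) (at (\<psi> q)) v else 0)"

lemma chart_deriv_eq:
  assumes "(V, \<psi>) \<in> \<A>" "u \<in> C_inf \<A>" "q \<in> V" "((u \<circ> inv_into V \<psi>) has_derivative D) (at (\<psi> q))"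
  shows "chart_deriv V \<psi> q v u = D v"
  using frechet_derivative_at[OF assms(4)] assms(2) by (simp add: chart_deriv_def)

lemma chart_deriv_tangent:
  assumes c: "(V, \<psi>) \<in> \<A>" and q: "q \<in> V"
  shows "chart_deriv V \<psi> q v \<in> tangent_space \<A> q"
proof -
  note d = C_inf_has_derivative[OF c _ q]
  have "chart_deriv V \<psi> q v (\<lambda>p. f p + h p) = chart_deriv V \<psi> q v f + chart_deriv V \<psi> q v h"
    if "f \<in> C_inf \<A>" "h \<in> C_inf \<A>" for f h
    using chart_deriv_eq[OF c C_inf_add[OF that] q, of _ v]
      has_derivative_add[OF d[OF that(1)] d[OF that(2)]] that
    by (simp add: chart_deriv_def comp_def)
  moreover have "chart_deriv V \<psi> q v (\<lambda>p. r * f p) = r * chart_deriv V \<psi> q v f"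
    if "f \<in> C_inf \<A>" for f r
    using chart_deriv_eq[OF c C_inf_mult[OF C_inf_const that] q, of r _ v]
      has_derivative_mult_right[OF d[OF that], of r] that
    by (simp add: chart_deriv_def comp_def)
  moreover have "chart_deriv V \<psi> q v (\<lambda>p. f p * h p) = f q * chart_deriv V \<psi> q v h + h q * chart_deriv V \<psi> q v f"
    if "f \<in> C_inf \<A>" "h \<in> C_inf \<A>" for f h
    using chart_deriv_eq[OF c C_inf_mult[OF that] q, of _ v]
      has_derivative_mult[OF d[OF that(1)] d[OF that(2)]] that
    by (simp add: chart_deriv_def comp_def inv_chart[OF c q] mult.commute)
  ultimately show ?thesis
    unfolding tangent_space_def by (simp add: chart_deriv_def)
qed

lemma chart_deriv_sum:
  assumes "(V, \<psi>) \<in> \<A>" "q \<in> V" "u \<in> C_inf \<A>"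
  shows "chart_deriv V \<psi> q v u = (\<Sum>b\<in>onb. (v \<bullet> b) * chart_deriv V \<psi> q b u)"
  using linear_onb_expand[OF bounded_linear.linear[OF has_derivative_bounded_linear[OF
          C_inf_has_derivative[OF assms(1,3,2)]]], of v] assms(3)
  by (simp add: chart_deriv_def)

lemma smooth_chart_deriv:
  assumes c: "(V, \<psi>) \<in> \<A>" and u: "u \<in> C_inf \<A>"
  shows "smooth_fun_on \<A> V (\<lambda>q. chart_deriv V \<psi> q v u)"
proof (rule smooth_fun_on_chartI[OF c open_chart(1)[OF c] order_refl])
  have "smooth_on (\<psi> ` V) (\<lambda>x. frechet_derivative (u \<circ> inv_into V \<psi>) (at x) v)"
    using smooth_fun_onD[OF C_inf_smooth_fun_on[OF u, of UNIV] c] by (intro smooth_on_frechet_derivative) simp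
  then show "smooth_on (\<psi> ` V) ((\<lambda>q. chart_deriv V \<psi> q v u) \<circ> inv_into V \<psi>)"
    by (rule smooth_on_cong[OF open_chart(2)[OF c], rotated]) (auto simp: inv_chart[OF c] chart_deriv_def u)
qed

text \<open>The purpose is the last clause: multiplying by \<open>\<beta>\<close> turns a function
  smooth on a coordinate ball into a global smooth function, on which a derivation can be evaluated.
  The value 1 is imposed at the centre alone, so \<open>\<beta>\<close> is carried through the
  product rule later.\<close>

definition cutoff_in :: "'m set \<Rightarrow> ('m \<Rightarrow> 'e) \<Rightarrow> 'm \<Rightarrow> real \<Rightarrow> ('e \<Rightarrow> real) \<Rightarrow> bool" where
  "cutoff_in V \<psi> q r \<beta> \<longleftrightarrow> r > 0 \<and> ball (\<psi> q) r \<subseteq> \<psi> ` V \<and> \<beta> (\<psi> q) = 1 \<and>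
     (\<forall>x. x \<notin> ball (\<psi> q) r \<longrightarrow> \<beta> x = 0) \<and> smooth_on UNIV \<beta> \<and>
     (\<forall>F. smooth_on (ball (\<psi> q) r) F \<longrightarrow> (\<lambda>p. if p \<in> V then \<beta> (\<psi> p) * F (\<psi> p) else 0) \<in> C_inf \<A>)"

lemma ex_cutoff:
  assumes c: "(V, \<psi>) \<in> \<A>" and q: "q \<in> V"
  shows "\<exists>r \<beta>. cutoff_in V \<psi> q r \<beta>"
proof -
  obtain r where r: "r > 0" "ball (\<psi> q) r \<subseteq> \<psi> ` V"
    using open_chart(2)[OF c] q by (meson imageI openE)
  \<comment> \<open>Half the radius keeps the closed ball that carries the bump inside the open
    ball, so that outside it the product with a function \<open>F\<close> known only on the open
    ball is 0.\<close>
  obtain \<beta> where \<beta>: "smooth_on UNIV \<beta>" "\<beta> (\<psi> q) = (1::real)" "\<And>x. x \<notin> cball (\<psi> q) (r/2) \<Longrightarrow> \<beta> x = 0"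
    using ex_bump[of "r/2" "\<psi> q"] r(1) by auto
  have sub: "cball (\<psi> q) (r/2) \<subseteq> ball (\<psi> q) r"
    using r(1) by (intro subsetI) simp
  have "(\<lambda>p. if p \<in> V then \<beta> (\<psi> p) * F (\<psi> p) else 0) \<in> C_inf \<A>"
    if F: "smooth_on (ball (\<psi> q) r) F" for F
  proof (rule C_inf_extend_by_zero[OF c _ compact_cball_findim, where w = "\<lambda>x. \<beta> x * F x"])
    show "smooth_on UNIV (\<lambda>x. \<beta> x * F x)"
    proof (rule smooth_on_local)
      fix x
      show "\<exists>T. open T \<and> x \<in> T \<and> smooth_on T (\<lambda>x. \<beta> x * F x)"
      proof (cases "x \<in> ball (\<psi> q) r")
        case True
        then show ?thesis
          using smooth_on_mult[OF open_ball smooth_on_subset[OF \<beta>(1)] F] by blast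
      next
        case False
        have "smooth_on (- cball (\<psi> q) (r/2)) (\<lambda>x. \<beta> x * F x)"
          by (rule smooth_on_cong[of _ "\<lambda>x. 0"]) (auto simp: \<beta>(3) open_Compl)
        then show ?thesis using False sub by (intro exI[of _ "- cball (\<psi> q) (r/2)"]) auto
      qed
    qed
    show "cball (\<psi> q) (r/2) \<subseteq> \<psi> ` V" using sub r(2) by blast
    show "\<beta> x * F x = 0" if "x \<notin> cball (\<psi> q) (r/2)" for x
      using \<beta>(3)[OF that] by simp
  qed
  moreover have "\<beta> x = 0" if "x \<notin> ball (\<psi> q) r" for x
    using \<beta>(3) that sub by blast
  ultimately have "cutoff_in V \<psi> q r \<beta>"
    unfolding cutoff_in_def using r \<beta>(1,2) by blast
  then show ?thesis by blast
qed

text \<open>The test function is the cut-off linear form \<open>(x - \<psi> q) \<bullet> v\<close>.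
  The linear form vanishes and \<open>\<beta>\<close> is 1 at the centre, so its derivative along
  \<open>v\<close> is \<open>v \<bullet> v\<close>.\<close>

lemma chart_deriv_nonzero:
  assumes c: "(V, \<psi>) \<in> \<A>" and q: "q \<in> V" and v: "v \<noteq> 0"
  shows "chart_deriv V \<psi> q v \<noteq> (\<lambda>u. 0)"
proof -
  obtain r \<beta> where "cutoff_in V \<psi> q r \<beta>"
    using ex_cutoff[OF c q] by blast
  then have r: "r > 0" "ball (\<psi> q) r \<subseteq> \<psi> ` V" and \<beta>: "\<beta> (\<psi> q) = 1"
    "\<And>x. x \<notin> ball (\<psi> q) r \<Longrightarrow> \<beta> x = 0" "smooth_on UNIV \<beta>"
    and ext: "\<And>F. smooth_on (ball (\<psi> q) r) F \<Longrightarrow> (\<lambda>p. if p \<in> V then \<beta> (\<psi> p) * F (\<psi> p) else 0) \<in> C_inf \<A>"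
    unfolding cutoff_in_def by blast+
  define u where "u = (\<lambda>p. if p \<in> V then \<beta> (\<psi> p) * ((\<psi> p - \<psi> q) \<bullet> v) else 0)"
  have u: "u \<in> C_inf \<A>"
    unfolding u_def by (intro ext smooth_on_inner smooth_on_diff smooth_on_id smooth_on_const open_ball)
  have "((\<lambda>x. (x - \<psi> q) \<bullet> v) has_derivative (\<lambda>y. y \<bullet> v)) (at (\<psi> q))"
    by (auto intro!: derivative_eq_intros)
  from has_derivative_mult[OF smooth_on_has_derivative[OF \<beta>(3) UNIV_I] this]
  have "((\<lambda>x. \<beta> x * ((x - \<psi> q) \<bullet> v)) has_derivative (\<lambda>y. y \<bullet> v)) (at (\<psi> q))"
    using \<beta>(1) by simp
  then have "((u \<circ> inv_into V \<psi>) has_derivative (\<lambda>y. y \<bullet> v)) (at (\<psi> q))"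
    by (rule has_derivative_transform_within_open[OF _ open_chart(2)[OF c]])
      (use q in \<open>auto simp: u_def inv_chart[OF c]\<close>)
  from chart_deriv_eq[OF c u q this, of v] v show ?thesis by auto
qed

text \<open>The components of \<open>v\<close> are the values of \<open>X\<close> on the cut-off
  coordinate functions \<open>Y b\<close>. Hadamard's lemma expresses \<open>u\<close> near
  \<open>q\<close> by those functions, with factors whose values at \<open>q\<close> are the partial
  derivatives of \<open>u\<close>.\<close>

lemma tangent_space_chart_deriv:
  assumes X: "X \<in> tangent_space \<A> q" and c: "(V, \<psi>) \<in> \<A>" and q: "q \<in> V"
  obtains v where "X = chart_deriv V \<psi> q v"
proof -
  have X_add: "X (\<lambda>p. f p + h p) = X f + X h"
    and X_scale: "X (\<lambda>p. r * f p) = r * X f"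
    and X_mult: "X (\<lambda>p. f p * h p) = f q * X h + h q * X f"
    if "f \<in> C_inf \<A>" "h \<in> C_inf \<A>" for f h r
    using X that unfolding tangent_space_def by blast+
  have X_junk: "X f = 0" if "f \<notin> C_inf \<A>" for f
    using X that unfolding tangent_space_def by blast
  have X_sum: "X (\<lambda>p. \<Sum>i\<in>I. f i p) = (\<Sum>i\<in>I. X (f i))"
    if "finite I" "\<And>i. i \<in> I \<Longrightarrow> f i \<in> C_inf \<A>" for I :: "'e set" and f
    using that
  proof (induction I rule: finite_induct)
    case empty
    show ?case using X_scale[OF C_inf_const C_inf_const, of 0 0] by simp
  next
    case (insert i I)
    then show ?case by (simp add: X_add C_inf_sum)
  qed
  obtain r \<beta> where "cutoff_in V \<psi> q r \<beta>"
    using ex_cutoff[OF c q] by blast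
  then have r: "r > 0" "ball (\<psi> q) r \<subseteq> \<psi> ` V" and \<beta>: "\<beta> (\<psi> q) = 1"
    "\<And>x. x \<notin> ball (\<psi> q) r \<Longrightarrow> \<beta> x = 0" "smooth_on UNIV \<beta>"
    and ext: "\<And>F. smooth_on (ball (\<psi> q) r) F \<Longrightarrow> (\<lambda>p. if p \<in> V then \<beta> (\<psi> p) * F (\<psi> p) else 0) \<in> C_inf \<A>"
    unfolding cutoff_in_def by blast+
  define E where "E F = (\<lambda>p. if p \<in> V then \<beta> (\<psi> p) * F (\<psi> p) else 0)" for F
  have E: "E F \<in> C_inf \<A>" if "smooth_on (ball (\<psi> q) r) F" for F
    unfolding E_def by (rule ext[OF that])
  define Y where "Y b = E (\<lambda>x. (x - \<psi> q) \<bullet> b)" for b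
  have Y: "Y b \<in> C_inf \<A>" for b
    unfolding Y_def by (intro E smooth_on_inner smooth_on_diff smooth_on_id smooth_on_const open_ball)
  have Yq: "Y b q = 0" for b by (simp add: Y_def E_def)
  \<comment> \<open>Hadamard's identity is multiplied by the cutoff twice: one copy globalizes the
    coordinate function and the other the factor \<open>G b\<close>, so each summand is a product of
    two global smooth functions.\<close>
  define B2 where "B2 = (\<lambda>p. E (\<lambda>x. 1) p * E (\<lambda>x. 1) p)"
  have B2: "B2 \<in> C_inf \<A>"
    unfolding B2_def by (intro C_inf_mult E smooth_on_const)
  have B2q: "B2 q = 1" using q \<beta>(1) by (simp add: B2_def E_def)
  define v where "v = (\<Sum>b\<in>onb. X (Y b) *\<^sub>R b)"
  have vb: "v \<bullet> b = X (Y b)" if "b \<in> onb" for b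
    using that by (simp add: v_def inner_sum_left inner_onb if_distrib sum.delta cong: if_cong)
  have "X u = chart_deriv V \<psi> q v u" for u
  proof (cases "u \<in> C_inf \<A>")
    case u: True
    define w where "w = u \<circ> inv_into V \<psi>"
    have w: "smooth_on (ball (\<psi> q) r) w"
      using smooth_fun_onD[OF C_inf_smooth_fun_on[OF u, of UNIV] c] r(2)
      unfolding w_def by (auto intro: smooth_on_subset)
    obtain G where "(\<forall>b. smooth_on (ball (\<psi> q) r) (G b)) \<and>
        (\<forall>b. G b (\<psi> q) = frechet_derivative w (at (\<psi> q)) b) \<and>
        (\<forall>x\<in>ball (\<psi> q) r. w x = w (\<psi> q) + (\<Sum>b\<in>onb. ((x - \<psi> q) \<bullet> b) * G b x))"
      by (rule exE[OF hadamard[OF w r(1)]])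
    then have G: "\<And>b. smooth_on (ball (\<psi> q) r) (G b)" "\<And>b. G b (\<psi> q) = frechet_derivative w (at (\<psi> q)) b"
      "\<And>x. x \<in> ball (\<psi> q) r \<Longrightarrow> w x = w (\<psi> q) + (\<Sum>b\<in>onb. ((x - \<psi> q) \<bullet> b) * G b x)"
      by auto
    have wq: "w (\<psi> p) = u p" if "p \<in> V" for p
      using inv_chart[OF c that] by (simp add: w_def)
    have "B2 p * u p = u q * B2 p + (\<Sum>b\<in>onb. Y b p * E (G b) p)" for p
    proof (cases "p \<in> V \<and> \<psi> p \<in> ball (\<psi> q) r")
      case True
      then have "u p = u q + (\<Sum>b\<in>onb. ((\<psi> p - \<psi> q) \<bullet> b) * G b (\<psi> p))"
        using G(3)[of "\<psi> p"] wq q by simp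
      then have "\<beta> (\<psi> p) * \<beta> (\<psi> p) * u p =
          \<beta> (\<psi> p) * \<beta> (\<psi> p) * (u q + (\<Sum>b\<in>onb. ((\<psi> p - \<psi> q) \<bullet> b) * G b (\<psi> p)))"
        by (simp only:)
      then show ?thesis
        using True by (simp add: B2_def Y_def E_def sum_distrib_left distrib_left mult_ac)
    next
      case False
      then show ?thesis using \<beta>(2) by (auto simp: B2_def Y_def E_def)
    qed
    then have "X (\<lambda>p. B2 p * u p) = X (\<lambda>p. u q * B2 p + (\<Sum>b\<in>onb. Y b p * E (G b) p))"
      by (simp only:)
    also have "\<dots> = u q * X B2 + (\<Sum>b\<in>onb. X (\<lambda>p. Y b p * E (G b) p))"
      using X_add[of "\<lambda>p. u q * B2 p" "\<lambda>p. \<Sum>b\<in>onb. Y b p * E (G b) p"]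
        X_sum[of onb "\<lambda>b p. Y b p * E (G b) p"] X_scale[OF B2 B2]
      by (simp add: C_inf_mult C_inf_const C_inf_sum B2 Y E G(1))
    also have "\<dots> = u q * X B2 + (\<Sum>b\<in>onb. (v \<bullet> b) * frechet_derivative w (at (\<psi> q)) b)"
    proof -
      have "E (G b) q = frechet_derivative w (at (\<psi> q)) b" for b
        using q \<beta>(1) by (simp add: E_def G(2))
      then have "X (\<lambda>p. Y b p * E (G b) p) = (v \<bullet> b) * frechet_derivative w (at (\<psi> q)) b" if "b \<in> onb" for b
        using X_mult[OF Y E[OF G(1)], of b b] Yq[of b] vb[OF that] by simp
      then show ?thesis by (simp cong: sum.cong)
    qed
    \<comment> \<open>As \<open>B2 q = 1\<close>, the product rule gives
      \<open>X u + u q * X B2\<close> on the left-hand side, and the terms with \<open>X B2\<close>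
      cancel.\<close>
    finally have "X u = (\<Sum>b\<in>onb. (v \<bullet> b) * frechet_derivative w (at (\<psi> q)) b)"
      using X_mult[OF B2 u] unfolding B2q by linarith
    then show ?thesis
      by (subst chart_deriv_sum[OF c q u]) (simp add: chart_deriv_def u w_def)
  qed (simp add: X_junk chart_deriv_def)
  then show ?thesis using that by blast
qed

end

section \<open>Pullback of smooth functions along a smooth map\<close>

lemma C_inf_pullback:
  assumes "smooth_mfd \<B>" "smooth_mfd \<A>" and \<iota>: "smooth_map \<B> \<A> \<iota>" and f: "f \<in> C_inf \<A>"
  shows "f \<circ> \<iota> \<in> C_inf \<B>"
proof -
  interpret N: smooth_mfd \<B> by fact
  interpret M: smooth_mfd \<A> by fact
  show ?thesis
    unfolding C_inf_def mem_Collect_eq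
  proof (rule N.smooth_fun_on_local)
    fix q
    obtain V \<psi> where c: "(V, \<psi>) \<in> \<B>" "q \<in> V" by (rule N.ex_chart)
    obtain U \<phi> where d: "(U, \<phi>) \<in> \<A>" "\<iota> q \<in> U" by (rule M.ex_chart)
    have "open (\<iota> -` U)"
      using \<iota> unfolding smooth_map_def by (intro open_vimage M.open_chart(1)[OF d(1)]) simp
    then have op: "open (V \<inter> \<iota> -` U)"
      using N.open_chart(1)[OF c(1)] by blast
    have op': "open (\<psi> ` (V \<inter> \<iota> -` U))"
      using N.open_chart_image[OF c(1) op] by simp
    have 1: "smooth_on (\<psi> ` (V \<inter> \<iota> -` U)) (\<phi> \<circ> \<iota> \<circ> inv_into V \<psi>)"
      using \<iota> c(1) d(1) unfolding smooth_map_def by blast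
    have 2: "smooth_on (\<phi> ` U) (f \<circ> inv_into U \<phi>)"
      using M.smooth_fun_onD[OF M.C_inf_smooth_fun_on[OF f, of UNIV] d(1)] by simp
    have "smooth_on (\<psi> ` (V \<inter> \<iota> -` U)) (\<lambda>x. (f \<circ> inv_into U \<phi>) ((\<phi> \<circ> \<iota> \<circ> inv_into V \<psi>) x))"
      by (rule smooth_on_compose[OF op' M.open_chart(2)[OF d(1)] _ 1 2]) (auto simp: N.inv_chart[OF c(1)])
    then have "smooth_on (\<psi> ` (V \<inter> \<iota> -` U)) (f \<circ> \<iota> \<circ> inv_into V \<psi>)"
      by (rule smooth_on_cong[OF op', rotated]) (auto simp: N.inv_chart[OF c(1)] M.inv_chart[OF d(1)])
    then have "smooth_fun_on \<B> (V \<inter> \<iota> -` U) (f \<circ> \<iota>)"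
      by (intro N.smooth_fun_on_chartI[OF c(1) op]) auto
    then show "\<exists>T. open T \<and> q \<in> T \<and> smooth_fun_on \<B> T (f \<circ> \<iota>)"
      using op c(2) d(2) by blast
  qed
qed

subsection \<open>Linear systems with smooth coefficients\<close>

lemma det_nonzero_if_kernel_trivial:
  fixes m :: "nat \<Rightarrow> nat \<Rightarrow> real"
  assumes "\<And>v. (\<And>i. i < n \<Longrightarrow> (\<Sum>j<n. m i j * v j) = 0) \<Longrightarrow> (\<And>j. j < n \<Longrightarrow> v j = 0)"
  shows "Determinant.det (Matrix.mat n n (\<lambda>(i, j). m i j)) \<noteq> 0"
proof
  let ?A = "Matrix.mat n n (\<lambda>(i, j). m i j)"
  have A: "?A \<in> carrier_mat n n" by simp
  assume "Determinant.det ?A = 0"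
  then obtain v where v: "v \<in> carrier_vec n" "v \<noteq> 0\<^sub>v n" "?A *\<^sub>v v = 0\<^sub>v n"
    using det_0_iff_vec_prod_zero[OF A] by blast
  have "(\<Sum>j<n. m i j * vec_index v j) = 0" if "i < n" for i
  proof -
    have "vec_index (?A *\<^sub>v v) i = (\<Sum>j<n. m i j * vec_index v j)"
      using that v(1) by (simp add: scalar_prod_def atLeast0LessThan)
    then show ?thesis using v(3) that by simp
  qed
  then have "vec_index v j = 0" if "j < n" for j
    using assms[of "vec_index v"] that by blast
  then show False using v(1,2) by (auto simp: vec_eq_iff)
qed

text \<open>Cramer's rule from the adjugate. The minors are spelled out as matrices of entries of
  \<open>m\<close>, with row \<open>i\<close> and column \<open>k\<close> skipped by the index
  shifts, so that smoothness of determinants applies to them directly when the entries depend on a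
  point.\<close>

lemma cramer_solution:
  fixes m :: "nat \<Rightarrow> nat \<Rightarrow> real"
  assumes "\<And>i. i < n \<Longrightarrow> (\<Sum>j<n. m i j * c j) = y i" and k: "k < n"
  shows "Determinant.det (Matrix.mat n n (\<lambda>(i, j). m i j)) * c k =
    (\<Sum>i<n. (-1) ^ (i + k) * Determinant.det (Matrix.mat (n - 1) (n - 1)
      (\<lambda>(i', j'). m (if i' < i then i' else Suc i') (if j' < k then j' else Suc j'))) * y i)"
proof -
  let ?A = "Matrix.mat n n (\<lambda>(i, j). m i j)"
  have A: "?A \<in> carrier_mat n n" by simp
  note adj = adj_mat[OF A]
  have adj_entry: "adj_mat ?A $$ (k, i) = (-1) ^ (i + k) * Determinant.det (Matrix.mat (n - 1) (n - 1)
      (\<lambda>(i', j'). m (if i' < i then i' else Suc i') (if j' < k then j' else Suc j')))" if i: "i < n" for i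
  proof -
    have "mat_delete ?A i k = Matrix.mat (n - 1) (n - 1)
        (\<lambda>(i', j'). m (if i' < i then i' else Suc i') (if j' < k then j' else Suc j'))"
      unfolding mat_delete_def by (rule Matrix.eq_matI) auto
    then show ?thesis
      using i k by (simp add: adj_mat_def cofactor_def)
  qed
  have "(\<Sum>i<n. adj_mat ?A $$ (k, i) * m i j) = (if k = j then Determinant.det ?A else 0)" if "j < n" for j
  proof -
    have "(adj_mat ?A * ?A) $$ (k, j) = (\<Sum>i<n. adj_mat ?A $$ (k, i) * m i j)"
      using that k adj(1) by (simp add: scalar_prod_def atLeast0LessThan)
    moreover have "(adj_mat ?A * ?A) $$ (k, j) = (if k = j then Determinant.det ?A else 0)"
      unfolding adj(3) using that k by simp
    ultimately show ?thesis by (simp only:)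
  qed
  then have "Determinant.det ?A * c k = (\<Sum>j<n. (\<Sum>i<n. adj_mat ?A $$ (k, i) * m i j) * c j)"
    using k by (simp add: if_distrib[of "\<lambda>x. x * _"] sum.delta' cong: if_cong)
  also have "\<dots> = (\<Sum>i<n. adj_mat ?A $$ (k, i) * (\<Sum>j<n. m i j * c j))"
    unfolding sum_distrib_left sum_distrib_right by (subst sum.swap) (simp add: mult.assoc)
  also have "\<dots> = (\<Sum>i<n. adj_mat ?A $$ (k, i) * y i)"
    using assms(1) by simp
  finally show ?thesis using adj_entry by simp
qed

context smooth_mfd
begin

lemma smooth_fun_on_det:
  assumes "open W" "\<And>i j. \<lbrakk>i < n; j < n\<rbrakk> \<Longrightarrow> smooth_fun_on \<A> W (m i j)"
  shows "smooth_fun_on \<A> W (\<lambda>p. Determinant.det (Matrix.mat n n (\<lambda>(i, j). m i j p)))"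
proof -
  have "smooth_fun_on \<A> W (\<lambda>p. \<Sum>\<pi> | \<pi> permutes {0..<n}. of_int (sign \<pi>) * (\<Prod>i = 0..<n. m i (\<pi> i) p))"
    by (intro smooth_fun_on_sum smooth_fun_on_mult smooth_fun_on_prod assms smooth_fun_on_const)
      (use permutes_in_image in fastforce)+
  moreover have "Determinant.det (Matrix.mat n n (\<lambda>(i, j). m i j p)) =
      (\<Sum>\<pi> | \<pi> permutes {0..<n}. of_int (sign \<pi>) * (\<Prod>i = 0..<n. m i (\<pi> i) p))" for p
  proof -
    have "(\<Prod>i = 0..<n. Matrix.mat n n (\<lambda>(i, j). m i j p) $$ (i, \<pi> i)) = (\<Prod>i = 0..<n. m i (\<pi> i) p)"
      if "\<pi> permutes {0..<n}" for \<pi>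
      using permutes_in_image[OF that] by (intro prod.cong) auto
    then show ?thesis
      unfolding Determinant.det_def by (auto intro!: sum.cong)
  qed
  ultimately show ?thesis by (simp only:)
qed

text \<open>No regularity is assumed of \<open>c\<close>: it is forced by the equations, since
  Cramer's rule writes \<open>c k\<close> as a quotient of smooth functions. Both the section on the
  base and the field on the leaf obtain their smoothness from this lemma.\<close>

lemma smooth_fun_on_solution:
  assumes W: "open W"
    and m: "\<And>i j. \<lbrakk>i < n; j < n\<rbrakk> \<Longrightarrow> smooth_fun_on \<A> W (m i j)"
    and y: "\<And>i. i < n \<Longrightarrow> smooth_fun_on \<A> W (y i)"
    and det: "\<And>p. p \<in> W \<Longrightarrow> Determinant.det (Matrix.mat n n (\<lambda>(i, j). m i j p)) \<noteq> 0"
    and sol: "\<And>p i. \<lbrakk>p \<in> W; i < n\<rbrakk> \<Longrightarrow> (\<Sum>j<n. m i j p * c j p) = y i p"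
    and k: "k < n"
  shows "smooth_fun_on \<A> W (c k)"
proof -
  let ?d = "\<lambda>p. Determinant.det (Matrix.mat n n (\<lambda>(i, j). m i j p))"
  let ?s = "\<lambda>p. \<Sum>i<n. (-1) ^ (i + k) * Determinant.det (Matrix.mat (n - 1) (n - 1)
      (\<lambda>(i', j'). m (if i' < i then i' else Suc i') (if j' < k then j' else Suc j') p)) * y i p"
  have sm: "smooth_fun_on \<A> W (\<lambda>p. inverse (?d p) * ?s p)"
    by (intro smooth_fun_on_mult smooth_fun_on_inverse smooth_fun_on_sum smooth_fun_on_const smooth_fun_on_det W)
      (use m y det in auto)
  have eq: "inverse (?d p) * ?s p = c k p" if "p \<in> W" for p
    using cramer_solution[of n "\<lambda>i j. m i j p" "\<lambda>j. c j p" "\<lambda>i. y i p", OF sol[OF that] k] det[OF that]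
    by (simp add: field_simps)
  show ?thesis
    by (rule smooth_fun_on_cong[OF W eq sm])
qed

end

section \<open>Hamiltonian sections\<close>

lemma linear_form_on_sum:
  fixes \<phi> :: "'v::real_vector \<Rightarrow> real"
  assumes F: "subspace F"
    and add: "\<And>a b. \<lbrakk>a \<in> F; b \<in> F\<rbrakk> \<Longrightarrow> \<phi> (a + b) = \<phi> a + \<phi> b"
    and sc: "\<And>r a. a \<in> F \<Longrightarrow> \<phi> (r *\<^sub>R a) = r * \<phi> a"
    and e: "finite I" "\<And>i. i \<in> I \<Longrightarrow> e i \<in> F"
  shows "\<phi> (\<Sum>i\<in>I. c i *\<^sub>R e i) = (\<Sum>i\<in>I. c i * \<phi> (e i))"
  using e
proof (induction I rule: finite_induct)
  case empty
  then show ?case using sc[of 0 0] subspace_0[OF F] by simp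
next
  case (insert i I)
  have "(\<Sum>i\<in>I. c i *\<^sub>R e i) \<in> F"
    using insert.prems F by (intro subspace_sum subspace_scale) auto
  then show ?case
    using insert F by (simp add: add sc subspace_scale)
qed

lemma smooth_bilinear_formD:
  assumes "smooth_bilinear_form E \<beta>"
  shows bilinear_add_left: "\<lbrakk>a \<in> fibre E p; b \<in> fibre E p; c \<in> fibre E p\<rbrakk> \<Longrightarrow> \<beta> p (a + b) c = \<beta> p a c + \<beta> p b c"
    and bilinear_add_right: "\<lbrakk>a \<in> fibre E p; b \<in> fibre E p; c \<in> fibre E p\<rbrakk> \<Longrightarrow> \<beta> p c (a + b) = \<beta> p c a + \<beta> p c b"
    and bilinear_scale_left: "\<lbrakk>a \<in> fibre E p; b \<in> fibre E p\<rbrakk> \<Longrightarrow> \<beta> p (r *\<^sub>R a) b = r * \<beta> p a b"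
    and bilinear_scale_right: "\<lbrakk>a \<in> fibre E p; b \<in> fibre E p\<rbrakk> \<Longrightarrow> \<beta> p a (r *\<^sub>R b) = r * \<beta> p a b"
    and bilinear_smooth: "\<lbrakk>(U, e) \<in> frames E; i < bundle_rank E; j < bundle_rank E\<rbrakk> \<Longrightarrow>
      smooth_fun_on (base E) U (\<lambda>p. \<beta> p (e i p) (e j p))"
proof -
  have 1: "\<forall>p. \<forall>a\<in>fibre E p. \<forall>b\<in>fibre E p. \<forall>c\<in>fibre E p.
        \<beta> p (a + b) c = \<beta> p a c + \<beta> p b c \<and> \<beta> p c (a + b) = \<beta> p c a + \<beta> p c b"
    using assms unfolding smooth_bilinear_form_def by (elim conjE)
  have 2: "\<forall>p r. \<forall>a\<in>fibre E p. \<forall>b\<in>fibre E p.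
        \<beta> p (r *\<^sub>R a) b = r * \<beta> p a b \<and> \<beta> p a (r *\<^sub>R b) = r * \<beta> p a b"
    using assms unfolding smooth_bilinear_form_def by (elim conjE)
  have 3: "\<forall>(U, e)\<in>frames E. \<forall>i<bundle_rank E. \<forall>j<bundle_rank E.
        smooth_fun_on (base E) U (\<lambda>p. \<beta> p (e i p) (e j p))"
    using assms unfolding smooth_bilinear_form_def by (elim conjE)
  show "\<lbrakk>a \<in> fibre E p; b \<in> fibre E p; c \<in> fibre E p\<rbrakk> \<Longrightarrow> \<beta> p (a + b) c = \<beta> p a c + \<beta> p b c"
    "\<lbrakk>a \<in> fibre E p; b \<in> fibre E p; c \<in> fibre E p\<rbrakk> \<Longrightarrow> \<beta> p c (a + b) = \<beta> p c a + \<beta> p c b"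
    using 1 by simp_all
  show "\<lbrakk>a \<in> fibre E p; b \<in> fibre E p\<rbrakk> \<Longrightarrow> \<beta> p (r *\<^sub>R a) b = r * \<beta> p a b"
    "\<lbrakk>a \<in> fibre E p; b \<in> fibre E p\<rbrakk> \<Longrightarrow> \<beta> p a (r *\<^sub>R b) = r * \<beta> p a b"
    using 2 by simp_all
  show "\<lbrakk>(U, e) \<in> frames E; i < bundle_rank E; j < bundle_rank E\<rbrakk> \<Longrightarrow>
      smooth_fun_on (base E) U (\<lambda>p. \<beta> p (e i p) (e j p))"
    using bspec[OF 3] by fastforce
qed

locale compatible_algebroid =
  fixes A :: "('m::{t2_space, second_countable_topology}, 'e::findim_inner, 'v::real_vector, 'z) algebroid_scheme"
    and \<omega> g :: "'m \<Rightarrow> 'v \<Rightarrow> 'v \<Rightarrow> real"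
    and J :: "'m \<Rightarrow> 'v \<Rightarrow> 'v"
  assumes lie_algebroid: "lie_algebroid A"
    and compatible: "compatible_triple A \<omega> J g"
begin

section \<open>Frames and sections of the bundle\<close>

lemma vector_bundle: "vector_bundle A"
  using lie_algebroid unfolding lie_algebroid_def by (elim conjE)

lemma anchor_map: "anchor_map A (anchor A)"
  using lie_algebroid unfolding lie_algebroid_def by (elim conjE)

lemma symplectic: "symplectic_form A \<omega>"
  using compatible unfolding compatible_triple_def by (elim conjE)

lemma almost_complex: "almost_complex_structure A J"
  using compatible unfolding compatible_triple_def by (elim conjE)

lemma riemannian: "riemannian_metric A g"
  using compatible unfolding compatible_triple_def by (elim conjE)

sublocale M: smooth_mfd "base A"
  using vector_bundle unfolding vector_bundle_def by unfold_locales blast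

lemma subspace_fibre: "subspace (fibre A p)"
  using vector_bundle unfolding vector_bundle_def by blast

lemmas fibre_closed =
  subspace_0[OF subspace_fibre] subspace_add[OF subspace_fibre] subspace_diff[OF subspace_fibre]
  subspace_scale[OF subspace_fibre] subspace_neg[OF subspace_fibre]

lemma frames_cover: "(\<Union>(U, e)\<in>frames A. U) = UNIV"
  using vector_bundle unfolding vector_bundle_def by (elim conjE)

lemma ex_frame: obtains U e where "(U, e) \<in> frames A" "p \<in> U"
proof -
  have "p \<in> (\<Union>(U, e)\<in>frames A. U)"
    unfolding frames_cover by simp
  then show ?thesis using that by auto
qed

lemma frame_basis:
  assumes "(U, e) \<in> frames A"
  shows open_frame: "open U"
    and inj_frame: "p \<in> U \<Longrightarrow> inj_on (\<lambda>i. e i p) {..<bundle_rank A}"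
    and independent_frame: "p \<in> U \<Longrightarrow> independent ((\<lambda>i. e i p) ` {..<bundle_rank A})"
    and span_frame: "p \<in> U \<Longrightarrow> span ((\<lambda>i. e i p) ` {..<bundle_rank A}) = fibre A p"
proof -
  have *: "\<forall>(U, e)\<in>frames A. open U \<and>
        (\<forall>p\<in>U. inj_on (\<lambda>i. e i p) {..<bundle_rank A} \<and>
           independent ((\<lambda>i. e i p) ` {..<bundle_rank A}) \<and>
           span ((\<lambda>i. e i p) ` {..<bundle_rank A}) = fibre A p) \<and>
        (\<forall>i<bundle_rank A. smooth_section_on A U (e i))"
    using vector_bundle unfolding vector_bundle_def by (elim conjE)
  show "open U"
    "p \<in> U \<Longrightarrow> inj_on (\<lambda>i. e i p) {..<bundle_rank A}"
    "p \<in> U \<Longrightarrow> independent ((\<lambda>i. e i p) ` {..<bundle_rank A})"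
    "p \<in> U \<Longrightarrow> span ((\<lambda>i. e i p) ` {..<bundle_rank A}) = fibre A p"
    using bspec[OF * assms] by simp_all
qed

lemma frame_in_fibre: "\<lbrakk>(U, e) \<in> frames A; p \<in> U; i < bundle_rank A\<rbrakk> \<Longrightarrow> e i p \<in> fibre A p"
  using span_frame[of U e p] span_base[of "e i p" "(\<lambda>i. e i p) ` {..<bundle_rank A}"] by auto

lemma frame_coefficients:
  assumes "(U, e) \<in> frames A" "p \<in> U" "a \<in> fibre A p"
  shows "\<exists>c. a = (\<Sum>i<bundle_rank A. c i *\<^sub>R e i p)"
proof -
  have "a \<in> span ((\<lambda>i. e i p) ` {..<bundle_rank A})"
    using span_frame[OF assms(1,2)] assms(3) by simp
  then obtain c where "a = (\<Sum>v\<in>(\<lambda>i. e i p) ` {..<bundle_rank A}. c v *\<^sub>R v)"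
    by (auto simp: span_finite)
  also have "\<dots> = (\<Sum>i<bundle_rank A. c (e i p) *\<^sub>R e i p)"
    by (simp add: sum.reindex[OF inj_frame[OF assms(1,2)]])
  finally show ?thesis
    by (intro exI[of _ "\<lambda>i. c (e i p)"])
qed

lemma frame_independent:
  assumes "(U, e) \<in> frames A" "p \<in> U" "(\<Sum>i<bundle_rank A. c i *\<^sub>R e i p) = 0" "i < bundle_rank A"
  shows "c i = 0"
proof -
  let ?S = "(\<lambda>i. e i p) ` {..<bundle_rank A}"
  note inj = inj_frame[OF assms(1,2)]
  \<comment> \<open>Linear independence is stated for the set of frame vectors, whereas
    \<open>c\<close> is indexed by numbers; injectivity of the frame at \<open>p\<close> translates
    one into the other.\<close>
  define d where "d v = c (the_inv_into {..<bundle_rank A} (\<lambda>i. e i p) v)" for v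
  have d: "d (e i p) = c i" if "i < bundle_rank A" for i
    using the_inv_into_f_f[OF inj, of i] that by (simp add: d_def)
  have "(\<Sum>v\<in>?S. d v *\<^sub>R v) = 0"
    using assms(3) by (simp add: sum.reindex[OF inj] d)
  then have "d (e i p) = 0"
    using independentD[OF independent_frame[OF assms(1,2)], of ?S d "e i p"] assms(4) by auto
  then show ?thesis using d assms(4) by simp
qed

lemma fibre_finite_span: "\<exists>B. finite B \<and> fibre A p \<subseteq> span B"
proof -
  obtain U e where "(U, e) \<in> frames A" "p \<in> U" by (rule ex_frame)
  from span_frame[OF this] show ?thesis
    by (metis finite_imageI finite_lessThan order_refl)
qed

lemma smooth_sectionD:
  assumes "s \<in> sections A" "(U, e) \<in> frames A"
  shows "\<exists>c. (\<forall>i<bundle_rank A. smooth_fun_on (base A) U (c i)) \<and> (\<forall>p\<in>U. s p = (\<Sum>i<bundle_rank A. c i p *\<^sub>R e i p))"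
  using assms(1) bspec[OF conjunct2[OF assms(1)[unfolded sections_def mem_Collect_eq smooth_section_on_def]] assms(2)]
  by simp

lemma smooth_sectionI:
  assumes "\<And>p. s p \<in> fibre A p"
    and "\<And>U e. (U, e) \<in> frames A \<Longrightarrow>
      \<exists>c. (\<forall>i<bundle_rank A. smooth_fun_on (base A) U (c i)) \<and> (\<forall>p\<in>U. s p = (\<Sum>i<bundle_rank A. c i p *\<^sub>R e i p))"
  shows "s \<in> sections A"
  unfolding sections_def mem_Collect_eq smooth_section_on_def
proof (intro conjI ballI)
  show "s p \<in> fibre A p" for p by (rule assms(1))
  fix x assume "x \<in> frames A"
  then show "case x of (U, e) \<Rightarrow> \<exists>c. (\<forall>i<bundle_rank A. smooth_fun_on (base A) (U \<inter> UNIV) (c i)) \<and>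
      (\<forall>p\<in>U \<inter> UNIV. s p = (\<Sum>i<bundle_rank A. c i p *\<^sub>R e i p))"
    using assms(2)[of "fst x" "snd x"] by (simp add: case_prod_beta)
qed

lemma section_in_fibre: "s \<in> sections A \<Longrightarrow> s p \<in> fibre A p"
  unfolding sections_def smooth_section_on_def by auto

section \<open>Fibrewise properties of the triple and the anchor\<close>

lemma J_fibre: "a \<in> fibre A p \<Longrightarrow> J p a \<in> fibre A p"
  and J_add: "\<lbrakk>a \<in> fibre A p; b \<in> fibre A p\<rbrakk> \<Longrightarrow> J p (a + b) = J p a + J p b"
  and J_scale: "a \<in> fibre A p \<Longrightarrow> J p (r *\<^sub>R a) = r *\<^sub>R J p a"
  and J_J: "a \<in> fibre A p \<Longrightarrow> J p (J p a) = - a"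
  using almost_complex unfolding almost_complex_structure_def bundle_endomorphism_def by blast+

lemma J_sum:
  assumes "finite I" "\<And>i. i \<in> I \<Longrightarrow> e i \<in> fibre A p"
  shows "J p (\<Sum>i\<in>I. c i *\<^sub>R e i) = (\<Sum>i\<in>I. c i *\<^sub>R J p (e i))"
  using assms
proof (induction I rule: finite_induct)
  case empty
  then show ?case using J_scale[OF fibre_closed(1), of p 0] by simp
next
  case (insert i I)
  have "(\<Sum>i\<in>I. c i *\<^sub>R e i) \<in> fibre A p"
    using insert.prems by (intro subspace_sum[OF subspace_fibre] fibre_closed) auto
  then show ?case
    using insert by (simp add: J_add J_scale fibre_closed)
qed

lemma metric_form: "smooth_bilinear_form A g"
  and metric_sym: "\<lbrakk>a \<in> fibre A p; b \<in> fibre A p\<rbrakk> \<Longrightarrow> g p a b = g p b a"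
  and metric_pos: "\<lbrakk>a \<in> fibre A p; a \<noteq> 0\<rbrakk> \<Longrightarrow> g p a a > 0"
proof -
  show "smooth_bilinear_form A g"
    using riemannian unfolding riemannian_metric_def by (elim conjE)
  have 1: "\<forall>p. \<forall>a\<in>fibre A p. \<forall>b\<in>fibre A p. g p a b = g p b a"
    using riemannian unfolding riemannian_metric_def by (elim conjE)
  have 2: "\<forall>p. \<forall>a\<in>fibre A p. a \<noteq> 0 \<longrightarrow> g p a a > 0"
    using riemannian unfolding riemannian_metric_def by (elim conjE)
  show "\<lbrakk>a \<in> fibre A p; b \<in> fibre A p\<rbrakk> \<Longrightarrow> g p a b = g p b a"
    by (rule 1[rule_format])
  show "\<lbrakk>a \<in> fibre A p; a \<noteq> 0\<rbrakk> \<Longrightarrow> g p a a > 0"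
    by (rule 2[rule_format])
qed

sublocale metric: inner_on "fibre A p" "g p" for p
  by unfold_locales
    (rule subspace_fibre bilinear_add_left[OF metric_form] bilinear_scale_left[OF metric_form]
      metric_sym metric_pos; assumption)+

lemma g_J: "\<lbrakk>a \<in> fibre A p; b \<in> fibre A p\<rbrakk> \<Longrightarrow> g p (J p a) (J p b) = g p a b"
  and omega_g: "\<lbrakk>a \<in> fibre A p; b \<in> fibre A p\<rbrakk> \<Longrightarrow> \<omega> p a b = g p a (J p b)"
proof -
  have *: "\<forall>p. \<forall>a\<in>fibre A p. \<forall>b\<in>fibre A p. g p (J p a) (J p b) = g p a b \<and> \<omega> p a b = g p a (J p b)"
    using compatible unfolding compatible_triple_def by (elim conjE)
  show "\<lbrakk>a \<in> fibre A p; b \<in> fibre A p\<rbrakk> \<Longrightarrow> g p (J p a) (J p b) = g p a b"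
    by (rule conjunct1[OF *[rule_format]])
  show "\<lbrakk>a \<in> fibre A p; b \<in> fibre A p\<rbrakk> \<Longrightarrow> \<omega> p a b = g p a (J p b)"
    by (rule conjunct2[OF *[rule_format]])
qed

text \<open>\<open>J\<close> is an isometry with square minus the identity, so its
  \<open>g\<close>-adjoint is \<open>- J\<close>. Hence \<open>\<omega>\<close> can be expressed by
  \<open>g\<close> with \<open>J\<close> on either argument.\<close>

lemma omega_g_left: "\<lbrakk>a \<in> fibre A p; b \<in> fibre A p\<rbrakk> \<Longrightarrow> \<omega> p a b = - g p (J p a) b"
  using g_J[of "J p a" p b] metric.g_scale[of a p "J p b" "-1"] omega_g[of a p b]
  by (simp add: J_fibre J_J)

lemma omega_form: "smooth_bilinear_form A \<omega>"
  and omega_nondegenerate: "\<lbrakk>a \<in> fibre A p; \<And>b. b \<in> fibre A p \<Longrightarrow> \<omega> p a b = 0\<rbrakk> \<Longrightarrow> a = 0"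
proof -
  show "smooth_bilinear_form A \<omega>"
    using symplectic unfolding symplectic_form_def by (elim conjE)
  have *: "\<forall>p. \<forall>a\<in>fibre A p. (\<forall>b\<in>fibre A p. \<omega> p a b = 0) \<longrightarrow> a = 0"
    using symplectic unfolding symplectic_form_def by (elim conjE)
  show "\<lbrakk>a \<in> fibre A p; \<And>b. b \<in> fibre A p \<Longrightarrow> \<omega> p a b = 0\<rbrakk> \<Longrightarrow> a = 0"
    by (rule *[rule_format])
qed

lemmas omega_add_left = bilinear_add_left[OF omega_form]
  and omega_add_right = bilinear_add_right[OF omega_form]
  and omega_scale_left = bilinear_scale_left[OF omega_form]
  and omega_scale_right = bilinear_scale_right[OF omega_form]

lemma omega_diff_left: "\<lbrakk>a \<in> fibre A p; b \<in> fibre A p; c \<in> fibre A p\<rbrakk> \<Longrightarrow> \<omega> p (a - b) c = \<omega> p a c - \<omega> p b c"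
  using omega_add_left[of "a - b" p b c] by (simp add: fibre_closed)

lemma omega_skew: "\<lbrakk>a \<in> fibre A p; b \<in> fibre A p\<rbrakk> \<Longrightarrow> \<omega> p a b = - \<omega> p b a"
  using omega_g[of a p b] omega_g_left[of b p a] metric.g_sym[of a p "J p b"] by (simp add: J_fibre)

lemma anchor_add: "\<lbrakk>a \<in> fibre A p; b \<in> fibre A p\<rbrakk> \<Longrightarrow> anchor A p (a + b) f = anchor A p a f + anchor A p b f"
  and anchor_scale: "a \<in> fibre A p \<Longrightarrow> anchor A p (r *\<^sub>R a) f = r * anchor A p a f"
  and anchor_frame_smooth: "\<lbrakk>(U, e) \<in> frames A; i < bundle_rank A; h \<in> C_inf (base A)\<rbrakk> \<Longrightarrow>
    smooth_fun_on (base A) U (\<lambda>p. anchor A p (e i p) h)"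
proof -
  have 1: "\<forall>p. \<forall>a\<in>fibre A p. \<forall>b\<in>fibre A p. anchor A p (a + b) = (\<lambda>f. anchor A p a f + anchor A p b f)"
    using anchor_map unfolding anchor_map_def by (elim conjE)
  have 2: "\<forall>p c. \<forall>a\<in>fibre A p. anchor A p (c *\<^sub>R a) = (\<lambda>f. c * anchor A p a f)"
    using anchor_map unfolding anchor_map_def by (elim conjE)
  have 3: "\<forall>(U, e)\<in>frames A. \<forall>i<bundle_rank A. \<forall>f\<in>C_inf (base A).
        smooth_fun_on (base A) U (\<lambda>p. anchor A p (e i p) f)"
    using anchor_map unfolding anchor_map_def by (elim conjE)
  show "\<lbrakk>a \<in> fibre A p; b \<in> fibre A p\<rbrakk> \<Longrightarrow> anchor A p (a + b) f = anchor A p a f + anchor A p b f"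
    using 1 by simp
  show "a \<in> fibre A p \<Longrightarrow> anchor A p (r *\<^sub>R a) f = r * anchor A p a f"
    using 2 by simp
  show "\<lbrakk>(U, e) \<in> frames A; i < bundle_rank A; h \<in> C_inf (base A)\<rbrakk> \<Longrightarrow>
      smooth_fun_on (base A) U (\<lambda>p. anchor A p (e i p) h)"
    using bspec[OF 3] by fastforce
qed

lemma anchor_diff: "\<lbrakk>a \<in> fibre A p; b \<in> fibre A p\<rbrakk> \<Longrightarrow> anchor A p (a - b) f = anchor A p a f - anchor A p b f"
  using anchor_add[of "a - b" p b f] by (simp add: fibre_closed)

text \<open>Taken with \<open>s = ham f\<close> and pulled back to the leaf, it provides the smooth
  right-hand side of the linear system there.\<close>

lemma anchor_section_smooth:
  assumes s: "s \<in> sections A" and f: "f \<in> C_inf (base A)"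
  shows "(\<lambda>p. anchor A p (s p) f) \<in> C_inf (base A)"
  unfolding C_inf_def mem_Collect_eq
proof (rule M.smooth_fun_on_local)
  fix p
  obtain U e where U: "(U, e) \<in> frames A" "p \<in> U" by (rule ex_frame)
  obtain c where c: "\<And>i. i < bundle_rank A \<Longrightarrow> smooth_fun_on (base A) U (c i)"
    "\<And>p. p \<in> U \<Longrightarrow> s p = (\<Sum>i<bundle_rank A. c i p *\<^sub>R e i p)"
    using smooth_sectionD[OF s U(1)] by auto
  have "smooth_fun_on (base A) U (\<lambda>p. anchor A p (e i p) f)" if "i < bundle_rank A" for i
    by (rule anchor_frame_smooth[OF U(1) that f])
  then have sm: "smooth_fun_on (base A) U (\<lambda>p. \<Sum>i<bundle_rank A. c i p * anchor A p (e i p) f)"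
    using c(1) by (intro M.smooth_fun_on_sum M.smooth_fun_on_mult open_frame[OF U(1)]) auto
  have "(\<Sum>i<bundle_rank A. c i q * anchor A q (e i q) f) = anchor A q (s q) f" if "q \<in> U" for q
    unfolding c(2)[OF that]
    by (rule linear_form_on_sum[OF subspace_fibre[of q], of "\<lambda>a. anchor A q a f", symmetric])
      (use U(1) that in \<open>auto simp: anchor_add anchor_scale frame_in_fibre\<close>)
  from M.smooth_fun_on_cong[OF open_frame[OF U(1)] this sm]
  show "\<exists>T. open T \<and> p \<in> T \<and> smooth_fun_on (base A) T (\<lambda>p. anchor A p (s p) f)"
    using U open_frame by blast
qed

lemma J_section:
  assumes s: "s \<in> sections A"
  shows "(\<lambda>p. J p (s p)) \<in> sections A"
proof (rule smooth_sectionI)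
  show "J p (s p) \<in> fibre A p" for p
    by (intro J_fibre section_in_fibre s)
  fix U e assume U: "(U, e) \<in> frames A"
  let ?r = "bundle_rank A"
  obtain c where c: "\<And>i. i < ?r \<Longrightarrow> smooth_fun_on (base A) U (c i)"
    "\<And>p. p \<in> U \<Longrightarrow> s p = (\<Sum>i<?r. c i p *\<^sub>R e i p)"
    using smooth_sectionD[OF s U] by auto
  have "\<exists>d. (\<forall>k<?r. smooth_fun_on (base A) U (d k)) \<and> (\<forall>p\<in>U. J p (e i p) = (\<Sum>k<?r. d k p *\<^sub>R e k p))"
    if "i < ?r" for i
  proof -
    have J: "smooth_section_on A U (\<lambda>p. J p (e i p))"
      using almost_complex U that unfolding almost_complex_structure_def bundle_endomorphism_def by fast
    show ?thesis
      using bspec[OF conjunct2[OF J[unfolded smooth_section_on_def]] U] by simp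
  qed
  then obtain d where d: "\<And>i k. \<lbrakk>i < ?r; k < ?r\<rbrakk> \<Longrightarrow> smooth_fun_on (base A) U (d i k)"
    "\<And>i p. \<lbrakk>i < ?r; p \<in> U\<rbrakk> \<Longrightarrow> J p (e i p) = (\<Sum>k<?r. d i k p *\<^sub>R e k p)"
    by metis
  have "J p (s p) = (\<Sum>k<?r. (\<Sum>i<?r. c i p * d i k p) *\<^sub>R e k p)" if p: "p \<in> U" for p
  proof -
    have "J p (s p) = (\<Sum>i<?r. c i p *\<^sub>R J p (e i p))"
      unfolding c(2)[OF p] by (rule J_sum) (use U p in \<open>auto simp: frame_in_fibre\<close>)
    also have "\<dots> = (\<Sum>i<?r. \<Sum>k<?r. (c i p * d i k p) *\<^sub>R e k p)"
      using d(2) p by (simp add: scaleR_sum_right)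
    also have "\<dots> = (\<Sum>k<?r. (\<Sum>i<?r. c i p * d i k p) *\<^sub>R e k p)"
      by (subst sum.swap) (simp add: scaleR_sum_left)
    finally show ?thesis .
  qed
  moreover have "smooth_fun_on (base A) U (\<lambda>p. \<Sum>i<?r. c i p * d i k p)" if "k < ?r" for k
    using c(1) d(1) that by (intro M.smooth_fun_on_sum M.smooth_fun_on_mult open_frame[OF U]) auto
  ultimately show "\<exists>c. (\<forall>i<?r. smooth_fun_on (base A) U (c i)) \<and> (\<forall>p\<in>U. J p (s p) = (\<Sum>i<?r. c i p *\<^sub>R e i p))"
    by (intro exI[of _ "\<lambda>k p. \<Sum>i<?r. c i p * d i k p"]) auto
qed

lemma section_diff:
  assumes s: "s \<in> sections A" and t: "t \<in> sections A"
  shows "(\<lambda>p. s p - t p) \<in> sections A"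
proof (rule smooth_sectionI)
  show "s p - t p \<in> fibre A p" for p
    by (intro fibre_closed section_in_fibre s t)
  fix U e assume U: "(U, e) \<in> frames A"
  let ?r = "bundle_rank A"
  obtain c where c: "\<And>i. i < ?r \<Longrightarrow> smooth_fun_on (base A) U (c i)"
    "\<And>p. p \<in> U \<Longrightarrow> s p = (\<Sum>i<?r. c i p *\<^sub>R e i p)"
    using smooth_sectionD[OF s U] by auto
  obtain d where d: "\<And>i. i < ?r \<Longrightarrow> smooth_fun_on (base A) U (d i)"
    "\<And>p. p \<in> U \<Longrightarrow> t p = (\<Sum>i<?r. d i p *\<^sub>R e i p)"
    using smooth_sectionD[OF t U] by auto
  have "smooth_fun_on (base A) U (\<lambda>p. c i p + - 1 * d i p)" if "i < ?r" for i
    using c(1) d(1) that by (intro M.smooth_fun_on_add M.smooth_fun_on_mult open_frame[OF U]) auto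
  then show "\<exists>c. (\<forall>i<?r. smooth_fun_on (base A) U (c i)) \<and> (\<forall>p\<in>U. s p - t p = (\<Sum>i<?r. c i p *\<^sub>R e i p))"
    using c(2) d(2)
    by (intro exI[of _ "\<lambda>i p. c i p + - 1 * d i p"]) (auto simp: sum_subtractf algebra_simps)
qed

text \<open>The solution is \<open>J n\<close>, where \<open>n\<close> is the
  \<open>g\<close>-gradient of \<open>f\<close> along the fibre given by the Riesz lemma:
  \<open>\<omega> (J n) b = - g (J (J n)) b = g n b\<close>.\<close>

lemma ex_hamiltonian: "\<exists>a\<in>fibre A p. \<forall>b\<in>fibre A p. anchor A p b f = \<omega> p a b"
proof -
  obtain B where B: "finite B" "fibre A p \<subseteq> span B"
    using fibre_finite_span by blast
  have "\<exists>n\<in>fibre A p. \<forall>b\<in>fibre A p. anchor A p b f = g p n b"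
    by (rule metric.riesz[OF B, of "\<lambda>b. anchor A p b f"]) (simp_all add: anchor_add anchor_scale)
  then obtain n where n: "n \<in> fibre A p" "\<And>b. b \<in> fibre A p \<Longrightarrow> anchor A p b f = g p n b"
    by blast
  have "anchor A p b f = \<omega> p (J p n) b" if "b \<in> fibre A p" for b
    using omega_g_left[OF J_fibre[OF n(1)] that] metric.g_scale[OF n(1) that, of "-1"] n(2)[OF that]
    by (simp add: J_J n(1))
  then show ?thesis using J_fibre[OF n(1)] by blast
qed

text \<open>A choice made fibre by fibre, before anything is known about smoothness; nondegeneracy
  of \<open>\<omega>\<close> leaves only one candidate in each fibre.\<close>

definition ham :: "('m \<Rightarrow> real) \<Rightarrow> 'm \<Rightarrow> 'v" where
  "ham f p = (SOME a. a \<in> fibre A p \<and> (\<forall>b\<in>fibre A p. anchor A p b f = \<omega> p a b))"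

lemma ham_fibre: "ham f p \<in> fibre A p"
  and omega_ham: "b \<in> fibre A p \<Longrightarrow> \<omega> p (ham f p) b = anchor A p b f"
proof -
  have *: "ham f p \<in> fibre A p \<and> (\<forall>b\<in>fibre A p. anchor A p b f = \<omega> p (ham f p) b)" for p
    unfolding ham_def by (rule someI_ex) (use ex_hamiltonian[of p f] in blast)
  show "ham f p \<in> fibre A p" using * by blast
  show "b \<in> fibre A p \<Longrightarrow> \<omega> p (ham f p) b = anchor A p b f" using * by simp
qed

text \<open>Row \<open>j\<close> tests against the frame vector \<open>e j\<close>, so the matrix is
  the transposed Gram matrix of \<open>\<omega>\<close>. A kernel vector gives the coefficients of a
  fibre element orthogonal to the whole frame, which nondegeneracy forces to be 0; so the matrix is
  invertible on all of \<open>U\<close>.\<close>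

lemma ham_section:
  assumes f: "f \<in> C_inf (base A)"
  shows "ham f \<in> sections A"
proof (rule smooth_sectionI[OF ham_fibre])
  fix U e assume U: "(U, e) \<in> frames A"
  let ?r = "bundle_rank A"
  have "\<forall>p\<in>U. \<exists>c. ham f p = (\<Sum>i<?r. c i *\<^sub>R e i p)"
    using frame_coefficients[OF U _ ham_fibre] by blast
  then obtain c' where c': "\<And>p. p \<in> U \<Longrightarrow> ham f p = (\<Sum>i<?r. c' p i *\<^sub>R e i p)"
    by metis
  define c where "c i p = c' p i" for i p
  have c: "ham f p = (\<Sum>i<?r. c i p *\<^sub>R e i p)" if "p \<in> U" for p
    using c'[OF that] by (simp add: c_def)
  note fib = frame_in_fibre[OF U]
  have lin: "\<omega> p (\<Sum>i<?r. v i *\<^sub>R e i p) b = (\<Sum>i<?r. v i * \<omega> p (e i p) b)"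
    if "p \<in> U" "b \<in> fibre A p" for p b v
    by (rule linear_form_on_sum[OF subspace_fibre[of p], of "\<lambda>a. \<omega> p a b"])
      (use that in \<open>auto simp: omega_add_left omega_scale_left fib\<close>)
  have "smooth_fun_on (base A) U (c k)" if "k < ?r" for k
  proof (rule M.smooth_fun_on_solution[where m = "\<lambda>j i p. \<omega> p (e i p) (e j p)"
        and y = "\<lambda>j p. anchor A p (e j p) f" and n = ?r, OF open_frame[OF U] _ _ _ _ that])
    show "smooth_fun_on (base A) U (\<lambda>p. \<omega> p (e i p) (e j p))" if "j < ?r" "i < ?r" for i j
      by (rule bilinear_smooth[OF omega_form U that(2,1)])
    show "smooth_fun_on (base A) U (\<lambda>p. anchor A p (e j p) f)" if "j < ?r" for j
      by (rule anchor_frame_smooth[OF U that f])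
    show "(\<Sum>i<?r. \<omega> p (e i p) (e j p) * c i p) = anchor A p (e j p) f" if "p \<in> U" "j < ?r" for p j
      using omega_ham[OF fib[OF that], of f] lin[OF that(1) fib[OF that], of "\<lambda>i. c i p"] c[OF that(1)]
      by (simp add: mult.commute)
    show "Determinant.det (Matrix.mat ?r ?r (\<lambda>(j, i). \<omega> p (e i p) (e j p))) \<noteq> 0" if p: "p \<in> U" for p
    proof (rule det_nonzero_if_kernel_trivial)
      fix v i assume v: "\<And>j. j < ?r \<Longrightarrow> (\<Sum>i<?r. \<omega> p (e i p) (e j p) * v i) = 0" and i: "i < ?r"
      let ?a = "\<Sum>i<?r. v i *\<^sub>R e i p"
      have a: "?a \<in> fibre A p"
        by (intro subspace_sum[OF subspace_fibre] fibre_closed) (use p fib in auto)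
      have "\<omega> p ?a (e j p) = 0" if "j < ?r" for j
        using lin[OF p fib[OF p that], of v] v[OF that] by (simp add: mult.commute)
      moreover have "\<omega> p ?a (\<Sum>j<?r. d j *\<^sub>R e j p) = (\<Sum>j<?r. d j * \<omega> p ?a (e j p))" for d
        by (rule linear_form_on_sum[OF subspace_fibre[of p], of "\<omega> p ?a"])
          (use a p in \<open>auto simp: omega_add_right omega_scale_right fib\<close>)
      ultimately have "\<omega> p ?a b = 0" if "b \<in> fibre A p" for b
        using frame_coefficients[OF U p that] by auto
      then have "?a = 0" using omega_nondegenerate[OF a] by blast
      then show "v i = 0" by (rule frame_independent[OF U p _ i])
    qed
  qed
  then show "\<exists>c. (\<forall>i<?r. smooth_fun_on (base A) U (c i)) \<and> (\<forall>p\<in>U. ham f p = (\<Sum>i<?r. c i p *\<^sub>R e i p))"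
    using c by blast
qed

text \<open>
  Uniqueness needs no bump functions on the base: the difference \<open>a\<close> of two candidates is tested
  against the global section \<open>J a\<close>, as \<open>\<omega>(a, J a) = - g(a, a)\<close>.
\<close>

lemma hamiltonian_section_eq_ham:
  assumes f: "f \<in> C_inf (base A)"
  shows "hamiltonian_section A \<omega> f = ham f"
  unfolding hamiltonian_section_def
proof (rule the_equality)
  show "ham f \<in> sections A \<and> (\<forall>b\<in>sections A. d0 A f b = (\<lambda>p. \<omega> p (ham f p) (b p)))"
    using ham_section[OF f] by (auto simp: d0_def omega_ham section_in_fibre)
  fix s assume s: "s \<in> sections A \<and> (\<forall>b\<in>sections A. d0 A f b = (\<lambda>p. \<omega> p (s p) (b p)))"
  let ?d = "\<lambda>p. s p - ham f p"
  have d: "?d \<in> sections A"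
    using s by (intro section_diff ham_section f) auto
  have "s p = ham f p" for p
  proof -
    have F: "s p \<in> fibre A p" "?d p \<in> fibre A p" "J p (?d p) \<in> fibre A p"
      using s d by (auto intro: section_in_fibre J_fibre)
    have "anchor A p (J p (?d p)) f = \<omega> p (s p) (J p (?d p))"
      using s J_section[OF d] by (auto simp: d0_def fun_eq_iff)
    then have "\<omega> p (?d p) (J p (?d p)) = 0"
      using omega_ham[OF F(3), of f] omega_diff_left[OF F(1) ham_fibre F(3)] by simp
    then have "g p (?d p) (?d p) = 0"
      using omega_g[OF F(2,3)] J_J[OF F(2)] metric.g_scale_right[OF F(2,2), of "-1"] by simp
    then show ?thesis
      using metric.g_pos[OF F(2)] by fastforce
  qed
  then show "s = ham f" by blast
qed

subsection \<open>The symplectic generalized distribution\<close>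

abbreviation Lw :: "'m \<Rightarrow> 'v set" where
  "Lw p \<equiv> omega_orth A \<omega> p (isotropy A p)"

lemma isotropy_fibre: "isotropy A p \<subseteq> fibre A p"
  by (auto simp: isotropy_def)

lemma Lw_fibre: "Lw p \<subseteq> fibre A p"
  by (auto simp: omega_orth_def)

lemma subspace_isotropy: "subspace (isotropy A p)"
  using anchor_add[of _ p] anchor_scale[of _ p] anchor_scale[OF fibre_closed(1), of p 0]
  by (auto simp: subspace_def isotropy_def fibre_closed fun_eq_iff)

lemma subspace_Lw: "subspace (Lw p)"
proof -
  have "\<omega> p 0 v = 0" if "v \<in> isotropy A p" for v
    using omega_scale_left[OF fibre_closed(1), of v p 0] that isotropy_fibre by auto
  then show ?thesis
    using isotropy_fibre[of p]
    by (auto simp: subspace_def omega_orth_def fibre_closed omega_add_left omega_scale_left subset_iff)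
qed

text \<open>
  Subtracting from \<open>a \<in> L\<^sup>\<omega>\<close> its \<open>g\<close>-orthogonal projection to \<open>L\<^sup>1\<close> makes it \<open>\<omega>\<close>-orthogonal to
  \<open>E\<^sup>1 = J L\<^sup>1\<close>.
\<close>

lemma E2_L1_eq: "E2_L1 A \<omega> J p = Lw p"
proof
  have 0: "0 \<in> isotropy A p" "0 \<in> L1 A \<omega> p"
    using subspace_isotropy subspace_Lw by (auto simp: subspace_0 L1_def)
  have L1: "L1 A \<omega> p \<subseteq> Lw p" "L1 A \<omega> p \<subseteq> fibre A p"
    by (auto simp: L1_def omega_orth_def)
  have J0: "J p 0 = 0"
    using J_scale[OF fibre_closed(1), of p 0] by simp
  \<comment> \<open>\<open>E2\<close> is orthogonal to the sum of \<open>isotropy\<close> and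
    \<open>E1\<close>, which contains \<open>isotropy\<close> because 0 belongs to
    \<open>E1\<close>.\<close>
  have E2: "E2 A \<omega> J p \<subseteq> Lw p"
  proof
    fix a assume a: "a \<in> E2 A \<omega> J p"
    have "l \<in> subspace_sum (isotropy A p) (E1 A \<omega> J p)" if "l \<in> isotropy A p" for l
    proof -
      have "0 \<in> E1 A \<omega> J p"
        unfolding E1_def using 0(2) J0 by (metis imageI)
      then show ?thesis
        unfolding subspace_sum_def using that by (intro CollectI exI[of _ l] exI[of _ 0]) simp
    qed
    then show "a \<in> Lw p" using a by (auto simp: E2_def omega_orth_def)
  qed
  show "E2_L1 A \<omega> J p \<subseteq> Lw p"
    unfolding E2_L1_def subspace_sum_def using E2 L1 subspace_add[OF subspace_Lw] by blast
  show "Lw p \<subseteq> E2_L1 A \<omega> J p"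
  proof
    fix a assume a: "a \<in> Lw p"
    then have aF: "a \<in> fibre A p" using Lw_fibre by blast
    obtain B where B: "finite B" "fibre A p \<subseteq> span B"
      using fibre_finite_span by blast
    have "subspace (L1 A \<omega> p)"
      unfolding L1_def by (intro subspace_inter subspace_isotropy subspace_Lw)
    from metric.ex_projection[OF B this L1(2) aF]
    obtain l where l: "l \<in> L1 A \<omega> p" "\<And>w. w \<in> L1 A \<omega> p \<Longrightarrow> g p (a - l) w = 0" by blast
    have d: "a - l \<in> Lw p"
      using a l(1) L1 by (intro subspace_diff[OF subspace_Lw]) auto
    then have dF: "a - l \<in> fibre A p" using Lw_fibre by blast
    have "\<omega> p (a - l) (v + J p w) = 0" if v: "v \<in> isotropy A p" and w: "w \<in> L1 A \<omega> p" for v w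
    proof -
      have F: "v \<in> fibre A p" "w \<in> fibre A p" "J p w \<in> fibre A p"
        using v w isotropy_fibre L1(2) by (auto intro!: J_fibre)
      have "\<omega> p (a - l) (J p w) = 0"
        using omega_g[OF dF F(3)] metric.g_scale_right[OF F(2) dF, of "-1"] l(2)[OF w] by (simp add: J_J F)
      moreover have "\<omega> p (a - l) v = 0"
        using d v by (auto simp: omega_orth_def)
      ultimately show ?thesis by (simp add: omega_add_right F dF)
    qed
    then have "a - l \<in> E2 A \<omega> J p"
      using dF by (auto simp: E2_def E1_def omega_orth_def subspace_sum_def)
    moreover have "a = (a - l) + l" by simp
    ultimately show "a \<in> E2_L1 A \<omega> J p"
      unfolding E2_L1_def subspace_sum_def using l(1) by blast
  qed
qed

text \<open>Project \<open>J a\<close> orthogonally to the image of \<open>L\<close> under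
  \<open>J\<close>. The residual \<open>?b\<close> is \<open>g\<close>-orthogonal to that image,
  hence lies in \<open>Lw p\<close>; by hypothesis it is then \<open>g\<close>-orthogonal to
  \<open>J a\<close>, so to itself. Thus \<open>J a\<close> is the image of an element of
  \<open>L\<close>, which has to be \<open>a\<close>.\<close>

lemma Lw_dual:
  assumes a: "a \<in> fibre A p" and o: "\<And>b. b \<in> Lw p \<Longrightarrow> \<omega> p a b = 0"
  shows "a \<in> isotropy A p"
proof -
  let ?V = "J p ` isotropy A p"
  have V: "?V \<subseteq> fibre A p" using isotropy_fibre J_fibre by blast
  have "subspace ?V"
    unfolding subspace_def
  proof (intro conjI ballI allI)
    show "0 \<in> ?V"
      using J_scale[OF fibre_closed(1), of p 0] subspace_0[OF subspace_isotropy, of p]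
      by (intro image_eqI[of _ _ 0]) auto
    show "x + y \<in> ?V" if "x \<in> ?V" "y \<in> ?V" for x y
      using that isotropy_fibre subspace_add[OF subspace_isotropy]
      by (auto simp: J_add[symmetric] subset_iff intro!: imageI)
    show "r *\<^sub>R x \<in> ?V" if "x \<in> ?V" for r x
      using that isotropy_fibre subspace_scale[OF subspace_isotropy]
      by (auto simp: J_scale[symmetric] subset_iff intro!: imageI)
  qed
  moreover obtain B where B: "finite B" "fibre A p \<subseteq> span B"
    using fibre_finite_span by blast
  ultimately obtain v where v: "v \<in> ?V" "\<And>w. w \<in> ?V \<Longrightarrow> g p (J p a - v) w = 0"
    using metric.ex_projection[OF B _ V J_fibre[OF a]] by blast
  have vF: "v \<in> fibre A p" using v(1) V by blast
  let ?b = "J p a - v"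
  have bF: "?b \<in> fibre A p" using a vF by (intro fibre_closed J_fibre)
  have "\<omega> p ?b l = 0" if "l \<in> isotropy A p" for l
    using v(2)[OF imageI[OF that]] omega_g[OF bF subsetD[OF isotropy_fibre that]] by simp
  then have "?b \<in> Lw p"
    using bF by (simp add: omega_orth_def)
  from o[OF this] have "g p (J p a) ?b = 0"
    using omega_g_left[OF a bF] by simp
  moreover have "g p v ?b = 0"
    using v(2)[OF v(1)] metric.g_sym[OF vF bF] by simp
  ultimately have "g p ?b ?b = 0"
    by (simp add: metric.g_diff J_fibre a vF bF)
  then have "?b = 0"
    using metric.g_pos[OF bF] by fastforce
  then obtain l where l: "l \<in> isotropy A p" "J p a = J p l"
    using v(1) by auto
  then have "J p (J p a) = J p (J p l)" by simp
  then have "a = l" using J_J[OF a] J_J[OF subsetD[OF isotropy_fibre l(1)]] by simp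
  then show ?thesis using l(1) by simp
qed

lemma ham_Lw: "ham f p \<in> Lw p"
  using omega_ham[of _ p f] by (auto simp: omega_orth_def isotropy_def ham_fibre)

text \<open>Vectors with the same anchor differ by an element of \<open>L\<close>. This moves the
  first argument; the second one is moved through skew symmetry when the leaf form is shown to be
  well defined.\<close>

lemma omega_anchor_cong:
  assumes "a \<in> fibre A p" "a' \<in> fibre A p" "anchor A p a = anchor A p a'" "b \<in> Lw p"
  shows "\<omega> p a b = \<omega> p a' b"
proof -
  have bF: "b \<in> fibre A p" using assms(4) Lw_fibre by blast
  have d: "a - a' \<in> fibre A p" using assms by (intro fibre_closed)
  have "a - a' \<in> isotropy A p"
    using assms d by (simp add: isotropy_def anchor_diff fun_eq_iff)
  then have "\<omega> p (a - a') b = 0"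
    using assms(4) omega_skew[OF d bF] by (simp add: omega_orth_def)
  then show ?thesis using omega_diff_left[OF assms(1,2) bF] by simp
qed

end

section \<open>Integral submanifolds of the symplectic distribution\<close>

lemma zero_tangent: "(\<lambda>u. 0) \<in> tangent_space \<A> p"
  by (simp add: tangent_space_def)

locale symplectic_leaf = compatible_algebroid A \<omega> g J
  for A :: "('m::{t2_space, second_countable_topology}, 'e::findim_inner, 'v::real_vector, 'z) algebroid_scheme"
    and \<omega> g J +
  fixes \<B> :: "('n::{t2_space, second_countable_topology}, 'd::findim_inner) atlas"
    and \<iota> :: "'n \<Rightarrow> 'm"
  assumes integral: "integral_submanifold \<B> (base A) \<iota> (symplectic_distribution A \<omega> J)"
begin

abbreviation push :: "'n tangent \<Rightarrow> 'm tangent" where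
  "push \<equiv> pushforward (base A) \<iota>"

lemma immersed: "immersed_submanifold \<B> (base A) \<iota>"
  using integral unfolding integral_submanifold_def by (elim conjE)

lemma push_tangent_space: "push ` tangent_space \<B> q = anchor A (\<iota> q) ` Lw (\<iota> q)"
proof -
  have *: "\<forall>q. push ` tangent_space \<B> q = symplectic_distribution A \<omega> J (\<iota> q)"
    using integral unfolding integral_submanifold_def by (elim conjE)
  then show ?thesis by (simp add: symplectic_distribution_def E2_L1_eq)
qed

lemma smooth_inclusion: "smooth_map \<B> (base A) \<iota>"
  using immersed unfolding immersed_submanifold_def by (elim conjE)

lemma inj_push: "inj_on push (tangent_space \<B> q)"
proof -
  have "\<forall>q. inj_on push (tangent_space \<B> q)"
    using immersed unfolding immersed_submanifold_def by (elim conjE)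
  then show ?thesis by (rule spec)
qed

sublocale N: smooth_mfd \<B>
proof
  show "smooth_manifold \<B>"
    using immersed unfolding immersed_submanifold_def by (elim conjE)
qed

lemma pullback_C_inf: "f \<in> C_inf (base A) \<Longrightarrow> f \<circ> \<iota> \<in> C_inf \<B>"
  by (rule C_inf_pullback[OF N.smooth_mfd_axioms M.smooth_mfd_axioms smooth_inclusion])

lemma push_apply: "f \<in> C_inf (base A) \<Longrightarrow> push X f = X (f \<circ> \<iota>)"
  by (simp add: pushforward_def)

lemma lift:
  assumes "X \<in> tangent_space \<B> q"
  obtains a where "a \<in> Lw (\<iota> q)" "anchor A (\<iota> q) a = push X"
proof -
  have "push X \<in> anchor A (\<iota> q) ` Lw (\<iota> q)"
    unfolding push_tangent_space[symmetric] using assms by (rule imageI)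
  then show ?thesis using that by auto
qed

lemma leaf_form_eq:
  assumes a: "a \<in> Lw (\<iota> q)" "anchor A (\<iota> q) a = push X"
    and b: "b \<in> Lw (\<iota> q)" "anchor A (\<iota> q) b = push Y"
  shows "leaf_form A \<omega> J \<iota> q X Y = \<omega> (\<iota> q) a b"
  unfolding leaf_form_def E2_L1_eq
proof (rule the_equality)
  have "\<omega> (\<iota> q) a b = \<omega> (\<iota> q) a' b'"
    if a': "a' \<in> Lw (\<iota> q)" "anchor A (\<iota> q) a' = push X"
      and b': "b' \<in> Lw (\<iota> q)" "anchor A (\<iota> q) b' = push Y" for a' b'
  proof -
    have F: "a \<in> fibre A (\<iota> q)" "a' \<in> fibre A (\<iota> q)" "b \<in> fibre A (\<iota> q)" "b' \<in> fibre A (\<iota> q)"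
      using a(1) b(1) a'(1) b'(1) Lw_fibre by blast+
    have "\<omega> (\<iota> q) a b = \<omega> (\<iota> q) a' b"
      by (rule omega_anchor_cong[OF F(1,2) _ b(1)]) (simp add: a(2) a'(2))
    moreover have "\<omega> (\<iota> q) b a' = \<omega> (\<iota> q) b' a'"
      by (rule omega_anchor_cong[OF F(3,4) _ a'(1)]) (simp add: b(2) b'(2))
    ultimately show ?thesis
      using omega_skew[OF F(2,3)] omega_skew[OF F(2,4)] by simp
  qed
  then show "\<forall>a'\<in>Lw (\<iota> q). \<forall>b'\<in>Lw (\<iota> q). anchor A (\<iota> q) a' = push X \<and> anchor A (\<iota> q) b' = push Y \<longrightarrow>
      \<omega> (\<iota> q) a b = \<omega> (\<iota> q) a' b'" by blast
  fix r
  assume "\<forall>a\<in>Lw (\<iota> q). \<forall>b\<in>Lw (\<iota> q). anchor A (\<iota> q) a = push X \<and> anchor A (\<iota> q) b = push Y \<longrightarrow>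
      r = \<omega> (\<iota> q) a b"
  then show "r = \<omega> (\<iota> q) a b" using a b by blast
qed

text \<open>The anchor of \<open>ham f\<close> lies in the distribution, hence is tangent to the
  leaf; injectivity of \<open>push\<close> on each tangent space makes the choice unique.\<close>

definition leaf_ham :: "('m \<Rightarrow> real) \<Rightarrow> 'n \<Rightarrow> 'n tangent" where
  "leaf_ham f q = (SOME X. X \<in> tangent_space \<B> q \<and> push X = anchor A (\<iota> q) (ham f (\<iota> q)))"

lemma leaf_ham_tangent: "leaf_ham f q \<in> tangent_space \<B> q"
  and push_leaf_ham: "push (leaf_ham f q) = anchor A (\<iota> q) (ham f (\<iota> q))"
proof -
  have "anchor A (\<iota> q) (ham f (\<iota> q)) \<in> push ` tangent_space \<B> q"
    unfolding push_tangent_space by (rule imageI[OF ham_Lw])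
  then have "\<exists>X. X \<in> tangent_space \<B> q \<and> push X = anchor A (\<iota> q) (ham f (\<iota> q))"
    by (metis imageE)
  then have *: "leaf_ham f q \<in> tangent_space \<B> q \<and> push (leaf_ham f q) = anchor A (\<iota> q) (ham f (\<iota> q))"
    unfolding leaf_ham_def by (rule someI_ex)
  show "leaf_ham f q \<in> tangent_space \<B> q" using * by (rule conjunct1)
  show "push (leaf_ham f q) = anchor A (\<iota> q) (ham f (\<iota> q))" using * by (rule conjunct2)
qed

text \<open>
  Since the differential of the inclusion is injective on derivations, finitely many restrictions
  of smooth functions on the base have linearly independent differentials at a given point.
\<close>

lemma ex_independent_restrictions:
  assumes c: "(V, \<psi>) \<in> \<B>" and q: "q \<in> V"
  shows "\<exists>n (F :: nat \<Rightarrow> 'm \<Rightarrow> real) (b :: nat \<Rightarrow> 'd). bij_betw b {..<n} onb \<and>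
    (\<forall>i<n. F i \<in> C_inf (base A)) \<and>
    Determinant.det (Matrix.mat n n (\<lambda>(i, j). N.chart_deriv V \<psi> q (b j) (F i \<circ> \<iota>))) \<noteq> 0"
proof -
  \<comment> \<open>\<open>G f\<close> is the gradient at \<open>q\<close>, in chart coordinates, of
    the restriction of \<open>f\<close> to the leaf.\<close>
  define G where "G f = (\<Sum>b\<in>onb. N.chart_deriv V \<psi> q b (f \<circ> \<iota>) *\<^sub>R b)" for f
  have G: "N.chart_deriv V \<psi> q v (f \<circ> \<iota>) = G f \<bullet> v" if "f \<in> C_inf (base A)" for f v
    by (subst N.chart_deriv_sum[OF c q pullback_C_inf[OF that]])
      (simp add: G_def inner_sum_left inner_commute[of v] mult.commute)
  define C where "C = G ` C_inf (base A)"
  \<comment> \<open>If the gradients did not span, some nonzero \<open>v\<close> would be orthogonal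
    to all of them. Its directional derivative would kill every restriction and so be sent to 0 by
    \<open>push\<close>, against injectivity.\<close>
  have span: "span C = UNIV"
  proof (rule ccontr)
    assume "span C \<noteq> UNIV"
    then obtain x where x: "x \<notin> span C" by blast
    interpret I: inner_on UNIV "inner :: 'd \<Rightarrow> 'd \<Rightarrow> real" by (rule inner_on_inner)
    obtain p where p: "p \<in> span C" "\<And>w. w \<in> span C \<Longrightarrow> (x - p) \<bullet> w = 0"
      using I.ex_projection[OF finite_onb, of "span C" x] by (auto simp: span_onb)
    define v where "v = x - p"
    have v: "v \<noteq> 0" using x p(1) by (auto simp: v_def)
    have "N.chart_deriv V \<psi> q v (f \<circ> \<iota>) = 0" if "f \<in> C_inf (base A)" for f
      using p(2)[of "G f"] G[OF that, of v] that
      by (simp add: v_def C_def span_base inner_commute)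
    then have "push (N.chart_deriv V \<psi> q v) = push (\<lambda>u. 0)"
      by (auto simp: pushforward_def fun_eq_iff)
    then have "N.chart_deriv V \<psi> q v = (\<lambda>u. 0)"
      by (rule inj_onD[OF inj_push[of q] _ N.chart_deriv_tangent[OF c q] zero_tangent])
    then show False using N.chart_deriv_nonzero[OF c q v] by simp
  qed
  obtain D where D: "D \<subseteq> C" "independent D" "C \<subseteq> span D"
    using maximal_independent_subset by blast
  have spanD: "span D = UNIV"
    using span span_mono[OF D(3)] by (simp add: span_span top.extremum_unique)
  have finD: "finite D"
    using independent_span_bound[OF finite_onb D(2)] by (simp add: span_onb)
  define n where "n = card (onb :: 'd set)"
  \<comment> \<open>Equal numbers of gradients and of coordinate directions, so the Jacobian matrix
    is square.\<close>
  have "card D = n"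
    using dim_eq_card[of D UNIV] dim_eq_card[of onb UNIV] D(2) spanD independent_onb span_onb
    unfolding n_def by (metis span_UNIV)
  then obtain d where d: "bij_betw d {..<n} D"
    using ex_bij_betw_nat_finite[OF finD] by (auto simp: atLeast0LessThan)
  obtain b where b: "bij_betw b {..<n} (onb :: 'd set)"
    using ex_bij_betw_nat_finite[of "onb :: 'd set"] by (auto simp: atLeast0LessThan n_def)
  have "\<forall>i<n. \<exists>f. f \<in> C_inf (base A) \<and> G f = d i"
  proof (intro allI impI)
    fix i assume "i < n"
    then have "d i \<in> C" using d D(1) by (auto simp: bij_betw_def)
    then show "\<exists>f. f \<in> C_inf (base A) \<and> G f = d i" by (auto simp: C_def)
  qed
  then obtain F where F: "\<And>i. i < n \<Longrightarrow> F i \<in> C_inf (base A)" "\<And>i. i < n \<Longrightarrow> G (F i) = d i"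
    by metis
  have "Determinant.det (Matrix.mat n n (\<lambda>(i, j). N.chart_deriv V \<psi> q (b j) (F i \<circ> \<iota>))) \<noteq> 0"
  proof (rule det_nonzero_if_kernel_trivial)
    fix v j assume v: "\<And>i. i < n \<Longrightarrow> (\<Sum>j<n. N.chart_deriv V \<psi> q (b j) (F i \<circ> \<iota>) * v j) = 0" and j: "j < n"
    define w where "w = (\<Sum>j<n. v j *\<^sub>R b j)"
    \<comment> \<open>Each row of the system is the inner product of \<open>w\<close> with a
      selected gradient, and these gradients span.\<close>
    have "w \<bullet> d i = 0" if "i < n" for i
      using v[OF that] G[OF F(1)[OF that]] F(2)[OF that]
      by (simp add: w_def inner_sum_left inner_commute[of "d i"] mult.commute)
    then have o: "w \<bullet> x = 0" if "x \<in> D" for x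
      using that d by (auto simp: bij_betw_def)
    have "w \<in> span D" by (simp add: spanD)
    then have "w \<bullet> w = 0"
      by (rule inner_on.orth_span[OF inner_on_inner UNIV_I subset_UNIV o, rotated])
    then have "w = 0" by simp
    moreover have "b j \<bullet> b i = (if i = j then 1 else 0)" if "i < n" for i
    proof -
      have "b j \<in> onb" "b i \<in> onb" "b j = b i \<longleftrightarrow> j = i"
        using b j that by (auto simp: bij_betw_def inj_on_eq_iff)
      then show ?thesis by (auto simp: inner_onb)
    qed
    then have "b j \<bullet> w = (\<Sum>i<n. if i = j then v i else 0)"
      unfolding w_def inner_sum_right by (intro sum.cong) auto
    then have "b j \<bullet> w = v j"
      using j by simp
    ultimately show "v j = 0" by simp
  qed
  then show ?thesis using b F(1) by blast
qed

text \<open>On a restriction \<open>F \<circ> \<iota>\<close> the field has the value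
  \<open>\<rho>(a\<^sub>f) F\<close> pulled back to the leaf, which is smooth. An arbitrary
  \<open>u\<close> is reached through the components of the field in a chart, recovered from such
  values by solving a linear system.\<close>

lemma leaf_ham_vector_field:
  assumes f: "f \<in> C_inf (base A)"
  shows "leaf_ham f \<in> vector_fields \<B>"
proof -
  have "(\<lambda>q. leaf_ham f q u) \<in> C_inf \<B>" if u: "u \<in> C_inf \<B>" for u
    unfolding C_inf_def mem_Collect_eq
  proof (rule N.smooth_fun_on_local)
    fix q0
    obtain V \<psi> where c: "(V, \<psi>) \<in> \<B>" "q0 \<in> V" by (rule N.ex_chart)
    note V = N.open_chart(1)[OF c(1)]
    obtain n and F :: "nat \<Rightarrow> 'm \<Rightarrow> real" and b :: "nat \<Rightarrow> 'd" where b: "bij_betw b {..<n} onb"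
      and F: "\<forall>i<n. F i \<in> C_inf (base A)"
      and det0: "Determinant.det (Matrix.mat n n (\<lambda>(i, j). N.chart_deriv V \<psi> q0 (b j) (F i \<circ> \<iota>))) \<noteq> 0"
      using ex_independent_restrictions[OF c] by blast
    let ?m = "\<lambda>i j q. N.chart_deriv V \<psi> q (b j) (F i \<circ> \<iota>)"
    let ?det = "\<lambda>q. Determinant.det (Matrix.mat n n (\<lambda>(i, j). ?m i j q))"
    have m: "smooth_fun_on \<B> V (?m i j)" if "i < n" for i j
      using F that by (intro N.smooth_chart_deriv[OF c(1)] pullback_C_inf) auto
    \<comment> \<open>The restrictions are independent at \<open>q0\<close> only; continuity of the
      determinant extends this to an open neighbourhood \<open>W\<close>.\<close>
    have "continuous_on V ?det"
      by (intro N.smooth_fun_on_imp_continuous_on[OF V] N.smooth_fun_on_det[OF V] m)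
    then have "open (V \<inter> ?det -` (- {0}))"
      by (rule continuous_open_preimage[OF _ V]) (simp add: open_Compl)
    moreover define W where "W = V \<inter> ?det -` (- {0})"
    ultimately have W: "open W" "W \<subseteq> V" "q0 \<in> W"
      using c(2) det0 by auto
    \<comment> \<open>The model vectors \<open>\<xi> q\<close> are selected point by point; the
      regularity of their components comes from the system solved in \<open>coeff\<close>.\<close>
    have "\<forall>q\<in>W. \<exists>v. leaf_ham f q = N.chart_deriv V \<psi> q v"
      using N.tangent_space_chart_deriv[OF leaf_ham_tangent c(1)] W(2) by blast
    then obtain \<xi> where \<xi>: "\<And>q. q \<in> W \<Longrightarrow> leaf_ham f q = N.chart_deriv V \<psi> q (\<xi> q)"
      by metis
    have expand: "leaf_ham f q u = (\<Sum>j<n. (\<xi> q \<bullet> b j) * N.chart_deriv V \<psi> q (b j) u)"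
      if "q \<in> W" "u \<in> C_inf \<B>" for q u
    proof -
      have "q \<in> V" using that(1) W(2) by blast
      then have "leaf_ham f q u = (\<Sum>b\<in>onb. (\<xi> q \<bullet> b) * N.chart_deriv V \<psi> q b u)"
        unfolding \<xi>[OF that(1)] by (rule N.chart_deriv_sum[OF c(1) _ that(2)])
      also have "\<dots> = (\<Sum>j<n. (\<xi> q \<bullet> b j) * N.chart_deriv V \<psi> q (b j) u)"
        by (rule sum.reindex_bij_betw[OF b, symmetric])
      finally show ?thesis .
    qed
    have coeff: "smooth_fun_on \<B> W (\<lambda>q. \<xi> q \<bullet> b k)" if k: "k < n" for k
    proof (rule N.smooth_fun_on_solution[where c = "\<lambda>j q. \<xi> q \<bullet> b j" and m = ?m and n = n
          and y = "\<lambda>i. (\<lambda>p. anchor A p (ham f p) (F i)) \<circ> \<iota>", OF W(1) _ _ _ _ k])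
      show "smooth_fun_on \<B> W (?m i j)" if "i < n" "j < n" for i j
        by (rule N.smooth_fun_on_subset[OF m[OF that(1)] W(2)])
      show "smooth_fun_on \<B> W ((\<lambda>p. anchor A p (ham f p) (F i)) \<circ> \<iota>)" if "i < n" for i
        using F that
        by (intro N.C_inf_smooth_fun_on pullback_C_inf anchor_section_smooth ham_section f) auto
      show "?det q \<noteq> 0" if "q \<in> W" for q
        using that by (simp add: W_def)
      show "(\<Sum>j<n. ?m i j q * (\<xi> q \<bullet> b j)) = ((\<lambda>p. anchor A p (ham f p) (F i)) \<circ> \<iota>) q"
        if "q \<in> W" "i < n" for q i
      proof -
        have Fi: "F i \<in> C_inf (base A)" using F that(2) by simp
        have "anchor A (\<iota> q) (ham f (\<iota> q)) (F i) = leaf_ham f q (F i \<circ> \<iota>)"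
          unfolding push_leaf_ham[symmetric] by (rule push_apply[OF Fi])
        also have "\<dots> = (\<Sum>j<n. (\<xi> q \<bullet> b j) * ?m i j q)"
          by (rule expand[OF that(1) pullback_C_inf[OF Fi]])
        finally show ?thesis by (simp add: mult.commute)
      qed
    qed
    have "smooth_fun_on \<B> W (\<lambda>q. \<Sum>j<n. (\<xi> q \<bullet> b j) * N.chart_deriv V \<psi> q (b j) u)"
      by (intro N.smooth_fun_on_sum N.smooth_fun_on_mult W(1) coeff
          N.smooth_fun_on_subset[OF N.smooth_chart_deriv[OF c(1) u] W(2)]) auto
    then have "smooth_fun_on \<B> W (\<lambda>q. leaf_ham f q u)"
      by (rule N.smooth_fun_on_cong[OF W(1), rotated]) (simp add: expand u)
    then show "\<exists>T. open T \<and> q0 \<in> T \<and> smooth_fun_on \<B> T (\<lambda>q. leaf_ham f q u)"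
      using W by blast
  qed
  then show ?thesis
    by (simp add: vector_fields_def leaf_ham_tangent)
qed

text \<open>For a lift \<open>b\<close> of \<open>Y\<close> the defining equation of
  \<open>ham f\<close> reads \<open>\<omega> (ham f) b = \<rho>(b) f\<close>, and
  \<open>\<rho>(b)\<close> is the push-forward of \<open>Y\<close>.\<close>

lemma leaf_form_leaf_ham:
  assumes f: "f \<in> C_inf (base A)" and Y: "Y \<in> tangent_space \<B> q"
  shows "leaf_form A \<omega> J \<iota> q (leaf_ham f q) Y = Y (f \<circ> \<iota>)"
proof -
  obtain b where b: "b \<in> Lw (\<iota> q)" "anchor A (\<iota> q) b = push Y"
    by (rule lift[OF Y])
  have bF: "b \<in> fibre A (\<iota> q)" using b(1) Lw_fibre by blast
  have "leaf_form A \<omega> J \<iota> q (leaf_ham f q) Y = \<omega> (\<iota> q) (ham f (\<iota> q)) b"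
    by (rule leaf_form_eq[OF ham_Lw push_leaf_ham[symmetric] b])
  also have "\<dots> = push Y f"
    using omega_ham[OF bF] b(2) by simp
  finally show ?thesis by (simp add: push_apply f)
qed

text \<open>The difference of lifts of \<open>X\<close> and \<open>X'\<close> is
  \<open>\<omega>\<close>-orthogonal to \<open>Lw\<close>, hence lies in \<open>L\<close> by
  \<open>Lw_dual\<close>. So \<open>X\<close> and \<open>X'\<close> have the same push-forward, and
  \<open>push\<close> is injective.\<close>

lemma leaf_form_nondegenerate:
  assumes X: "X \<in> tangent_space \<B> q" "X' \<in> tangent_space \<B> q"
    and eq: "\<And>Y. Y \<in> tangent_space \<B> q \<Longrightarrow> leaf_form A \<omega> J \<iota> q X Y = leaf_form A \<omega> J \<iota> q X' Y"
  shows "X = X'"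
proof -
  obtain a where a: "a \<in> Lw (\<iota> q)" "anchor A (\<iota> q) a = push X" by (rule lift[OF X(1)])
  obtain a' where a': "a' \<in> Lw (\<iota> q)" "anchor A (\<iota> q) a' = push X'" by (rule lift[OF X(2)])
  have F: "a \<in> fibre A (\<iota> q)" "a' \<in> fibre A (\<iota> q)" using a(1) a'(1) Lw_fibre by blast+
  have "\<omega> (\<iota> q) (a - a') b = 0" if b: "b \<in> Lw (\<iota> q)" for b
  proof -
    \<comment> \<open>The hypothesis speaks of tangent vectors \<open>Y\<close>; it reaches every
      \<open>b\<close> in \<open>Lw\<close> because the whole distribution is tangent to the
      leaf.\<close>
    have "anchor A (\<iota> q) b \<in> push ` tangent_space \<B> q"
      unfolding push_tangent_space using b by (rule imageI)
    then obtain Y where Y: "anchor A (\<iota> q) b = push Y" "Y \<in> tangent_space \<B> q" by (rule imageE)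
    have "\<omega> (\<iota> q) a b = \<omega> (\<iota> q) a' b"
      using eq[OF Y(2)] leaf_form_eq[OF a b Y(1)] leaf_form_eq[OF a' b Y(1)] by simp
    then show ?thesis
      using omega_diff_left[OF F, of b] b Lw_fibre by (simp add: subset_iff)
  qed
  then have "a - a' \<in> isotropy A (\<iota> q)"
    by (rule Lw_dual[OF fibre_closed(3)[OF F]])
  then have "anchor A (\<iota> q) a = anchor A (\<iota> q) a'"
    using F by (simp add: isotropy_def fun_eq_iff anchor_diff)
  then have "push X = push X'" using a(2) a'(2) by simp
  then show ?thesis by (rule inj_onD[OF inj_push[of q] _ X])
qed

lemma hamiltonian_field_eq:
  assumes f: "f \<in> C_inf (base A)"
  shows "hamiltonian_field \<B> (leaf_form A \<omega> J \<iota>) (f \<circ> \<iota>) = leaf_ham f"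
  unfolding hamiltonian_field_def
proof (rule the_equality)
  show "leaf_ham f \<in> vector_fields \<B> \<and>
      (\<forall>q. \<forall>Y\<in>tangent_space \<B> q. Y (f \<circ> \<iota>) = leaf_form A \<omega> J \<iota> q (leaf_ham f q) Y)"
    by (simp add: leaf_ham_vector_field f leaf_form_leaf_ham)
  fix X
  assume X: "X \<in> vector_fields \<B> \<and> (\<forall>q. \<forall>Y\<in>tangent_space \<B> q. Y (f \<circ> \<iota>) = leaf_form A \<omega> J \<iota> q (X q) Y)"
  show "X = leaf_ham f"
  proof
    fix q
    have "X q \<in> tangent_space \<B> q" using X by (simp add: vector_fields_def)
    moreover have "leaf_form A \<omega> J \<iota> q (X q) Y = leaf_form A \<omega> J \<iota> q (leaf_ham f q) Y"
      if "Y \<in> tangent_space \<B> q" for Y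
      using conjunct2[OF X, rule_format, OF that] leaf_form_leaf_ham[OF f that] by (simp only:)
    ultimately show "X q = leaf_ham f q"
      by (rule leaf_form_nondegenerate[OF _ leaf_ham_tangent])
  qed
qed

end

theorem theorem3p12:
  fixes A :: "('m::{t2_space, second_countable_topology}, 'e::findim_inner, 'v::real_vector) algebroid"
    and \<omega> g :: "'m \<Rightarrow> 'v \<Rightarrow> 'v \<Rightarrow> real"
    and J :: "'m \<Rightarrow> 'v \<Rightarrow> 'v"
    and \<B> :: "('n::{t2_space, second_countable_topology}, 'd::findim_inner) atlas"
    and \<iota> :: "'n \<Rightarrow> 'm"
    and f h :: "'m \<Rightarrow> real"
  assumes "lie_algebroid A"
    and "compatible_triple A \<omega> J g"
    and "integral_submanifold \<B> (base A) \<iota> (symplectic_distribution A \<omega> J)"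
    and "f \<in> C_inf (base A)" and "h \<in> C_inf (base A)"
  shows "poisson A \<omega> f h \<circ> \<iota> = manifold_poisson \<B> (leaf_form A \<omega> J \<iota>) (f \<circ> \<iota>) (h \<circ> \<iota>)"
proof -
  interpret symplectic_leaf A \<omega> g J \<B> \<iota>
    by unfold_locales (use assms in blast)+
  show ?thesis
  proof
    fix q
    have "manifold_poisson \<B> (leaf_form A \<omega> J \<iota>) (f \<circ> \<iota>) (h \<circ> \<iota>) q =
        leaf_form A \<omega> J \<iota> q (leaf_ham f q) (leaf_ham h q)"
      by (simp add: manifold_poisson_def hamiltonian_field_eq assms)
    \<comment> \<open>The Hamiltonian sections at \<open>\<iota> q\<close> are themselves admissible
      lifts of the two leaf fields, so the leaf form is evaluated on them.\<close>
    also have "\<dots> = \<omega> (\<iota> q) (ham f (\<iota> q)) (ham h (\<iota> q))"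
      by (rule leaf_form_eq[OF ham_Lw push_leaf_ham[symmetric] ham_Lw push_leaf_ham[symmetric]])
    also have "\<dots> = (poisson A \<omega> f h \<circ> \<iota>) q"
      by (simp add: poisson_def hamiltonian_section_eq_ham assms)
    finally show "(poisson A \<omega> f h \<circ> \<iota>) q =
        manifold_poisson \<B> (leaf_form A \<omega> J \<iota>) (f \<circ> \<iota>) (h \<circ> \<iota>) q" by simp
  qed
qed

end
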